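(* Let $d>0$ be a square free integer, $F=\mathbb{Q}(\sqrt{-d})\subset\mathbb{C}$, and let $p$ be a prime number which splits completely in $F/\mathbb{Q}$. Fix an isomorphism of fields $\mathbb{C}\simeq\overline{\mathbb{Q}}_p$, used to identify the two fields (so $F\subset\mathbb{Q}_p$). Let $\theta=\frac{-1+\sqrt{-d}}{2}$ if $-d\equiv1\bmod4$ and $\theta=\sqrt{-d}$ otherwise. Consider the $\{\infty,p\}$-continued fraction expansion of $\theta$ with associated $x_k$, $B_k$; it is purely periodic. Let $N$ be the smallest positive integer with $\theta=x_1=x_{N+1}$, let $(s_N,t_N)$ be the second row of $B_N^{-1}\in SL_2(\mathbb{Z}[1/p])$, and put $s=p^Ns_N$, $t=p^Nt_N$ (which are relatively prime integers). (i) If $-d\not\equiv1\bmod4$, then the solutions $(x,y,\nu)$ to the Pell-like equation $x^2+dy^2=p^{2\nu}$, where $x$ and $y$ are relatively prime integers and $\nu\in\mathbb{N}$, are exactly of the form $$x+\sqrt{-d}\,y=\zeta(t\pm\sqrt{-d}\,s)^r,\quad\nu=rN,$$ where $\zeta$ is a root of unity in $F$ and $r\in\mathbb{N}$. (ii) If $-d\equiv1\bmod4$, then the solutions $(x,y,\nu)$ to the Pell-like equation $4x^2-4xy+(1+d)y^2=4p^{2\nu}$, where $x$ and $y$ are relatively prime integers and $\nu\in\mathbb{N}$, are exactly of the form $$x+\frac{-1+\sqrt{-d}}{2}y=\zeta\Big(t+\frac{-1\pm\sqrt{-d}}{2}s\Big)^r,\quad\nu=rN,$$ where $\zeta$ is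 a root of unity in $F$ and $r\in\mathbb{N}$.
   Context: $\mathbb{N}$ includes $0$. $\mathfrak{h}=\{z\in\mathbb{C}:\Im z>0\}$; $\sqrt{-d}$ is the root in $\mathfrak{h}$. $\mathcal{D}=\{z\in\mathfrak{h}:|z|>1,\ -\frac12\le\Re z<\frac12\}\cup\{e^{i\alpha}:\alpha\in[\pi/2,2\pi/3]\}$. Matrices in $SL_2(\mathbb{Z}[1/p])$ act by linear fractional transformations. $\{\infty,p\}$-continued fraction expansion of $z\in\mathfrak{h}\cap\mathbb{Q}_p$. Set $x_1=z$. For $x_k$, $k\ge1$, do the following. Initialization: if $x_k\in\mathbb{Z}_p$, set $z_k=x_k$ and $D_k=I$ (identity matrix); otherwise set $z_k=-1/x_k\in\mathbb{Z}_p$ and $D_k=\begin{pmatrix}0&-1\\1&0\end{pmatrix}$. $p$-adic reduction: determine $a_k\in\{0,\dots,p^2-1\}$ such that $z_k-a_k\equiv0\bmod p^2$ (in $\mathbb{Z}_p$), and set $z_{k0}=(z_k-a_k)/p^2$, $P_k=\begin{pmatrix}1/p&0\\0&p\end{pmatrix}\begin{pmatrix}1&-a_k\\0&1\end{pmatrix}$. $\infty$-adic reduction: for $j\ge0$, if $z_{kj}\in\mathcal{D}$, set $x_{k+1}=z_{kj}$ and go to the initialization step for $k+1$; if not, determine $b_{kj}\in\mathbb{Z}$ so that $-\frac12\le\Re(z_{kj}-b_{kj})<\frac12$ and set $z_{k,j+1}=-1/(z_{kj}-b_{kj})$. The $\infty$-adic reduction is asserted to end within a finite number of steps, so that the algorithm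 is well defined. If $b_{k0},\dots,b_{kl_k}$ are the integers so obtained, set $Q_k=\begin{pmatrix}0&-1\\1&-b_{kl_k}\end{pmatrix}\cdots\begin{pmatrix}0&-1\\1&-b_{k0}\end{pmatrix}$ (the empty product being $I$). Put $A_k^{-1}=Q_kP_kD_k$ and $B_k=A_1\cdots A_k\in SL_2(\mathbb{Z}[1/p])$, so that $x_{k+1}=A_k^{-1}x_k=B_k^{-1}x_1$. Purely periodic means that $x_1=x_{N+1}$ for some integer $N\ge1$.
   Formalization: For d = 3 the ∞-adic reduction as printed never ends (it gets stuck at exp(iπ/3), outside D), so for d = 3 the periodicity and the description of solutions are asserted only on the condition that the expansion is defined. *)

theory Defs
  imports
    "HOL-Analysis.Analysis"
    "HOL-Algebra.Algebraic_Closure_Type"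
    "HOL-Algebra.Ideal_Product"
    "HOL-Algebra.QuotRing"
    "HOL-Number_Theory.Cong"
begin

section \<open>The field of p-adic numbers and its algebraic closure\<close>

definition padic_norm :: "nat \<Rightarrow> rat \<Rightarrow> real" where
  "padic_norm p q = (if q = 0 then 0 else
     real p powi (int (multiplicity (int p) (snd (quotient_of q)))
                - int (multiplicity (int p) (fst (quotient_of q)))))"

definition padic_cauchy :: "nat \<Rightarrow> (nat \<Rightarrow> rat) set" where
  "padic_cauchy p = {u. \<forall>e>0. \<exists>M. \<forall>m\<ge>M. \<forall>n\<ge>M. padic_norm p (u m - u n) < e}"

definition padic_null :: "nat \<Rightarrow> (nat \<Rightarrow> rat) set" where
  "padic_null p = {u. (\<lambda>n. padic_norm p (u n)) \<longlonglongrightarrow> 0}"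

definition cauchy_ring :: "nat \<Rightarrow> (nat \<Rightarrow> rat) ring" where
  "cauchy_ring p = \<lparr>carrier = padic_cauchy p, monoid.mult = (\<lambda>u v n. u n * v n),
     one = (\<lambda>_. 1), zero = (\<lambda>_. 0), add = (\<lambda>u v n. u n + v n)\<rparr>"

text \<open>The completion of the rationals with respect to the p-adic absolute value.\<close>

definition Qp :: "nat \<Rightarrow> (nat \<Rightarrow> rat) set ring" where
  "Qp p = cauchy_ring p Quot padic_null p"

lemma padic_norm_nonneg: "padic_norm p q \<ge> 0"
  by (simp add: padic_norm_def)

lemma padic_norm_0: "padic_norm p 0 = 0"
  by (simp add: padic_norm_def)

context
  fixes p :: nat
  assumes p: "Factorial_Ring.prime p"
begin

lemma p_elem: "prime_elem (int p)"
  using p by simp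

lemma p_gt: "real p > 1"
  using p prime_gt_1_nat by auto

lemma padic_norm_eq_0_iff: "padic_norm p q = 0 \<longleftrightarrow> q = 0"
  using p_gt by (auto simp: padic_norm_def)

lemma padic_norm_frac:
  assumes "a \<noteq> 0" "b \<noteq> 0"
  shows "padic_norm p (of_int a / of_int b) =
    real p powi (int (multiplicity (int p) b) - int (multiplicity (int p) a))"
proof -
  obtain n e where q: "quotient_of (of_int a / of_int b) = (n, e)" by fastforce
  have e: "e > 0" using quotient_of_denom_pos q by blast
  have *: "(of_int a / of_int b :: rat) = of_int n / of_int e" using quotient_of_div[OF q] .
  have n: "n \<noteq> 0" using * assms e by auto
  have "(of_int (a * e) :: rat) = of_int (n * b)" using * assms e by (simp add: field_simps)
  hence "a * e = n * b" by (simp only: of_int_eq_iff)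
  hence "multiplicity (int p) a + multiplicity (int p) e = multiplicity (int p) n + multiplicity (int p) b"
    using prime_elem_multiplicity_mult_distrib[OF p_elem] assms n e by (metis less_irrefl)
  hence "int (multiplicity (int p) e) - int (multiplicity (int p) n)
     = int (multiplicity (int p) b) - int (multiplicity (int p) a)" by linarith
  thus ?thesis using q assms by (simp add: padic_norm_def)
qed

lemma rat_frac: obtains a b :: int where "b \<noteq> 0" "(q :: rat) = of_int a / of_int b"
  by (metis quotient_of_denom_pos quotient_of_div less_irrefl surj_pair)

lemma padic_norm_mult: "padic_norm p (q * r) = padic_norm p q * padic_norm p r"
proof (cases "q = 0 \<or> r = 0")
  case True thus ?thesis by (auto simp: padic_norm_0)
next
  case False
  obtain a b where b: "b \<noteq> 0" and q: "q = of_int a / of_int b" by (rule rat_frac)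
  obtain c e where e: "e \<noteq> 0" and r: "r = of_int c / of_int e" by (rule rat_frac)
  have a: "a \<noteq> 0" and c: "c \<noteq> 0" using False q r by auto
  have "q * r = of_int (a * c) / of_int (b * e)" using q r by simp
  hence "padic_norm p (q * r) = real p powi (int (multiplicity (int p) (b * e)) - int (multiplicity (int p) (a * c)))"
    using padic_norm_frac[of "a * c" "b * e"] a b c e by simp
  also have "\<dots> = real p powi ((int (multiplicity (int p) b) - int (multiplicity (int p) a))
      + (int (multiplicity (int p) e) - int (multiplicity (int p) c)))"
    using a b c e by (simp add: prime_elem_multiplicity_mult_distrib[OF p_elem] algebra_simps)
  also have "\<dots> = padic_norm p q * padic_norm p r"
    using p_gt padic_norm_frac a b c e q r by (simp add: power_int_add)
  finally show ?thesis .
qed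

lemma padic_norm_add: "padic_norm p (q + r) \<le> max (padic_norm p q) (padic_norm p r)"
proof (cases "q = 0 \<or> r = 0 \<or> q + r = 0")
  case True thus ?thesis using padic_norm_nonneg[of p q] padic_norm_nonneg[of p r] by (auto simp: padic_norm_0)
next
  case False
  obtain a' b where b: "b \<noteq> 0" and q': "q = of_int a' / of_int b" by (rule rat_frac)
  obtain c' e where e: "e \<noteq> 0" and r': "r = of_int c' / of_int e" by (rule rat_frac)
  define a c f where "a = a' * e" and "c = c' * b" and "f = b * e"
  have f: "f \<noteq> 0" and q: "q = of_int a / of_int f" and r: "r = of_int c / of_int f"
    using b e q' r' by (auto simp: a_def c_def f_def)
  have qr: "q + r = of_int (a + c) / of_int f" using q r by (simp add: add_divide_distrib)
  have a: "a \<noteq> 0" and c: "c \<noteq> 0" and ac: "a + c \<noteq> 0" using False q r qr by auto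
  define m where "m = min (multiplicity (int p) a) (multiplicity (int p) c)"
  have "int p ^ m dvd a + c"
    by (intro dvd_add) (auto simp: m_def intro: multiplicity_dvd')
  hence "multiplicity (int p) (a + c) \<ge> m"
    using ac p_elem by (intro multiplicity_geI) auto
  hence m: "int (multiplicity (int p) f) - int (multiplicity (int p) (a + c)) \<le> int (multiplicity (int p) f) - int m"
    by simp
  have "padic_norm p (q + r) = real p powi (int (multiplicity (int p) f) - int (multiplicity (int p) (a + c)))"
    using qr padic_norm_frac[OF ac f] by simp
  also have "\<dots> \<le> real p powi (int (multiplicity (int p) f) - int m)"
    using m p_gt by (intro power_int_increasing) auto
  also have "\<dots> \<le> max (padic_norm p q) (padic_norm p r)"
    using padic_norm_frac[OF a f] padic_norm_frac[OF c f] q r by (auto simp: m_def min_def)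
  finally show ?thesis .
qed

lemma padic_norm_minus: "padic_norm p (- q) = padic_norm p q"
proof -
  have "padic_norm p (-1) * padic_norm p (-1) = padic_norm p 1"
    using padic_norm_mult[of "-1" "-1"] by simp
  moreover have "padic_norm p 1 = 1" by (simp add: padic_norm_def)
  ultimately have "(padic_norm p (-1))\<^sup>2 = 1" by (simp add: power2_eq_square)
  hence "padic_norm p (-1) = 1" using padic_norm_nonneg[of p "-1"] by (simp add: power2_eq_1_iff)
  thus ?thesis using padic_norm_mult[of "-1" q] by simp
qed

lemma padic_norm_1: "padic_norm p 1 = 1"
  by (simp add: padic_norm_def)

lemma padic_norm_triangle: "padic_norm p (q + r) \<le> padic_norm p q + padic_norm p r"
  using padic_norm_add[of q r] padic_norm_nonneg[of p q] padic_norm_nonneg[of p r] by linarith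

lemma padic_norm_triangle': "padic_norm p (q - r) \<le> padic_norm p q + padic_norm p r"
  using padic_norm_triangle[of q "- r"] by (simp add: padic_norm_minus)

lemma cauchy_bounded:
  assumes "u \<in> padic_cauchy p"
  shows "\<exists>B>0. \<forall>n. padic_norm p (u n) \<le> B"
proof -
  obtain M where M: "\<And>m n. m \<ge> M \<Longrightarrow> n \<ge> M \<Longrightarrow> padic_norm p (u m - u n) < 1"
    using assms zero_less_one unfolding padic_cauchy_def by blast
  define B where "B = Max ((\<lambda>n. padic_norm p (u n)) ` {..M}) + 1"
  have *: "padic_norm p (u n) \<le> B - 1" if "n \<le> M" for n
    using that by (auto simp: B_def)
  have "padic_norm p (u n) \<le> B" for n
  proof (cases "n \<le> M")
    case False
    have "padic_norm p (u n) = padic_norm p (u M + (u n - u M))" by simp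
    also have "\<dots> \<le> padic_norm p (u M) + padic_norm p (u n - u M)" by (rule padic_norm_triangle)
    also have "\<dots> \<le> (B - 1) + 1" using *[of M] M[of n M] False by (intro add_mono) auto
    finally show ?thesis by simp
  qed (use * in fastforce)
  moreover have "B > 0" using *[of M] padic_norm_nonneg[of p "u M"] by simp
  ultimately show ?thesis by blast
qed

lemma cauchy_const: "(\<lambda>_. c) \<in> padic_cauchy p"
  by (simp add: padic_cauchy_def padic_norm_0)

lemma cauchy_add:
  assumes "u \<in> padic_cauchy p" "v \<in> padic_cauchy p"
  shows "(\<lambda>n. u n + v n) \<in> padic_cauchy p"
  unfolding padic_cauchy_def
proof (clarify)
  fix e :: real assume e: "e > 0"
  obtain M where M: "\<forall>m\<ge>M. \<forall>n\<ge>M. padic_norm p (u m - u n) < e"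
    using assms(1) e by (auto simp: padic_cauchy_def)
  obtain M' where M': "\<forall>m\<ge>M'. \<forall>n\<ge>M'. padic_norm p (v m - v n) < e"
    using assms(2) e by (auto simp: padic_cauchy_def)
  show "\<exists>M. \<forall>m\<ge>M. \<forall>n\<ge>M. padic_norm p (u m + v m - (u n + v n)) < e"
  proof (intro exI allI impI)
    fix m n assume mn: "m \<ge> max M M'" "n \<ge> max M M'"
    have "padic_norm p ((u m - u n) + (v m - v n)) < e"
      using padic_norm_add[of "u m - u n" "v m - v n"] M M' mn by fastforce
    thus "padic_norm p (u m + v m - (u n + v n)) < e" by (simp add: algebra_simps)
  qed
qed

lemma cauchy_mult:
  assumes "u \<in> padic_cauchy p" "v \<in> padic_cauchy p"
  shows "(\<lambda>n. u n * v n) \<in> padic_cauchy p"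
  unfolding padic_cauchy_def
proof (clarify)
  fix e :: real assume e: "e > 0"
  obtain B where B: "B > 0" "\<And>n. padic_norm p (u n) \<le> B" using cauchy_bounded assms by blast
  obtain B' where B': "B' > 0" "\<And>n. padic_norm p (v n) \<le> B'" using cauchy_bounded assms by blast
  have "e / B' > 0" "e / B > 0" using e B B' by auto
  obtain M where M: "\<forall>m\<ge>M. \<forall>n\<ge>M. padic_norm p (u m - u n) < e / B'"
    using assms(1) \<open>e / B' > 0\<close> unfolding padic_cauchy_def by blast
  obtain M' where M': "\<forall>m\<ge>M'. \<forall>n\<ge>M'. padic_norm p (v m - v n) < e / B"
    using assms(2) \<open>e / B > 0\<close> unfolding padic_cauchy_def by blast
  show "\<exists>M. \<forall>m\<ge>M. \<forall>n\<ge>M. padic_norm p (u m * v m - u n * v n) < e"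
  proof (intro exI allI impI)
    fix m n assume mn: "m \<ge> max M M'" "n \<ge> max M M'"
    have "padic_norm p ((u m - u n) * v m) \<le> padic_norm p (u m - u n) * B'"
      using B' by (simp add: padic_norm_mult mult_left_mono padic_norm_nonneg)
    also have "\<dots> < e" using M mn B' by (simp add: pos_less_divide_eq)
    finally have 1: "padic_norm p ((u m - u n) * v m) < e" .
    have "padic_norm p (u n * (v m - v n)) \<le> B * padic_norm p (v m - v n)"
      using B by (simp add: padic_norm_mult mult_right_mono padic_norm_nonneg)
    also have "\<dots> < e" using M' mn B by (simp add: pos_less_divide_eq mult.commute)
    finally have 2: "padic_norm p (u n * (v m - v n)) < e" .
    have "u m * v m - u n * v n = (u m - u n) * v m + u n * (v m - v n)" by (simp add: algebra_simps)
    thus "padic_norm p (u m * v m - u n * v n) < e"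
      using padic_norm_add[of "(u m - u n) * v m" "u n * (v m - v n)"] 1 2 by simp
  qed
qed

lemma null_cauchy: "padic_null p \<subseteq> padic_cauchy p"
proof
  fix u assume u: "u \<in> padic_null p"
  show "u \<in> padic_cauchy p"
    unfolding padic_cauchy_def
  proof clarify
    fix e :: real assume "e > 0"
    then obtain M where M: "\<forall>n\<ge>M. padic_norm p (u n) < e"
      using u LIMSEQ_D[of "\<lambda>n. padic_norm p (u n)" 0 e] padic_norm_nonneg
      by (auto simp: padic_null_def)
    show "\<exists>M. \<forall>m\<ge>M. \<forall>n\<ge>M. padic_norm p (u m - u n) < e"
    proof (intro exI allI impI)
      fix m n assume "m \<ge> M" "n \<ge> M"
      thus "padic_norm p (u m - u n) < e"
        using padic_norm_add[of "u m" "- u n"] M by (auto simp: padic_norm_minus intro: le_less_trans)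
    qed
  qed
qed

lemma null_add:
  assumes "u \<in> padic_null p" "v \<in> padic_null p"
  shows "(\<lambda>n. u n + v n) \<in> padic_null p"
proof -
  have "(\<lambda>n. padic_norm p (u n) + padic_norm p (v n)) \<longlonglongrightarrow> 0 + 0"
    using assms unfolding padic_null_def by (intro tendsto_add) auto
  hence *: "(\<lambda>n. padic_norm p (u n) + padic_norm p (v n)) \<longlonglongrightarrow> 0" by simp
  show ?thesis unfolding padic_null_def
    by (auto intro!: tendsto_sandwich[OF _ _ tendsto_const *] simp: padic_norm_nonneg padic_norm_triangle)
qed

lemma null_mult:
  assumes "u \<in> padic_null p" "v \<in> padic_cauchy p"
  shows "(\<lambda>n. u n * v n) \<in> padic_null p"
proof -
  obtain B where B: "B > 0" "\<And>n. padic_norm p (v n) \<le> B" using cauchy_bounded assms by blast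
  have "(\<lambda>n. padic_norm p (u n) * B) \<longlonglongrightarrow> 0 * B"
    using assms unfolding padic_null_def by (intro tendsto_mult) auto
  hence *: "(\<lambda>n. padic_norm p (u n) * B) \<longlonglongrightarrow> 0" by simp
  show ?thesis unfolding padic_null_def
    using B by (auto intro!: tendsto_sandwich[OF _ _ tendsto_const *]
        simp: padic_norm_nonneg padic_norm_mult mult_left_mono)
qed

lemma cauchy_uminus: "u \<in> padic_cauchy p \<Longrightarrow> (\<lambda>n. - u n) \<in> padic_cauchy p"
  using cauchy_mult[OF cauchy_const[of "-1"]] by fastforce

lemma null_uminus: "u \<in> padic_null p \<Longrightarrow> (\<lambda>n. - u n) \<in> padic_null p"
  by (simp add: padic_null_def padic_norm_minus)

lemma cring_cauchy_ring: "cring (cauchy_ring p)"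
proof (intro cringI abelian_groupI comm_monoidI)
  fix u assume "u \<in> carrier (cauchy_ring p)"
  thus "\<exists>v\<in>carrier (cauchy_ring p). v \<oplus>\<^bsub>cauchy_ring p\<^esub> u = \<zero>\<^bsub>cauchy_ring p\<^esub>"
    by (intro bexI[of _ "\<lambda>n. - u n"]) (auto simp: cauchy_ring_def cauchy_uminus)
qed (auto simp: cauchy_ring_def cauchy_add cauchy_mult cauchy_const algebra_simps)

lemma ideal_padic_null: "ideal (padic_null p) (cauchy_ring p)"
proof -
  interpret cring "cauchy_ring p" by (rule cring_cauchy_ring)
  show ?thesis
  proof (rule idealI)
    show "subgroup (padic_null p) (add_monoid (cauchy_ring p))"
    proof (rule group.subgroupI)
      show "group (add_monoid (cauchy_ring p))" by (rule add.is_group)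
      show "padic_null p \<subseteq> carrier (add_monoid (cauchy_ring p))"
        using null_cauchy by (simp add: cauchy_ring_def)
      show "padic_null p \<noteq> {}"
        using padic_norm_0 by (auto simp: padic_null_def intro!: exI[of _ "\<lambda>_. 0"])
    next
      fix u assume u: "u \<in> padic_null p"
      have "inv\<^bsub>add_monoid (cauchy_ring p)\<^esub> u = (\<lambda>n. - u n)"
        unfolding a_inv_def[symmetric]
        by (rule minus_equality) (use u null_cauchy cauchy_uminus in \<open>auto simp: cauchy_ring_def\<close>)
      thus "inv\<^bsub>add_monoid (cauchy_ring p)\<^esub> u \<in> padic_null p" using u null_uminus by simp
    next
      fix u v assume "u \<in> padic_null p" "v \<in> padic_null p"
      thus "u \<otimes>\<^bsub>add_monoid (cauchy_ring p)\<^esub> v \<in> padic_null p"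
        by (simp add: cauchy_ring_def null_add)
    qed
  next
    show "ring (cauchy_ring p)" by (rule ring_axioms)
  next
    fix a x assume "a \<in> padic_null p" "x \<in> carrier (cauchy_ring p)"
    thus "x \<otimes>\<^bsub>cauchy_ring p\<^esub> a \<in> padic_null p" "a \<otimes>\<^bsub>cauchy_ring p\<^esub> x \<in> padic_null p"
      using null_mult[of a x] by (simp_all add: cauchy_ring_def mult.commute)
  qed
qed

lemma cauchy_away:
  assumes "u \<in> padic_cauchy p" "u \<notin> padic_null p"
  shows "\<exists>e>0. \<exists>M. \<forall>n\<ge>M. padic_norm p (u n) \<ge> e"
proof -
  obtain e where e: "e > 0" "\<And>M. \<exists>n\<ge>M. \<not> padic_norm p (u n) < e"
    using assms(2) padic_norm_nonneg by (auto simp: padic_null_def LIMSEQ_iff)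
  obtain M where M: "\<forall>m\<ge>M. \<forall>n\<ge>M. padic_norm p (u m - u n) < e"
    using assms(1) e(1) by (auto simp: padic_cauchy_def)
  obtain k where k: "k \<ge> M" "padic_norm p (u k) \<ge> e" using e(2)[of M] by auto
  have "padic_norm p (u n) \<ge> e" if "n \<ge> M" for n
    using padic_norm_add[of "u k - u n" "u n"] M k that by fastforce
  thus ?thesis using e(1) by blast
qed

lemma cauchy_inverse:
  assumes "u \<in> padic_cauchy p" "u \<notin> padic_null p"
  shows "(\<lambda>n. inverse (u n)) \<in> padic_cauchy p"
  unfolding padic_cauchy_def
proof clarify
  fix e :: real assume e: "e > 0"
  obtain c M where c: "c > 0" and M: "\<forall>n\<ge>M. padic_norm p (u n) \<ge> c"
    using cauchy_away[OF assms] by blast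
  have "e * c * c > 0" using e c by simp
  then obtain M' where M': "\<forall>m\<ge>M'. \<forall>n\<ge>M'. padic_norm p (u m - u n) < e * c * c"
    using assms(1) unfolding padic_cauchy_def by blast
  show "\<exists>M. \<forall>m\<ge>M. \<forall>n\<ge>M. padic_norm p (inverse (u m) - inverse (u n)) < e"
  proof (intro exI allI impI)
    fix m n assume mn: "m \<ge> max M M'" "n \<ge> max M M'"
    have nz: "u m \<noteq> 0" "u n \<noteq> 0" using M mn c padic_norm_0 by fastforce+
    have "padic_norm p (u n - u m) = padic_norm p (u m * u n * (inverse (u m) - inverse (u n)))"
      using nz by (simp add: field_simps)
    also have "\<dots> = padic_norm p (u m) * padic_norm p (u n) * padic_norm p (inverse (u m) - inverse (u n))"
      by (simp add: padic_norm_mult)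
    finally have eq: "padic_norm p (u n - u m) = \<dots>" .
    have "c * c \<le> padic_norm p (u m) * padic_norm p (u n)"
      using M mn c by (intro mult_mono) auto
    hence "c * c * padic_norm p (inverse (u m) - inverse (u n)) \<le> padic_norm p (u n - u m)"
      unfolding eq by (intro mult_right_mono padic_norm_nonneg)
    also have "\<dots> < c * c * e" using M' mn by (simp add: mult_ac)
    finally show "padic_norm p (inverse (u m) - inverse (u n)) < e" using c by simp
  qed
qed

lemma field_Qp: "field (Qp p)"
proof -
  interpret cring "cauchy_ring p" by (rule cring_cauchy_ring)
  have "maximalideal (padic_null p) (cauchy_ring p)"
  proof (rule maximalidealI)
    show "ideal (padic_null p) (cauchy_ring p)" by (rule ideal_padic_null)
    have "(\<lambda>_. 1) \<notin> padic_null p" by (simp add: padic_null_def padic_norm_1 LIMSEQ_const_iff)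
    thus "carrier (cauchy_ring p) \<noteq> padic_null p" using cauchy_const[of 1] by (auto simp: cauchy_ring_def)
  next
    fix J assume J: "ideal J (cauchy_ring p)" "padic_null p \<subseteq> J" "J \<subseteq> carrier (cauchy_ring p)"
    interpret J: ideal J "cauchy_ring p" by fact
    show "J = padic_null p \<or> J = carrier (cauchy_ring p)"
    proof (rule disjCI)
      assume "J \<noteq> carrier (cauchy_ring p)"
      show "J = padic_null p"
      proof (rule ccontr)
        assume "J \<noteq> padic_null p"
        then obtain u where u: "u \<in> J" "u \<notin> padic_null p" using J by blast
        have uc: "u \<in> padic_cauchy p" using u J by (auto simp: cauchy_ring_def)
        define w where "w = (\<lambda>n. 1 - u n * inverse (u n))"
        obtain c M where c: "c > 0" and M: "\<forall>n\<ge>M. padic_norm p (u n) \<ge> c"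
          using cauchy_away[OF uc u(2)] by blast
        have "padic_norm p (w n) = 0" if "n \<ge> M" for n
        proof -
          have "u n \<noteq> 0" using M that c padic_norm_0 by fastforce
          thus ?thesis by (simp add: w_def padic_norm_0)
        qed
        hence "w \<in> padic_null p"
          unfolding padic_null_def by (auto intro!: tendsto_eventually eventually_sequentiallyI)
        hence "w \<in> J" using J by blast
        moreover have "(\<lambda>n. u n * inverse (u n)) \<in> J"
          using J.I_r_closed[OF u(1), of "\<lambda>n. inverse (u n)"] cauchy_inverse[OF uc u(2)]
          by (simp add: cauchy_ring_def)
        ultimately have "(\<lambda>n. w n + u n * inverse (u n)) \<in> J"
          using J.a_closed[of w "\<lambda>n. u n * inverse (u n)"] by (simp add: cauchy_ring_def)
        hence "\<one>\<^bsub>cauchy_ring p\<^esub> \<in> J" by (simp add: w_def cauchy_ring_def)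
        hence "J = carrier (cauchy_ring p)" by (rule J.one_imp_carrier)
        thus False using \<open>J \<noteq> carrier (cauchy_ring p)\<close> by simp
      qed
    qed
  qed
  thus ?thesis unfolding Qp_def by (rule maximalideal.quotient_is_field) (rule cring_axioms)
qed

end

definition Qp_abs :: "nat \<Rightarrow> (nat \<Rightarrow> rat) set \<Rightarrow> real" where
  "Qp_abs p C = (THE c. \<forall>u\<in>C. (\<lambda>n. padic_norm p (u n)) \<longlonglongrightarrow> c)"

definition Zp :: "nat \<Rightarrow> (nat \<Rightarrow> rat) set set" where
  "Zp p = {C \<in> carrier (Qp p). Qp_abs p C \<le> 1}"

type_synonym Qp_bar_elem =
  "((nat \<Rightarrow> rat) set list \<times> nat) multiset \<Rightarrow> (nat \<Rightarrow> rat) set"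

text \<open>The library's algebraic closure contains the base field through
  \<^const>\<open>ring.indexed_const\<close>.\<close>

definition Qp_bar :: "nat \<Rightarrow> Qp_bar_elem ring" where
  "Qp_bar p = field.alg_closure (Qp p)"

definition Qp_embed :: "nat \<Rightarrow> (nat \<Rightarrow> rat) set \<Rightarrow> Qp_bar_elem" where
  "Qp_embed p = ring.indexed_const (Qp p)"

abbreviation complex_ring :: "complex ring" where
  "complex_ring \<equiv> ring_of_type_algebra"

text \<open>The p-adic numbers and the p-adic integers as subsets of the complex numbers, under the
  identification given by an isomorphism \<open>\<phi>\<close> of the complex numbers with \<^term>\<open>Qp_bar p\<close>.\<close>

definition Qp_in_C :: "nat \<Rightarrow> (complex \<Rightarrow> Qp_bar_elem) \<Rightarrow> complex set" where
  "Qp_in_C p \<phi> = {z. \<phi> z \<in> Qp_embed p ` carrier (Qp p)}"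

definition Zp_in_C :: "nat \<Rightarrow> (complex \<Rightarrow> Qp_bar_elem) \<Rightarrow> complex set" where
  "Zp_in_C p \<phi> = {z. \<phi> z \<in> Qp_embed p ` Zp p}"


section \<open>Imaginary quadratic fields\<close>

text \<open>The square root of \<open>-d\<close> in the upper half plane (for \<open>d > 0\<close>).\<close>

definition sqrt_neg :: "int \<Rightarrow> complex" where
  "sqrt_neg d = \<i> * complex_of_real (sqrt (real_of_int d))"

definition quad_field :: "int \<Rightarrow> complex set" where
  "quad_field d = {of_rat a + of_rat b * sqrt_neg d | a b. True}"

definition quad_integers :: "int \<Rightarrow> complex ring" where
  "quad_integers d = complex_ring\<lparr>carrier := {z \<in> quad_field d. algebraic_int z}\<rparr>"

definition splits_completely :: "nat \<Rightarrow> int \<Rightarrow> bool" where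
  "splits_completely p d \<longleftrightarrow> (\<exists>P1 P2.
     primeideal P1 (quad_integers d) \<and> primeideal P2 (quad_integers d) \<and> P1 \<noteq> P2 \<and>
     cgenideal (quad_integers d) (of_nat p) = ideal_prod (quad_integers d) P1 P2)"

definition root_of_unity_in :: "complex set \<Rightarrow> complex \<Rightarrow> bool" where
  "root_of_unity_in F \<zeta> \<longleftrightarrow> \<zeta> \<in> F \<and> (\<exists>n\<ge>1. \<zeta> ^ n = 1)"

definition theta :: "int \<Rightarrow> complex" where
  "theta d = (if [- d = 1] (mod 4) then (-1 + sqrt_neg d) / 2 else sqrt_neg d)"


section \<open>The continued fraction expansion\<close>

definition fund_domain :: "complex set" where
  "fund_domain = {z. Im z > 0 \<and> cmod z > 1 \<and> - 1/2 \<le> Re z \<and> Re z < 1/2}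
     \<union> {exp (\<i> * complex_of_real \<alpha>) | \<alpha>. pi / 2 \<le> \<alpha> \<and> \<alpha> \<le> 2 * pi / 3}"

text \<open>In the following, \<open>Z\<close> is the set of complex numbers that are p-adic integers.
  For each \<open>k\<close>, the data \<open>z\<^sub>k, D\<^sub>k, a\<^sub>k, P\<^sub>k, z\<^sub>k\<^sub>j, b\<^sub>k\<^sub>j, Q\<^sub>k\<close> are functions of \<open>x = x\<^sub>k\<close> alone.\<close>

definition cf_z :: "complex set \<Rightarrow> complex \<Rightarrow> complex" where
  "cf_z Z x = (if x \<in> Z then x else - 1 / x)"

definition mat2 :: "rat \<Rightarrow> rat \<Rightarrow> rat \<Rightarrow> rat \<Rightarrow> rat^2^2" where
  "mat2 a b c d = vector [vector [a, b], vector [c, d]]"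

definition cf_D :: "complex set \<Rightarrow> complex \<Rightarrow> rat^2^2" where
  "cf_D Z x = (if x \<in> Z then mat 1 else mat2 0 (- 1) 1 0)"

definition cf_a :: "nat \<Rightarrow> complex set \<Rightarrow> complex \<Rightarrow> nat" where
  "cf_a p Z x = (THE a. a < p^2 \<and> (cf_z Z x - of_nat a) / of_nat p ^ 2 \<in> Z)"

definition cf_P :: "nat \<Rightarrow> complex set \<Rightarrow> complex \<Rightarrow> rat^2^2" where
  "cf_P p Z x = mat2 (1 / of_nat p) 0 0 (of_nat p) ** mat2 1 (- of_nat (cf_a p Z x)) 0 1"

definition inf_b :: "complex \<Rightarrow> int" where
  "inf_b z = (THE b. - 1/2 \<le> Re (z - of_int b) \<and> Re (z - of_int b) < 1/2)"

definition inf_step :: "complex \<Rightarrow> complex" where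
  "inf_step z = - 1 / (z - of_int (inf_b z))"

text \<open>The point \<open>\<rho> = exp (i \<pi> / 3)\<close> lies outside the fundamental domain and is fixed by the
  reduction step, so that the reduction at infinity of a point that reaches \<open>\<rho>\<close> does not end.
  The orbit of \<open>\<rho>\<close> under the modular group contains \<^term>\<open>theta 3\<close>, and every point of the
  orbit except \<^term>\<open>theta 3\<close> itself reaches \<open>\<rho>\<close>.\<close>

lemma inf_b_eqI:
  assumes "- 1/2 \<le> Re (z - of_int b)" "Re (z - of_int b) < 1/2"
  shows "inf_b z = b"
  unfolding inf_b_def
proof (rule the_equality)
  fix c :: int assume "- 1/2 \<le> Re (z - of_int c) \<and> Re (z - of_int c) < 1/2"
  hence "\<bar>real_of_int c - real_of_int b\<bar> < 1" using assms by auto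
  thus "c = b" by linarith
qed (use assms in auto)

lemma inf_step_fixpoint:
  defines "\<rho> \<equiv> Complex (1/2) (sqrt 3 / 2)"
  shows "inf_b \<rho> = 1" "inf_step \<rho> = \<rho>" "\<rho> \<notin> fund_domain"
proof -
  show b: "inf_b \<rho> = 1" by (rule inf_b_eqI) (auto simp: \<rho>_def)
  have "\<rho> * (\<rho> - 1) = - 1"
    by (auto simp: \<rho>_def complex_eq_iff)
  moreover have "\<rho> - 1 \<noteq> 0" by (auto simp: \<rho>_def complex_eq_iff)
  ultimately show "inf_step \<rho> = \<rho>" by (simp add: inf_step_def b field_simps)
  have "cos \<alpha> \<le> 0" if "pi / 2 \<le> \<alpha>" "\<alpha> \<le> 2 * pi / 3" for \<alpha>
    using cos_monotone_0_pi_le[of "pi/2" \<alpha>] that by auto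
  thus "\<rho> \<notin> fund_domain"
    by (force simp: fund_domain_def \<rho>_def complex_eq_iff Re_exp)
qed

definition cf_zj :: "nat \<Rightarrow> complex set \<Rightarrow> complex \<Rightarrow> nat \<Rightarrow> complex" where
  "cf_zj p Z x j = (inf_step ^^ j) ((cf_z Z x - of_nat (cf_a p Z x)) / of_nat p ^ 2)"

text \<open>The number of steps of the reduction at infinity; meaningful only if it ends.\<close>

definition cf_len :: "nat \<Rightarrow> complex set \<Rightarrow> complex \<Rightarrow> nat" where
  "cf_len p Z x = (LEAST j. cf_zj p Z x j \<in> fund_domain)"

primrec cf_Qj :: "nat \<Rightarrow> complex set \<Rightarrow> complex \<Rightarrow> nat \<Rightarrow> rat^2^2" where
  "cf_Qj p Z x 0 = mat 1"
| "cf_Qj p Z x (Suc j) =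
     mat2 0 (- 1) 1 (- of_int (inf_b (cf_zj p Z x j))) ** cf_Qj p Z x j"

definition cf_Q :: "nat \<Rightarrow> complex set \<Rightarrow> complex \<Rightarrow> rat^2^2" where
  "cf_Q p Z x = cf_Qj p Z x (cf_len p Z x)"

definition cf_next :: "nat \<Rightarrow> complex set \<Rightarrow> complex \<Rightarrow> complex" where
  "cf_next p Z x = cf_zj p Z x (cf_len p Z x)"

text \<open>The sequence \<open>x\<^sub>k\<close> of the expansion of \<open>z\<close>, indexed by \<open>k \<ge> 1\<close>.\<close>

definition cf_x :: "nat \<Rightarrow> complex set \<Rightarrow> complex \<Rightarrow> nat \<Rightarrow> complex" where
  "cf_x p Z z k = (cf_next p Z ^^ (k - 1)) z"

definition cf_A :: "nat \<Rightarrow> complex set \<Rightarrow> complex \<Rightarrow> nat \<Rightarrow> rat^2^2" where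
  "cf_A p Z z k = (let x = cf_x p Z z k in matrix_inv (cf_Q p Z x ** cf_P p Z x ** cf_D Z x))"

primrec cf_B :: "nat \<Rightarrow> complex set \<Rightarrow> complex \<Rightarrow> nat \<Rightarrow> rat^2^2" where
  "cf_B p Z z 0 = mat 1"
| "cf_B p Z z (Suc k) = cf_B p Z z k ** cf_A p Z z (Suc k)"

text \<open>All the reductions at infinity in the expansion of \<open>z\<close> end, i.e. the algorithm is
  well defined on \<open>z\<close>.\<close>

definition cf_defined :: "nat \<Rightarrow> complex set \<Rightarrow> complex \<Rightarrow> bool" where
  "cf_defined p Z z \<longleftrightarrow> (\<forall>k\<ge>1. \<exists>j. cf_zj p Z (cf_x p Z z k) j \<in> fund_domain)"

definition purely_periodic :: "nat \<Rightarrow> complex set \<Rightarrow> complex \<Rightarrow> bool" where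
  "purely_periodic p Z z \<longleftrightarrow> (\<exists>N\<ge>1. cf_x p Z z (N + 1) = cf_x p Z z 1)"

definition cf_period :: "nat \<Rightarrow> complex set \<Rightarrow> complex \<Rightarrow> nat" where
  "cf_period p Z z = (LEAST N. N \<ge> 1 \<and> cf_x p Z z (N + 1) = cf_x p Z z 1)"

end

theory Submission
  imports Defs
begin

text \<open>
  The expansion is a reduction algorithm for ideals. Put \<open>O = \<int> + \<int> \<theta>\<close>, the ring of integers of
  \<open>F\<close>, and let \<open>\<pp>\<close> be the prime ideal above \<open>p\<close> consisting of the elements of \<open>O\<close> that are
  divisible by \<open>p\<close> in the p-adic integers. After \<open>k\<close> rounds, \<open>p\<^sup>k B\<^sub>k\<^sup>-\<^sup>1\<close> is an integral
  matrix, and it takes \<open>\<theta>, 1\<close> to a basis of \<open>\<pp>\<^sup>2\<^sup>k\<close> whose quotient is \<open>x\<^sub>k\<^sub>+\<^sub>1\<close>. This is the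
  invariant \<open>basis_at\<close>. The p-adic step (\<open>basis_at_padic_step\<close>) passes to the sublattice of index
  \<open>p\<^sup>2\<close> defined by divisibility by a further \<open>p\<^sup>2\<close>; all other steps only change the basis by a
  matrix of determinant \<open>1\<close>. The reduction at infinity then chooses a reduced basis. It ends because
  each step inside the unit disc decreases the integer \<open>A = Im \<theta> / Im z\<close>, and it can only fail at a
  primitive cube root of unity, which lies in \<open>F\<close> only for \<open>d = 3\<close>.

  A point of the fundamental domain determines its lattice up to homothety. If
  \<open>\<pp>\<^sup>2\<^sup>k\<close> is principal, then its reduced basis must have the point \<open>\<theta>\<close>, since \<open>O\<close> has no nonzero
  element shorter than \<open>1\<close> and neither has the lattice of a reduced point (\<open>principal_imp_theta\<close>).
  There are only finitely many reduced points, because they are roots of positive definite quadratic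
  forms of a fixed discriminant. So two rounds \<open>i < j\<close> share a point; the ratio of their lattices
  generates \<open>\<pp>\<^sup>2\<^sup>(\<^sup>j\<^sup>-\<^sup>i\<^sup>)\<close> (\<open>equal_points_imp_principal\<close>), and the expansion returns to
  \<open>\<theta>\<close> itself after \<open>j - i\<close> rounds. Thus the period \<open>N\<close> is the order of the class of \<open>\<pp>\<^sup>2\<close>.

  At the period, the second basis vector \<open>t + s \<theta>\<close> generates \<open>\<pp>\<^sup>2\<^sup>N\<close>. A primitive solution is an
  element of norm \<open>p\<^sup>2\<^sup>\<nu>\<close> not divisible by \<open>p\<close>, hence a generator of \<open>\<pp>\<^sup>2\<^sup>\<nu>\<close> or of its
  conjugate. So \<open>\<nu> = r N\<close>, and the solution is a unit times the \<open>r\<close>-th power of \<open>t + s \<theta>\<close> or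
  of its conjugate; the units are the roots of unity of \<open>F\<close> (\<open>pell_solutions\<close>).

  Ideals appear as sets of elements of \<open>O\<close> given by a divisibility in the p-adic integers, and the
  p-adic integers enter the argument only through a few properties of a subring \<open>Z\<close> of the complex
  numbers (locale \<open>split_order\<close>). Complete splitting provides a simple root of the minimal polynomial
  of \<open>\<theta>\<close> modulo \<open>p\<close>; lifting it puts \<open>F\<close> inside the p-adic numbers and shows that \<open>p\<close> does not
  divide the discriminant.
\<close>


section \<open>p-adic numbers as limits of rational Cauchy sequences\<close>

lemma padic_norm_of_int_le_1:
  assumes "Factorial_Ring.prime p"
  shows "padic_norm p (of_int a) \<le> 1"
proof (cases "a = 0")
  case False
  have "padic_norm p (of_int a / of_int 1) = real p powi (int (multiplicity (int p) 1) - int (multiplicity (int p) a))"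
    by (rule padic_norm_frac[OF assms False]) simp
  also have "\<dots> \<le> real p powi 0"
    using p_gt[OF assms] by (intro power_int_increasing) auto
  finally show ?thesis by simp
qed (simp add: padic_norm_0)

lemma padic_norm_of_prime:
  assumes "Factorial_Ring.prime p"
  shows "padic_norm p (of_nat p) = 1 / real p"
proof -
  have "multiplicity (int p) (int p) = 1"
    using assms by (simp add: multiplicity_self)
  moreover have "padic_norm p (of_int (int p) / of_int 1) = real p powi (int (multiplicity (int p) 1) - int (multiplicity (int p) (int p)))"
    by (rule padic_norm_frac[OF assms]) (use assms prime_gt_0_nat in auto)
  ultimately show ?thesis
    by (simp add: power_int_minus divide_simps)
qed

lemma padic_norm_inverse:
  assumes "Factorial_Ring.prime p"
  shows "padic_norm p (inverse q) = 1 / padic_norm p q"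
proof (cases "q = 0")
  case False
  have "padic_norm p q * padic_norm p (inverse q) = 1"
    using padic_norm_mult[OF assms, of q "inverse q"] False padic_norm_1[OF assms] by simp
  then show ?thesis
    by (metis mult_zero_left nonzero_mult_div_cancel_left zero_neq_one)
qed (simp add: padic_norm_0)

lemma padic_norm_of_int_dvd:
  assumes "Factorial_Ring.prime p" "int p ^ n dvd a"
  shows "padic_norm p (of_int a) \<le> 1 / real p ^ n"
proof -
  obtain b where b: "a = int p ^ n * b"
    using assms(2) by blast
  have "padic_norm p (of_nat p ^ n) = 1 / real p ^ n"
    by (induction n) (simp_all add: assms(1) padic_norm_mult padic_norm_1 padic_norm_of_prime)
  then have "padic_norm p (of_int a) = 1 / real p ^ n * padic_norm p (of_int b)"
    by (simp add: b padic_norm_mult[OF assms(1)])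
  also have "\<dots> \<le> 1 / real p ^ n * 1"
    by (intro mult_left_mono padic_norm_of_int_le_1 assms) auto
  finally show ?thesis by simp
qed

text \<open>The p-adic absolute value of a rational is a power of \<open>p\<close>, so there is no value strictly
  between \<open>1\<close> and \<open>p\<close>.\<close>

lemma padic_norm_discrete:
  assumes "Factorial_Ring.prime p" "padic_norm p q < real p"
  shows "padic_norm p q \<le> 1"
proof (cases "q = 0")
  case False
  define k where "k = int (multiplicity (int p) (snd (quotient_of q))) - int (multiplicity (int p) (fst (quotient_of q)))"
  have k: "padic_norm p q = real p powi k"
    using False by (simp add: padic_norm_def k_def)
  have "k < 1"
    using power_int_increasing[of 1 k "real p"] assms k p_gt[OF assms(1)] by force
  then show ?thesis
    using power_int_increasing[of k 0 "real p"] k p_gt[OF assms(1)] by simp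
qed (simp add: padic_norm_0)

lemma padic_residue_rat:
  assumes p: "Factorial_Ring.prime p" and q: "padic_norm p q \<le> 1"
  obtains a :: int where "padic_norm p (q - of_int a) \<le> 1 / real p"
proof -
  obtain N D where ND: "quotient_of q = (N, D)" by fastforce
  have D: "D > 0" and cop: "coprime N D" and qd: "q = of_int N / of_int D"
    using quotient_of_denom_pos[OF ND] quotient_of_coprime[OF ND] quotient_of_div[OF ND] by auto
  have nD: "\<not> int p dvd D"
  proof
    assume dv: "int p dvd D"
    then have nN: "\<not> int p dvd N"
      using cop p by (meson coprime_common_divisor not_prime_unit prime_int_nat_transfer prime_nat_int_transfer)
    then have "N \<noteq> 0" by auto
    have "multiplicity (int p) N = 0"
      using nN by (simp add: not_dvd_imp_multiplicity_0)
    moreover have "multiplicity (int p) D \<ge> 1"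
      using dv D p p_elem[OF p] by (intro multiplicity_geI) auto
    ultimately have "real p powi 1 \<le> padic_norm p q"
      unfolding qd padic_norm_frac[OF p \<open>N \<noteq> 0\<close> less_imp_neq[OF D, symmetric]]
      using p_gt[OF p] by (intro power_int_increasing) auto
    then show False using q p_gt[OF p] by simp
  qed
  have "Factorial_Ring.prime (int p)"
    using p by simp
  then have "coprime (int p) D"
    using nD by (rule prime_imp_coprime)
  then have "coprime D (int p)"
    by (simp add: coprime_commute)
  then obtain D' where D': "[D * D' = 1] (mod int p)"
    using cong_solve_coprime_int by blast
  define a where "a = N * D'"
  have "int p dvd N * (1 - D * D')"
    using D' by (metis cong_iff_dvd_diff cong_sym dvd_mult)
  then have 1: "padic_norm p (of_int (N * (1 - D * D'))) \<le> 1 / real p"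
    using padic_norm_of_int_dvd[OF p, of 1 "N * (1 - D * D')"] by (metis power_one_right)
  have "q - of_int a = of_int (N * (1 - D * D')) * inverse (of_int D)"
    using D by (simp add: qd a_def field_simps)
  moreover have "padic_norm p (of_int D) = 1"
  proof -
    have "padic_norm p (of_int D / of_int 1) = 1"
      using D nD by (subst padic_norm_frac[OF p]) (auto simp: not_dvd_imp_multiplicity_0)
    then show ?thesis by simp
  qed
  ultimately have "padic_norm p (q - of_int a) \<le> 1 / real p"
    using 1 by (simp add: padic_norm_mult[OF p] padic_norm_inverse[OF p])
  then show ?thesis by (rule that)
qed

lemma padic_norm_diff_abs:
  assumes "Factorial_Ring.prime p"
  shows "\<bar>padic_norm p a - padic_norm p b\<bar> \<le> padic_norm p (a - b)"
  using padic_norm_triangle[OF assms, of "a - b" b] padic_norm_triangle[OF assms, of "b - a" a]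
    padic_norm_minus[OF assms, of "a - b"] by simp

lemma padic_norm_convergent:
  assumes p: "Factorial_Ring.prime p" and u: "u \<in> padic_cauchy p"
  shows "convergent (\<lambda>n. padic_norm p (u n))"
proof -
  have "Cauchy (\<lambda>n. padic_norm p (u n))"
    unfolding Cauchy_def dist_real_def
  proof (intro allI impI)
    fix r :: real assume "r > 0"
    then obtain M where "\<forall>m\<ge>M. \<forall>n\<ge>M. padic_norm p (u m - u n) < r"
      using u by (auto simp: padic_cauchy_def)
    then show "\<exists>M. \<forall>m\<ge>M. \<forall>n\<ge>M. \<bar>padic_norm p (u m) - padic_norm p (u n)\<bar> < r"
      using padic_norm_diff_abs[OF p] by (meson le_less_trans)
  qed
  then show ?thesis by (simp add: Cauchy_convergent_iff)
qed

abbreviation padic_class :: "nat \<Rightarrow> (nat \<Rightarrow> rat) \<Rightarrow> (nat \<Rightarrow> rat) set" where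
  "padic_class p u \<equiv> padic_null p +>\<^bsub>cauchy_ring p\<^esub> u"

lemma padic_class_eq: "padic_class p u = {\<lambda>n. v n + u n | v. v \<in> padic_null p}"
  by (auto simp: a_r_coset_def' cauchy_ring_def)

lemma Qp_carrier: "carrier (Qp p) = padic_class p ` padic_cauchy p"
  by (auto simp: Qp_def FactRing_def A_RCOSETS_def' cauchy_ring_def)

lemma Qp_abs_class:
  assumes p: "Factorial_Ring.prime p" and u: "u \<in> padic_cauchy p"
  shows "(\<lambda>n. padic_norm p (u n)) \<longlonglongrightarrow> Qp_abs p (padic_class p u)"
proof -
  obtain l where l: "(\<lambda>n. padic_norm p (u n)) \<longlonglongrightarrow> l"
    using padic_norm_convergent[OF p u] by (auto simp: convergent_def)
  have *: "(\<lambda>n. padic_norm p (v n + u n)) \<longlonglongrightarrow> l" if v: "v \<in> padic_null p" for v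
  proof -
    have "(\<lambda>n. padic_norm p (v n + u n) - padic_norm p (u n)) \<longlonglongrightarrow> 0"
    proof (rule Lim_null_comparison)
      show "\<forall>\<^sub>F n in sequentially. norm (padic_norm p (v n + u n) - padic_norm p (u n)) \<le> padic_norm p (v n)"
      proof (intro always_eventually allI)
        fix n
        show "norm (padic_norm p (v n + u n) - padic_norm p (u n)) \<le> padic_norm p (v n)"
          using padic_norm_diff_abs[OF p, of "v n + u n" "u n"] by simp
      qed
      show "(\<lambda>n. padic_norm p (v n)) \<longlonglongrightarrow> 0"
        using v by (simp add: padic_null_def)
    qed
    from tendsto_add[OF this l] show ?thesis by simp
  qed
  have "(\<lambda>_. 0) \<in> padic_null p"
    by (simp add: padic_null_def padic_norm_0)
  then have "u \<in> padic_class p u"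
    by (force simp: padic_class_eq)
  then have "Qp_abs p (padic_class p u) = l"
    unfolding Qp_abs_def
  proof (intro the_equality)
    show "\<forall>u\<in>padic_class p u. (\<lambda>n. padic_norm p (u n)) \<longlonglongrightarrow> l"
      using * by (auto simp: padic_class_eq)
  qed (use l LIMSEQ_unique in blast)
  with l show ?thesis by simp
qed

text \<open>Discreteness of the values turns a condition on the limit into one on almost all members of
  a representing sequence.\<close>

lemma padic_class_in_Zp_iff:
  assumes p: "Factorial_Ring.prime p" and u: "u \<in> padic_cauchy p"
  shows "padic_class p u \<in> Zp p \<longleftrightarrow> (\<forall>\<^sub>F n in sequentially. padic_norm p (u n) \<le> 1)"
proof
  assume "padic_class p u \<in> Zp p"
  then have "Qp_abs p (padic_class p u) < real p"
    using p_gt[OF p] by (simp add: Zp_def)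
  from order_tendstoD(2)[OF Qp_abs_class[OF p u] this]
  show "\<forall>\<^sub>F n in sequentially. padic_norm p (u n) \<le> 1"
    by eventually_elim (rule padic_norm_discrete[OF p])
next
  assume "\<forall>\<^sub>F n in sequentially. padic_norm p (u n) \<le> 1"
  then have "Qp_abs p (padic_class p u) \<le> 1"
    by (intro tendsto_upperbound[OF Qp_abs_class[OF p u]]) auto
  then show "padic_class p u \<in> Zp p"
    using u by (auto simp: Zp_def Qp_carrier)
qed

text \<open>The p-adic limit of a sequence of rationals, carried to the complex numbers by the inverse of
  \<open>\<phi>\<close>. As a ring homomorphism on Cauchy sequences it replaces the tower of quotient ring,
  algebraic closure and isomorphism in everything that follows.\<close>

definition padic_lim :: "nat \<Rightarrow> (complex \<Rightarrow> Qp_bar_elem) \<Rightarrow> (nat \<Rightarrow> rat) \<Rightarrow> complex" where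
  "padic_lim p \<phi> u = inv_into UNIV \<phi> (Qp_embed p (padic_class p u))"

locale padic_identification =
  fixes p :: nat and \<phi> :: "complex \<Rightarrow> Qp_bar_elem"
  assumes prime_p: "Factorial_Ring.prime p"
    and phi_iso: "\<phi> \<in> ring_iso complex_ring (Qp_bar p)"
begin



lemma embed_hom: "Qp_embed p \<in> ring_hom (Qp p) (Qp_bar p)"
proof -
  interpret Q: field "Qp p" by (rule field_Qp[OF prime_p])
  show ?thesis
    unfolding Qp_bar_def Qp_embed_def by (rule Q.alg_closureE(2))
qed

lemma embed_inj: "Qp_embed p x = Qp_embed p y \<longleftrightarrow> x = y"
proof -
  interpret Q: field "Qp p" by (rule field_Qp[OF prime_p])
  show ?thesis
    unfolding Qp_embed_def by (rule Q.indexed_const_eq_iff)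
qed

lemma phi_hom: "\<phi> (x + y) = \<phi> x \<oplus>\<^bsub>Qp_bar p\<^esub> \<phi> y" "\<phi> (x * y) = \<phi> x \<otimes>\<^bsub>Qp_bar p\<^esub> \<phi> y"
  "\<phi> 1 = \<one>\<^bsub>Qp_bar p\<^esub>" "bij_betw \<phi> UNIV (carrier (Qp_bar p))"
  using ring_iso_memE[OF phi_iso] by (auto simp: ring_of_type_algebra_def)

lemma inj_phi: "\<phi> x = \<phi> y \<longleftrightarrow> x = y"
  using phi_hom(4) by (auto simp: bij_betw_def inj_on_def)

lemma phi_padic_lim:
  assumes "u \<in> padic_cauchy p"
  shows "\<phi> (padic_lim p \<phi> u) = Qp_embed p (padic_class p u)"
proof -
  have "Qp_embed p (padic_class p u) \<in> carrier (Qp_bar p)"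
    using ring_hom_closed[OF embed_hom] assms by (simp add: Qp_carrier)
  then have "Qp_embed p (padic_class p u) \<in> \<phi> ` UNIV"
    using phi_hom(4) by (simp add: bij_betw_def)
  then show ?thesis
    unfolding padic_lim_def by (rule f_inv_into_f)
qed

lemma class_ops:
  assumes "u \<in> padic_cauchy p" "v \<in> padic_cauchy p"
  shows "padic_class p (\<lambda>n. u n + v n) = padic_class p u \<oplus>\<^bsub>Qp p\<^esub> padic_class p v"
    "padic_class p (\<lambda>n. u n * v n) = padic_class p u \<otimes>\<^bsub>Qp p\<^esub> padic_class p v"
    "padic_class p (\<lambda>_. 1) = \<one>\<^bsub>Qp p\<^esub>"
proof -
  interpret I: ideal "padic_null p" "cauchy_ring p" by (rule ideal_padic_null[OF prime_p])
  have h: "padic_class p \<in> ring_hom (cauchy_ring p) (Qp p)"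
    unfolding Qp_def by (rule I.rcos_ring_hom)
  have c: "u \<in> carrier (cauchy_ring p)" "v \<in> carrier (cauchy_ring p)"
    using assms by (auto simp: cauchy_ring_def)
  show "padic_class p (\<lambda>n. u n + v n) = padic_class p u \<oplus>\<^bsub>Qp p\<^esub> padic_class p v"
    using ring_hom_add[OF h c] by (simp add: cauchy_ring_def)
  show "padic_class p (\<lambda>n. u n * v n) = padic_class p u \<otimes>\<^bsub>Qp p\<^esub> padic_class p v"
    using ring_hom_mult[OF h c] by (simp add: cauchy_ring_def)
  show "padic_class p (\<lambda>_. 1) = \<one>\<^bsub>Qp p\<^esub>"
    using ring_hom_one[OF h] by (simp add: cauchy_ring_def)
qed

lemma padic_lim_add:
  assumes "u \<in> padic_cauchy p" "v \<in> padic_cauchy p"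
  shows "padic_lim p \<phi> (\<lambda>n. u n + v n) = padic_lim p \<phi> u + padic_lim p \<phi> v"
proof -
  have "\<phi> (padic_lim p \<phi> (\<lambda>n. u n + v n)) = \<phi> (padic_lim p \<phi> u + padic_lim p \<phi> v)"
    using assms ring_hom_add[OF embed_hom, of "padic_class p u" "padic_class p v"]
    by (simp add: phi_hom phi_padic_lim cauchy_add[OF prime_p] class_ops Qp_carrier)
  then show ?thesis by (simp add: inj_phi)
qed

lemma padic_lim_mult:
  assumes "u \<in> padic_cauchy p" "v \<in> padic_cauchy p"
  shows "padic_lim p \<phi> (\<lambda>n. u n * v n) = padic_lim p \<phi> u * padic_lim p \<phi> v"
proof -
  have "\<phi> (padic_lim p \<phi> (\<lambda>n. u n * v n)) = \<phi> (padic_lim p \<phi> u * padic_lim p \<phi> v)"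
    using assms ring_hom_mult[OF embed_hom, of "padic_class p u" "padic_class p v"]
    by (simp add: phi_hom phi_padic_lim cauchy_mult[OF prime_p] class_ops Qp_carrier)
  then show ?thesis by (simp add: inj_phi)
qed

lemma padic_lim_1: "padic_lim p \<phi> (\<lambda>_. 1) = 1"
proof -
  have "\<phi> (padic_lim p \<phi> (\<lambda>_. 1)) = \<phi> 1"
    using ring_hom_one[OF embed_hom] cauchy_const[OF prime_p, of 1]
    by (simp add: phi_padic_lim class_ops(3)[OF cauchy_const cauchy_const] phi_hom prime_p)
  then show ?thesis by (simp add: inj_phi)
qed

lemma padic_lim_0: "padic_lim p \<phi> (\<lambda>_. 0) = 0"
  using padic_lim_add[of "\<lambda>_. 0" "\<lambda>_. 0"] cauchy_const[OF prime_p, of 0] by simp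

lemma padic_lim_eq_0_iff:
  assumes "u \<in> padic_cauchy p"
  shows "padic_lim p \<phi> u = 0 \<longleftrightarrow> u \<in> padic_null p"
proof -
  have z: "(\<lambda>_. 0) \<in> padic_null p" by (simp add: padic_null_def padic_norm_0)
  have "padic_lim p \<phi> u = 0 \<longleftrightarrow> \<phi> (padic_lim p \<phi> u) = \<phi> (padic_lim p \<phi> (\<lambda>_. 0))"
    by (simp add: inj_phi padic_lim_0)
  also have "\<dots> \<longleftrightarrow> padic_class p u = padic_class p (\<lambda>_. 0)"
    by (simp add: phi_padic_lim assms cauchy_const prime_p embed_inj)
  also have "\<dots> \<longleftrightarrow> u \<in> padic_null p"
  proof
    assume eq: "padic_class p u = padic_class p (\<lambda>_. 0)"
    have "u \<in> padic_class p u" using z by (force simp: padic_class_eq)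
    then show "u \<in> padic_null p" unfolding eq by (auto simp: padic_class_eq)
  next
    assume u: "u \<in> padic_null p"
    have "\<exists>w. v = (\<lambda>n. w n + u n) \<and> w \<in> padic_null p" if "v \<in> padic_null p" for v
      by (rule exI[of _ "\<lambda>n. v n + - u n"])
        (use null_add[OF prime_p that null_uminus[OF prime_p u]] in auto)
    with null_add[OF prime_p _ u] show "padic_class p u = padic_class p (\<lambda>_. 0)"
      by (auto simp: padic_class_eq)
  qed
  finally show ?thesis .
qed

lemma Qp_in_C_eq: "Qp_in_C p \<phi> = padic_lim p \<phi> ` padic_cauchy p"
  by (auto simp: Qp_in_C_def Qp_carrier phi_padic_lim image_iff) (metis inj_phi phi_padic_lim)

lemma Zp_in_C_eq:
  "Zp_in_C p \<phi> = padic_lim p \<phi> ` {u \<in> padic_cauchy p. \<forall>\<^sub>F n in sequentially. padic_norm p (u n) \<le> 1}"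
proof (intro Set.set_eqI iffI)
  fix z assume "z \<in> Zp_in_C p \<phi>"
  then obtain C where C: "C \<in> Zp p" "\<phi> z = Qp_embed p C" by (auto simp: Zp_in_C_def)
  then obtain u where u: "u \<in> padic_cauchy p" "C = padic_class p u"
    by (auto simp: Zp_def Qp_carrier)
  then have "z = padic_lim p \<phi> u" using C by (metis inj_phi phi_padic_lim)
  with u C padic_class_in_Zp_iff[OF prime_p]
  show "z \<in> padic_lim p \<phi> ` {u \<in> padic_cauchy p. \<forall>\<^sub>F n in sequentially. padic_norm p (u n) \<le> 1}"
    by auto
next
  fix z assume "z \<in> padic_lim p \<phi> ` {u \<in> padic_cauchy p. \<forall>\<^sub>F n in sequentially. padic_norm p (u n) \<le> 1}"
  then show "z \<in> Zp_in_C p \<phi>"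
    using padic_class_in_Zp_iff[OF prime_p] phi_padic_lim by (auto simp: Zp_in_C_def)
qed

abbreviation (input) "ev_integral u \<equiv> (\<forall>\<^sub>F n in sequentially. padic_norm p (u n) \<le> 1)"

lemma padic_lim_in_Zp_iff:
  assumes u: "u \<in> padic_cauchy p"
  shows "padic_lim p \<phi> u \<in> Zp_in_C p \<phi> \<longleftrightarrow> ev_integral u"
  using phi_padic_lim[OF u] padic_class_in_Zp_iff[OF prime_p u] embed_inj
  by (auto simp: Zp_in_C_def)

lemma padic_lim_uminus:
  assumes "u \<in> padic_cauchy p"
  shows "padic_lim p \<phi> (\<lambda>n. - u n) = - padic_lim p \<phi> u"
  using padic_lim_add[OF assms cauchy_uminus[OF prime_p assms]]
  by (simp add: padic_lim_0 eq_neg_iff_add_eq_0 add.commute)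

lemma padic_lim_of_nat: "padic_lim p \<phi> (\<lambda>_. of_nat n) = of_nat n"
proof (induction n)
  case (Suc n)
  have "padic_lim p \<phi> (\<lambda>_. of_nat n + 1) = padic_lim p \<phi> (\<lambda>_. of_nat n) + padic_lim p \<phi> (\<lambda>_. 1)"
    by (intro padic_lim_add cauchy_const prime_p)
  with Suc show ?case by (simp add: padic_lim_1 add.commute)
qed (simp add: padic_lim_0)

lemma padic_lim_of_int: "padic_lim p \<phi> (\<lambda>_. of_int a) = of_int a"
proof (cases a)
  case (neg n)
  then show ?thesis
    using padic_lim_uminus[OF cauchy_const[OF prime_p], of "of_nat (Suc n)"]
      padic_lim_of_nat[of "Suc n"] by simp
qed (simp add: padic_lim_of_nat)

lemma Qp_in_C_of_int: "of_int a \<in> Qp_in_C p \<phi>"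
  unfolding Qp_in_C_eq using padic_lim_of_int cauchy_const[OF prime_p] by (metis image_eqI)

lemma Qp_in_C_add: "x \<in> Qp_in_C p \<phi> \<Longrightarrow> y \<in> Qp_in_C p \<phi> \<Longrightarrow> x + y \<in> Qp_in_C p \<phi>"
  unfolding Qp_in_C_eq using padic_lim_add cauchy_add[OF prime_p] by (smt (verit) image_iff)

lemma Qp_in_C_mult: "x \<in> Qp_in_C p \<phi> \<Longrightarrow> y \<in> Qp_in_C p \<phi> \<Longrightarrow> x * y \<in> Qp_in_C p \<phi>"
  unfolding Qp_in_C_eq using padic_lim_mult cauchy_mult[OF prime_p] by (smt (verit) image_iff)

lemma Qp_in_C_uminus: "x \<in> Qp_in_C p \<phi> \<Longrightarrow> - x \<in> Qp_in_C p \<phi>"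
  unfolding Qp_in_C_eq using padic_lim_uminus cauchy_uminus[OF prime_p] by (smt (verit) image_iff)

lemma padic_lim_inverse:
  assumes u: "u \<in> padic_cauchy p" "padic_lim p \<phi> u \<noteq> 0"
  shows "(\<lambda>n. inverse (u n)) \<in> padic_cauchy p"
    "padic_lim p \<phi> (\<lambda>n. inverse (u n)) = inverse (padic_lim p \<phi> u)"
proof -
  have nn: "u \<notin> padic_null p" using u padic_lim_eq_0_iff by blast
  show inv: "(\<lambda>n. inverse (u n)) \<in> padic_cauchy p"
    by (rule cauchy_inverse[OF prime_p u(1) nn])
  obtain c M where c: "c > 0" and M: "\<forall>n\<ge>M. padic_norm p (u n) \<ge> c"
    using cauchy_away[OF prime_p u(1) nn] by blast
  define w where "w = (\<lambda>n. u n * inverse (u n) + (- 1))"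
  have w: "w n = 0" if "n \<ge> M" for n
  proof -
    have "padic_norm p (u n) \<noteq> 0" using M c that by fastforce
    then have "u n \<noteq> 0" using padic_norm_0[of p] by auto
    then show ?thesis by (simp add: w_def)
  qed
  have "(\<lambda>n. padic_norm p (w n)) \<longlonglongrightarrow> 0"
    by (rule tendsto_eventually)
      (use w in \<open>auto simp: padic_norm_0 eventually_sequentially intro!: exI[of _ M]\<close>)
  then have "w \<in> padic_null p" by (simp add: padic_null_def)
  then have "padic_lim p \<phi> w = 0"
    using null_cauchy[OF prime_p] padic_lim_eq_0_iff by blast
  moreover have "padic_lim p \<phi> w = padic_lim p \<phi> u * padic_lim p \<phi> (\<lambda>n. inverse (u n)) + (- 1)"
    unfolding w_def using u(1) inv prime_p padic_lim_of_int[of "-1"]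
    by (subst padic_lim_add) (simp_all add: padic_lim_mult cauchy_mult cauchy_const)
  ultimately show "padic_lim p \<phi> (\<lambda>n. inverse (u n)) = inverse (padic_lim p \<phi> u)"
    using u(2) by (simp add: field_simps)
qed

lemma Qp_in_C_inverse: "x \<in> Qp_in_C p \<phi> \<Longrightarrow> inverse x \<in> Qp_in_C p \<phi>"
  using padic_lim_inverse Qp_in_C_of_int[of 0] unfolding Qp_in_C_eq
  by (cases "x = 0") (smt (verit) image_iff of_int_0 inverse_zero)+

lemma Qp_in_C_of_rat: "of_rat q \<in> Qp_in_C p \<phi>"
proof -
  obtain a b where "q = of_int a / of_int b" using rat_frac[OF prime_p] by metis
  then have "of_rat q = (of_int a * inverse (of_int b) :: complex)"
    by (simp add: of_rat_divide) (simp add: divide_inverse)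
  then show ?thesis
    by (simp add: Qp_in_C_mult Qp_in_C_inverse Qp_in_C_of_int)
qed

lemma Zp_in_C_of_int: "of_int a \<in> Zp_in_C p \<phi>"
  using padic_lim_in_Zp_iff[OF cauchy_const[OF prime_p, of "of_int a"]]
  by (simp add: padic_lim_of_int padic_norm_of_int_le_1 prime_p)

lemma Zp_in_C_add:
  assumes "x \<in> Zp_in_C p \<phi>" "y \<in> Zp_in_C p \<phi>"
  shows "x + y \<in> Zp_in_C p \<phi>"
proof -
  obtain u v where uv: "u \<in> padic_cauchy p" "ev_integral u" "x = padic_lim p \<phi> u"
    "v \<in> padic_cauchy p" "ev_integral v" "y = padic_lim p \<phi> v"
    using assms by (auto simp: Zp_in_C_eq)
  have "ev_integral (\<lambda>n. u n + v n)"
    using uv(2,5) by eventually_elim (use padic_norm_add[OF prime_p] in \<open>meson le_max_iff_disj max.boundedI order_trans\<close>)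
  then show ?thesis
    using uv by (simp add: padic_lim_add[symmetric] padic_lim_in_Zp_iff cauchy_add prime_p)
qed

lemma Zp_in_C_mult:
  assumes "x \<in> Zp_in_C p \<phi>" "y \<in> Zp_in_C p \<phi>"
  shows "x * y \<in> Zp_in_C p \<phi>"
proof -
  obtain u v where uv: "u \<in> padic_cauchy p" "ev_integral u" "x = padic_lim p \<phi> u"
    "v \<in> padic_cauchy p" "ev_integral v" "y = padic_lim p \<phi> v"
    using assms by (auto simp: Zp_in_C_eq)
  have "ev_integral (\<lambda>n. u n * v n)"
    using uv(2,5) by eventually_elim (simp add: padic_norm_mult prime_p mult_le_one padic_norm_nonneg)
  then show ?thesis
    using uv by (simp add: padic_lim_mult[symmetric] padic_lim_in_Zp_iff cauchy_mult prime_p)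
qed

lemma inverse_p_notin_Zp: "1 / of_nat p \<notin> Zp_in_C p \<phi>"
proof
  assume "1 / of_nat p \<in> Zp_in_C p \<phi>"
  moreover have "padic_lim p \<phi> (\<lambda>_. inverse (of_nat p)) = 1 / of_nat p"
    using padic_lim_inverse(2)[of "\<lambda>_. of_nat p"] prime_gt_0_nat[OF prime_p]
    by (simp add: padic_lim_of_nat cauchy_const prime_p divide_inverse)
  ultimately have "padic_norm p (inverse (of_nat p)) \<le> 1"
    using padic_lim_in_Zp_iff[of "\<lambda>_. inverse (of_nat p)"] by (simp add: cauchy_const prime_p)
  then show False
    using p_gt[OF prime_p] by (simp add: padic_norm_inverse prime_p padic_norm_of_prime)
qed

text \<open>The residue field of the p-adic integers is that of the integers: a member of a
  representing sequence close to the limit is a rational without \<open>p\<close> in its denominator.\<close>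

lemma Zp_residue:
  assumes "z \<in> Zp_in_C p \<phi>"
  shows "\<exists>a :: int. (z - of_int a) / of_nat p \<in> Zp_in_C p \<phi>"
proof -
  obtain u where u: "u \<in> padic_cauchy p" "ev_integral u" "z = padic_lim p \<phi> u"
    using assms by (auto simp: Zp_in_C_eq)
  have "1 / real p > 0" using p_gt[OF prime_p] by simp
  then obtain M where M: "\<forall>m\<ge>M. \<forall>n\<ge>M. padic_norm p (u m - u n) < 1 / real p"
    using u(1) unfolding padic_cauchy_def by blast
  obtain M' where M': "\<forall>n\<ge>M'. padic_norm p (u n) \<le> 1"
    using u(2) by (auto simp: eventually_sequentially)
  define K where "K = max M M'"
  obtain a :: int where a: "padic_norm p (u K - of_int a) \<le> 1 / real p"
    using padic_residue_rat[OF prime_p, of "u K"] M' by (auto simp: K_def)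
  define v where "v = (\<lambda>n. (u n + of_int (- a)) * inverse (of_nat p))"
  have inv: "padic_lim p \<phi> (\<lambda>_. inverse (of_nat p)) = inverse (of_nat p)"
    using padic_lim_inverse(2)[of "\<lambda>_. of_nat p"] prime_gt_0_nat[OF prime_p]
    by (simp add: padic_lim_of_nat cauchy_const prime_p)
  have vc: "v \<in> padic_cauchy p"
    unfolding v_def by (intro cauchy_mult cauchy_add cauchy_const prime_p u)
  have "padic_norm p (v n) \<le> 1" if "n \<ge> K" for n
  proof -
    have "padic_norm p ((u n - u K) + (u K - of_int a)) \<le> 1 / real p"
      using padic_norm_add[OF prime_p, of "u n - u K" "u K - of_int a"] M[rule_format, of n K] a that
      by (simp add: K_def)
    then have "padic_norm p (u n - of_int a) * real p \<le> 1"
      using p_gt[OF prime_p] by (simp add: field_simps)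
    then show ?thesis
      by (simp add: v_def padic_norm_mult padic_norm_inverse padic_norm_of_prime prime_p)
  qed
  then have "ev_integral v" by (auto simp: eventually_sequentially)
  moreover have "padic_lim p \<phi> v = (z + of_int (- a)) * inverse (of_nat p)"
  proof -
    have "padic_lim p \<phi> v = padic_lim p \<phi> (\<lambda>n. u n + of_int (- a)) * inverse (of_nat p)"
      unfolding v_def inv[symmetric]
      by (intro padic_lim_mult cauchy_add cauchy_const prime_p u)
    also have "padic_lim p \<phi> (\<lambda>n. u n + of_int (- a)) = z + of_int (- a)"
      unfolding u(3) padic_lim_of_int[symmetric]
      by (intro padic_lim_add cauchy_const prime_p u)
    finally show ?thesis .
  qed
  ultimately have "(z - of_int a) / of_nat p \<in> Zp_in_C p \<phi>"
    using padic_lim_in_Zp_iff[OF vc] by (simp add: divide_inverse)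
  then show ?thesis ..
qed

text \<open>The absolute values of a Cauchy sequence are at last all at most \<open>1\<close> or all greater than \<open>1\<close>,
  by the ultrametric inequality.\<close>

lemma Zp_valuation:
  assumes "z \<in> Qp_in_C p \<phi>"
  shows "z \<in> Zp_in_C p \<phi> \<or> inverse z \<in> Zp_in_C p \<phi>"
proof (cases "z = 0")
  case True
  then show ?thesis using Zp_in_C_of_int[of 0] by simp
next
  case False
  obtain u where u: "u \<in> padic_cauchy p" "z = padic_lim p \<phi> u"
    using assms by (auto simp: Qp_in_C_eq)
  obtain M where M: "\<forall>m\<ge>M. \<forall>n\<ge>M. padic_norm p (u m - u n) < 1"
    using u(1) zero_less_one unfolding padic_cauchy_def by blast
  have *: "padic_norm p (u m) \<le> 1" if "m \<ge> M" "n \<ge> M" "padic_norm p (u n) \<le> 1" for m n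
    using padic_norm_add[OF prime_p, of "u m - u n" "u n"] M that by force
  show ?thesis
  proof (cases "padic_norm p (u M) \<le> 1")
    case True
    then have "ev_integral u"
      using * by (auto simp: eventually_sequentially)
    then show ?thesis using u padic_lim_in_Zp_iff by blast
  next
    case False
    then have "padic_norm p (u n) > 1" if "n \<ge> M" for n
      using *[of M n] that by force
    then have "padic_norm p (inverse (u n)) \<le> 1" if "n \<ge> M" for n
      using that by (fastforce simp: padic_norm_inverse prime_p)
    then have "ev_integral (\<lambda>n. inverse (u n))"
      by (auto simp: eventually_sequentially)
    then show ?thesis
      using padic_lim_inverse[OF u(1)] u(2) \<open>z \<noteq> 0\<close> padic_lim_in_Zp_iff by metis
  qed
qed

text \<open>A simple root modulo \<open>p\<close> of \<open>X\<^sup>2 + e X + c\<close> is lifted by Newton's iteration to a Cauchy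
  sequence whose limit is a root; the roots of the polynomial in the algebraic closure being that
  limit and its conjugate, both are p-adic.\<close>

lemma hensel_quadratic:
  fixes e c h :: int and z :: complex
  assumes h: "int p dvd h^2 + e * h + c" "\<not> int p dvd 2 * h + e"
    and z: "z^2 + of_int e * z + of_int c = 0"
  shows "z \<in> Qp_in_C p \<phi>"
proof -
  have pp: "Factorial_Ring.prime (int p)" using prime_p by simp
  define f where "f = (\<lambda>h :: int. h^2 + e * h + c)"
  have step: "\<exists>h'. (int p ^ Suc (Suc n) dvd f h' \<and> \<not> int p dvd 2 * h' + e) \<and> int p ^ Suc n dvd h' - h"
    if hn: "int p ^ Suc n dvd f h \<and> \<not> int p dvd 2 * h + e" for h n
  proof -
    obtain k where k: "f h = int p ^ Suc n * k" using hn by blast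
    have "coprime (int p) (2 * h + e)"
      using pp hn by (blast intro: prime_imp_coprime)
    then obtain r where "[(2 * h + e) * r = 1] (mod int p)"
      using cong_solve_coprime_int coprime_commute by blast
    then obtain q where q: "(2 * h + e) * r = 1 + int p * q"
      by (metis cong_iff_lin cong_sym)
    define h' where "h' = h + int p ^ Suc n * (- k * r)"
    \<comment> \<open>Taylor expansion at \<open>h\<close>; the linear term cancels \<open>f h\<close> up to a further factor \<open>p\<close>.\<close>
    have "f h' = f h + int p ^ Suc n * (- k * ((2 * h + e) * r)) + (int p ^ Suc n * (k * r))^2"
      unfolding f_def h'_def by (simp add: power2_eq_square algebra_simps)
    also have "\<dots> = int p ^ Suc n * (- k * (int p * q)) + (int p ^ Suc n * (k * r))^2"
      unfolding q k by (simp add: algebra_simps)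
    also have "\<dots> = int p ^ Suc (Suc n) * (- k * q + int p ^ n * (k * r)^2)"
      by (simp add: power2_eq_square algebra_simps)
    finally have "int p ^ Suc (Suc n) dvd f h'" by simp
    moreover have "2 * h' + e = (2 * h + e) + int p * (2 * int p ^ n * (- k * r))"
      by (simp add: h'_def algebra_simps)
    then have "\<not> int p dvd 2 * h' + e"
      using hn by (metis dvd_add_left_iff dvd_triv_left)
    moreover have "int p ^ Suc n dvd h' - h" by (simp add: h'_def)
    ultimately show ?thesis by blast
  qed
  obtain H where H: "\<And>n. int p ^ Suc n dvd f (H n) \<and> \<not> int p dvd 2 * H n + e"
    "\<And>n. int p ^ Suc n dvd H (Suc n) - H n"
  proof -
    have "\<exists>x. int p ^ Suc 0 dvd f x \<and> \<not> int p dvd 2 * x + e"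
      using h by (auto simp: f_def)
    from dependent_nat_choice[of "\<lambda>n h. int p ^ Suc n dvd f h \<and> \<not> int p dvd 2 * h + e"
        "\<lambda>n h h'. int p ^ Suc n dvd h' - h", OF this step] that show ?thesis by blast
  qed
  have H': "int p ^ Suc n dvd H (n + k) - H n" for n k
  proof (induction k)
    case (Suc k)
    have "int p ^ Suc n dvd H (Suc (n + k)) - H (n + k)"
      by (rule dvd_trans[OF _ H(2)]) (simp add: le_imp_power_dvd)
    from dvd_add[OF this Suc] show ?case by simp
  qed simp
  have small: "\<exists>N. \<forall>n\<ge>N. 1 / real p ^ n < \<epsilon>" if eps: "\<epsilon> > 0" for \<epsilon> :: real
  proof -
    obtain N where N: "(1 / real p) ^ N < \<epsilon>"
      using real_arch_pow_inv[OF eps, of "1 / real p"] p_gt[OF prime_p] by auto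
    have "1 / real p ^ n < \<epsilon>" if "n \<ge> N" for n
    proof -
      have "(1 / real p) ^ n \<le> (1 / real p) ^ N"
        using that p_gt[OF prime_p] by (intro power_decreasing) auto
      then show ?thesis using N by (simp add: power_divide)
    qed
    then show ?thesis by blast
  qed
  define u where "u = (\<lambda>n. of_int (H n) :: rat)"
  have u: "u \<in> padic_cauchy p"
    unfolding padic_cauchy_def
  proof clarify
    fix \<epsilon> :: real assume "\<epsilon> > 0"
    then obtain N where N: "\<forall>n\<ge>N. 1 / real p ^ n < \<epsilon>" using small by blast
    have *: "padic_norm p (u m - u n) < \<epsilon>" if "N \<le> n" "n \<le> m" for m n
    proof -
      have "int p ^ Suc n dvd H m - H n"
        using H'[of n "m - n"] that by simp
      then have "padic_norm p (of_int (H m - H n)) \<le> 1 / real p ^ Suc n"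
        by (rule padic_norm_of_int_dvd[OF prime_p])
      moreover have "1 / real p ^ Suc n < \<epsilon>" using N that by (meson le_SucI)
      ultimately show ?thesis by (simp add: u_def)
    qed
    have "padic_norm p (u m - u n) < \<epsilon>" if "N \<le> m" "N \<le> n" for m n
      using *[of n m] *[of m n] that padic_norm_minus[OF prime_p, of "u m - u n"]
      by (cases "n \<le> m") auto
    then show "\<exists>M. \<forall>m\<ge>M. \<forall>n\<ge>M. padic_norm p (u m - u n) < \<epsilon>" by blast
  qed
  define v where "v = (\<lambda>n. u n * u n + of_int e * u n + of_int c)"
  have "(\<lambda>n. padic_norm p (v n)) \<longlonglongrightarrow> 0"
  proof (rule LIMSEQ_I)
    fix \<epsilon> :: real assume "\<epsilon> > 0"
    then obtain N where N: "\<forall>n\<ge>N. 1 / real p ^ n < \<epsilon>" using small by blast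
    have "padic_norm p (v n) < \<epsilon>" if "n \<ge> N" for n
    proof -
      have "padic_norm p (of_int (f (H n))) \<le> 1 / real p ^ Suc n"
        using H(1) by (intro padic_norm_of_int_dvd[OF prime_p]) blast
      moreover have "1 / real p ^ Suc n < \<epsilon>" using N that by (meson le_SucI)
      ultimately show ?thesis by (simp add: v_def u_def f_def power2_eq_square)
    qed
    then show "\<exists>no. \<forall>n\<ge>no. norm (padic_norm p (v n) - 0) < \<epsilon>"
      using padic_norm_nonneg by auto
  qed
  then have "v \<in> padic_null p" by (simp add: padic_null_def)
  then have "padic_lim p \<phi> v = 0"
    using null_cauchy[OF prime_p] padic_lim_eq_0_iff by blast
  define y where "y = padic_lim p \<phi> u"
  have "padic_lim p \<phi> v = y * y + of_int e * y + of_int c"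
    unfolding v_def y_def
    by (simp add: padic_lim_add padic_lim_mult u cauchy_add cauchy_mult cauchy_const prime_p padic_lim_of_int)
  with \<open>padic_lim p \<phi> v = 0\<close> have "y * y + of_int e * y + of_int c = 0" by simp
  moreover have "(z - y) * (z + y + of_int e)
      = (z^2 + of_int e * z + of_int c) - (y * y + of_int e * y + of_int c)"
    by (simp add: power2_eq_square algebra_simps)
  ultimately have "(z - y) * (z + y + of_int e) = 0"
    using z by simp
  then have "z - y = 0 \<or> z + y + of_int e = 0"
    by (simp only: mult_eq_0_iff)
  then have "z = y \<or> z = - (y + of_int e)"
    by (metis add.assoc eq_iff_diff_eq_0 eq_neg_iff_add_eq_0)
  moreover have "y \<in> Qp_in_C p \<phi>"
    unfolding y_def Qp_in_C_eq using u by blast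
  ultimately show ?thesis
    using Qp_in_C_uminus[OF Qp_in_C_add[OF _ Qp_in_C_of_int]] by blast
qed

end


section \<open>Algebraic integers of an imaginary quadratic field\<close>

text \<open>The order \<open>\<int>[\<surd>-d]\<close>, which may be smaller than the ring of integers; it only serves to
  bound denominators.\<close>

definition sqrt_neg_order :: "int \<Rightarrow> complex set" where
  "sqrt_neg_order d = {of_int x + of_int y * sqrt_neg d | x y. True}"

lemma sqrt_neg_square: "d > 0 \<Longrightarrow> sqrt_neg d * sqrt_neg d = - of_int d"
  by (simp add: sqrt_neg_def complex_eq_iff)

lemma cnj_sqrt_neg: "cnj (sqrt_neg d) = - sqrt_neg d"
  by (simp add: sqrt_neg_def)

lemma of_int_in_sqrt_neg_order: "of_int x \<in> sqrt_neg_order d"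
  unfolding sqrt_neg_order_def by (rule CollectI, rule exI[of _ x], rule exI[of _ 0]) simp

lemma sqrt_neg_order_add:
  "u \<in> sqrt_neg_order d \<Longrightarrow> v \<in> sqrt_neg_order d \<Longrightarrow> u + v \<in> sqrt_neg_order d"
  unfolding sqrt_neg_order_def
proof clarify
  fix x y x' y' :: int
  show "\<exists>x'' y''. of_int x + of_int y * sqrt_neg d + (of_int x' + of_int y' * sqrt_neg d)
      = of_int x'' + of_int y'' * sqrt_neg d \<and> True"
    by (rule exI[of _ "x + x'"], rule exI[of _ "y + y'"]) (simp add: algebra_simps)
qed

lemma sqrt_neg_order_mult:
  assumes "d > 0"
  shows "u \<in> sqrt_neg_order d \<Longrightarrow> v \<in> sqrt_neg_order d \<Longrightarrow> u * v \<in> sqrt_neg_order d"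
  unfolding sqrt_neg_order_def
proof clarify
  fix x y x' y' :: int
  have "(of_int x + of_int y * sqrt_neg d) * (of_int x' + of_int y' * sqrt_neg d)
      = of_int (x * x') + of_int (y * y') * (sqrt_neg d * sqrt_neg d) + of_int (x * y' + y * x') * sqrt_neg d"
    by (simp add: algebra_simps)
  then show "\<exists>x'' y''. (of_int x + of_int y * sqrt_neg d) * (of_int x' + of_int y' * sqrt_neg d)
      = of_int x'' + of_int y'' * sqrt_neg d \<and> True"
    using assms
    by (intro exI[of _ "x * x' - d * (y * y')"] exI[of _ "x * y' + y * x'"])
      (simp add: sqrt_neg_square algebra_simps)
qed

lemma sqrt_neg_order_sum:
  "(\<And>i. i \<in> A \<Longrightarrow> f i \<in> sqrt_neg_order d) \<Longrightarrow> (\<Sum>i\<in>A. f i) \<in> sqrt_neg_order d"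
  using of_int_in_sqrt_neg_order[of 0 d]
  by (induction A rule: infinite_finite_induct) (auto intro: sqrt_neg_order_add)

lemma sqrt_neg_order_power: "d > 0 \<Longrightarrow> u \<in> sqrt_neg_order d \<Longrightarrow> u ^ n \<in> sqrt_neg_order d"
  using of_int_in_sqrt_neg_order[of 1 d]
  by (induction n) (auto intro: sqrt_neg_order_mult)

lemma quad_field_common_denominator:
  assumes "z \<in> quad_field d"
  obtains D :: int where "D \<noteq> 0" "of_int D * z \<in> sqrt_neg_order d"
proof -
  obtain a b where z: "z = of_rat a + of_rat b * sqrt_neg d"
    using assms by (auto simp: quad_field_def)
  obtain n m where a: "a = of_int n / of_int m" "m \<noteq> 0"
    by (metis quotient_of_denom_pos quotient_of_div less_irrefl surj_pair)
  obtain n' m' where b: "b = of_int n' / of_int m'" "m' \<noteq> 0"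
    by (metis quotient_of_denom_pos quotient_of_div less_irrefl surj_pair)
  have "of_int (m * m') * z = of_int (n * m') + of_int (n' * m) * sqrt_neg d"
    using a b by (simp add: z of_rat_divide) (simp add: field_simps)
  then have "of_int (m * m') * z \<in> sqrt_neg_order d"
    unfolding sqrt_neg_order_def by blast
  moreover have "m * m' \<noteq> 0" using a b by simp
  ultimately show ?thesis using that by blast
qed

text \<open>Each power of an algebraic integer is an integral combination of the first few, whose
  denominators have a common multiple. Bounded denominators of all powers, unlike integrality, pass
  to norms and to translates by direct computation.\<close>

lemma algebraic_int_powers_bounded:
  assumes d: "d > 0" and z: "z \<in> quad_field d" "algebraic_int z"
  obtains M :: int where "M \<noteq> 0" "\<And>k. of_int M * z ^ k \<in> sqrt_neg_order d"
proof -
  obtain P where P: "Polynomial.lead_coeff P = 1" "\<forall>i. Polynomial.coeff P i \<in> \<int>" "Polynomial.poly P z = 0"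
    using z(2) by (auto elim: algebraic_int.cases)
  define n where "n = Polynomial.degree P"
  define c where "c = Polynomial.coeff P"
  obtain D where D: "D \<noteq> 0" "of_int D * z \<in> sqrt_neg_order d"
    using quad_field_common_denominator[OF z(1)] .
  have zn: "z ^ n = (\<Sum>i<n. - c i * z ^ i)"
  proof -
    have "0 = (\<Sum>i\<le>n. c i * z ^ i)"
      using P(3) by (simp add: poly_altdef n_def c_def)
    also have "\<dots> = (\<Sum>i<n. c i * z ^ i) + z ^ n"
      using P(1) by (simp add: n_def c_def lessThan_Suc_atMost[symmetric])
    finally show ?thesis
      by (simp add: sum_negf eq_neg_iff_add_eq_0 add.commute)
  qed
  have "of_int (D ^ n) * z ^ k \<in> sqrt_neg_order d" for k
  proof (induction k rule: less_induct)
    case (less k)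
    show ?case
    proof (cases "k < n")
      case True
      have "(of_int (D ^ n) :: complex) = of_int (D ^ (n - k)) * of_int D ^ k"
        using True by (simp flip: power_add)
      then have "of_int (D ^ n) * z ^ k = of_int (D ^ (n - k)) * (of_int D * z) ^ k"
        by (simp add: power_mult_distrib mult.assoc)
      then show ?thesis
        using d D(2) by (simp only: sqrt_neg_order_mult sqrt_neg_order_power of_int_in_sqrt_neg_order)
    next
      case False
      have "of_int (D ^ n) * z ^ k = of_int (D ^ n) * (z ^ (k - n) * z ^ n)"
        using False by (simp flip: power_add)
      also have "\<dots> = (\<Sum>i<n. - c i * (of_int (D ^ n) * z ^ (k - n + i)))"
        by (simp add: zn sum_distrib_left power_add mult_ac)
      also have "\<dots> \<in> sqrt_neg_order d"
      proof (rule sqrt_neg_order_sum)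
        fix i assume i: "i \<in> {..<n}"
        obtain a where "c i = of_int a" using P(2) unfolding c_def by (metis Ints_cases)
        then have "- c i = of_int (- a)" by simp
        then have "- c i \<in> sqrt_neg_order d"
          by (simp only: of_int_in_sqrt_neg_order)
        moreover have "of_int (D ^ n) * z ^ (k - n + i) \<in> sqrt_neg_order d"
          using i False by (intro less.IH) auto
        ultimately show "- c i * (of_int (D ^ n) * z ^ (k - n + i)) \<in> sqrt_neg_order d"
          by (rule sqrt_neg_order_mult[OF d])
      qed
      finally show ?thesis .
    qed
  qed
  moreover have "D ^ n \<noteq> 0" using D by simp
  ultimately show ?thesis using that by blast
qed

text \<open>All powers of the reduced denominator divide the bound.\<close>

lemma rat_powers_bounded_imp_int:
  fixes r :: rat and M :: int
  assumes M: "M \<noteq> 0" and int: "\<And>k. of_int M * r ^ k \<in> \<int>"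
  shows "r \<in> \<int>"
proof -
  obtain N D where q: "quotient_of r = (N, D)" by fastforce
  have D: "D > 0" and cop: "coprime N D" and r: "r = of_int N / of_int D"
    using quotient_of_denom_pos[OF q] quotient_of_coprime[OF q] quotient_of_div[OF q] by auto
  have dvd: "D ^ k dvd M" for k
  proof -
    obtain j where j: "of_int M * r ^ k = of_int j" using int[of k] by (auto elim: Ints_cases)
    have "(of_int (M * N ^ k) :: rat) = of_int (j * D ^ k)"
      using j D by (simp add: r power_divide field_simps)
    then have "D ^ k dvd M * N ^ k" by (simp only: of_int_eq_iff) simp
    moreover have "coprime (D ^ k) (N ^ k)" using cop by (simp add: coprime_commute)
    ultimately show ?thesis by (simp add: coprime_dvd_mult_left_iff)
  qed
  have "D = 1"
  proof (rule ccontr)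
    assume "D \<noteq> 1"
    then have "2 \<le> D" using D by simp
    define k where "k = nat \<bar>M\<bar>"
    have "int k < 2 ^ k" by (metis of_nat_less_two_power)
    also have "2 ^ k \<le> D ^ k" using \<open>2 \<le> D\<close> by (intro power_mono) auto
    also have "\<dots> \<le> \<bar>M\<bar>" using dvd[of k] M D by (metis abs_of_pos dvd_imp_le_int zero_less_power)
    finally show False by (simp add: k_def)
  qed
  then show ?thesis using r by simp
qed

lemma quad_field_bounded_norm:
  assumes d: "d > 0" and M: "M \<noteq> 0"
    and bd: "\<And>k. of_int M * (of_rat a + of_rat b * sqrt_neg d) ^ k \<in> sqrt_neg_order d"
  shows "a^2 + of_int d * b^2 \<in> \<int>"
proof (rule rat_powers_bounded_imp_int[of "M^2"])
  show "M^2 \<noteq> 0" using M by simp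
  fix k
  define z where "z = of_rat a + of_rat b * sqrt_neg d"
  have norm: "(of_rat u + of_rat v * sqrt_neg d) * cnj (of_rat u + of_rat v * sqrt_neg d)
      = of_rat (u^2 + of_int d * v^2)" for u v
  proof -
    have c: "cnj (of_rat q) = of_rat q" for q
      by (cases q rule: Rat_cases) (simp add: Fract_of_int_quotient of_rat_divide)
    have "(of_rat u + of_rat v * sqrt_neg d) * (of_rat u - of_rat v * sqrt_neg d)
      = of_rat u * of_rat u - of_rat v * of_rat v * (sqrt_neg d * sqrt_neg d)"
      by (simp add: algebra_simps)
    then show ?thesis
      using d by (simp add: c cnj_sqrt_neg sqrt_neg_square of_rat_add of_rat_mult power2_eq_square)
  qed
  obtain x y where xy: "of_int M * z ^ k = of_int x + of_int y * sqrt_neg d"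
    using bd[of k] by (auto simp: z_def sqrt_neg_order_def)
  have "of_rat (of_int (M^2) * (a^2 + of_int d * b^2) ^ k) = of_int (M^2) * (z * cnj z) ^ k"
    unfolding z_def norm by (simp add: of_rat_mult of_rat_power)
  also have "\<dots> = (of_int M * z ^ k) * cnj (of_int M * z ^ k)"
    by (simp add: power_mult_distrib power2_eq_square)
  also have "\<dots> = of_rat ((of_int x)^2 + of_int d * (of_int y)^2)"
    unfolding xy using norm[of "of_int x" "of_int y"] by simp
  finally have "of_int (M^2) * (a^2 + of_int d * b^2) ^ k = of_int (x^2 + d * y^2)"
    by (simp only: of_rat_eq_iff) simp
  then show "of_int (M^2) * (a^2 + of_int d * b^2) ^ k \<in> \<int>" by simp
qed

text \<open>The norms of \<open>z\<close> and \<open>z + 1\<close> are integers, for their powers have bounded denominators;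
  hence so is the trace, which is their difference less one.\<close>

lemma algebraic_int_norm_trace:
  assumes d: "d > 0" and alg: "algebraic_int (of_rat a + of_rat b * sqrt_neg d)"
  shows "a^2 + of_int d * b^2 \<in> \<int>" "2 * a \<in> \<int>"
proof -
  define z where "z = of_rat a + of_rat b * sqrt_neg d"
  have "z \<in> quad_field d" by (auto simp: z_def quad_field_def)
  then obtain M :: int where M: "M \<noteq> 0" "\<And>k. of_int M * z ^ k \<in> sqrt_neg_order d"
    using algebraic_int_powers_bounded[OF d] alg unfolding z_def by metis
  show N: "a^2 + of_int d * b^2 \<in> \<int>"
    using quad_field_bounded_norm[OF d M(1)] M(2) unfolding z_def .
  have "of_int M * (z + 1) ^ k \<in> sqrt_neg_order d" for k
  proof -
    have "of_int M * (z + 1) ^ k = (\<Sum>i\<le>k. of_int (int (k choose i)) * (of_int M * z ^ i))"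
      by (simp add: binomial_ring sum_distrib_left mult_ac)
    also have "\<dots> \<in> sqrt_neg_order d"
      by (rule sqrt_neg_order_sum, rule sqrt_neg_order_mult[OF d of_int_in_sqrt_neg_order M(2)])
    finally show ?thesis .
  qed
  moreover have "z + 1 = of_rat (a + 1) + of_rat b * sqrt_neg d"
    by (simp add: z_def of_rat_add)
  ultimately have "(a + 1)^2 + of_int d * b^2 \<in> \<int>"
    using quad_field_bounded_norm[OF d M(1), of "a + 1" b] by simp
  from Ints_diff[OF Ints_diff[OF this N], of 1] show "2 * a \<in> \<int>"
    by (simp add: power2_eq_square algebra_simps)
qed

text \<open>Twice the irrational coordinate is an integer because \<open>d\<close> has no square factor, and its
  parity is governed by \<open>d\<close> modulo \<open>4\<close>.\<close>

theorem quad_field_algebraic_int: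
  assumes d: "d > 0" "squarefree d" and z: "z \<in> quad_field d" "algebraic_int z"
  obtains x y :: int where "z = of_int x + of_int y * theta d"
proof -
  obtain a b where ab: "z = of_rat a + of_rat b * sqrt_neg d"
    using z(1) by (auto simp: quad_field_def)
  obtain m where m: "2 * a = of_int m"
    using algebraic_int_norm_trace(2)[OF d(1) z(2)[unfolded ab]] by (elim Ints_cases)
  obtain n where n: "a^2 + of_int d * b^2 = of_int n"
    using algebraic_int_norm_trace(1)[OF d(1) z(2)[unfolded ab]] by (elim Ints_cases)
  obtain N D where q: "quotient_of (2 * b) = (N, D)" by fastforce
  have D: "D > 0" and cop: "coprime N D" and b: "2 * b = of_int N / of_int D"
    using quotient_of_denom_pos[OF q] quotient_of_coprime[OF q] quotient_of_div[OF q] by auto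
  have "of_int d * (2 * b)^2 = of_int (4 * n - m^2)"
    by (simp add: n[symmetric] m[symmetric] power2_eq_square algebra_simps)
  moreover have "of_int N = 2 * b * of_int D" using b D by simp
  then have "(of_int (d * N^2) :: rat) = of_int d * (2 * b)^2 * of_int D^2"
    by (simp add: power_mult_distrib)
  ultimately have "(of_int (d * N^2) :: rat) = of_int ((4 * n - m^2) * D^2)"
    by simp
  then have "D^2 dvd d * N^2" by (simp only: of_int_eq_iff) simp
  moreover have "coprime (D^2) (N^2)" using cop by (simp add: coprime_commute)
  ultimately have "D^2 dvd d" by (simp add: coprime_dvd_mult_left_iff)
  with d(2) have "D dvd 1" by (auto simp: squarefree_def)
  with D have "D = 1" by simp
  then have b2: "2 * b = of_int N" using b by simp
  have "of_int (m^2 + d * N^2) = (of_int (4 * n) :: rat)"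
    by (simp add: n[symmetric] m[symmetric] b2[symmetric] power2_eq_square algebra_simps)
  then have mN: "m^2 + d * N^2 = 4 * n" by (simp only: of_int_eq_iff)
  have d4: "\<not> 4 dvd d"
  proof
    assume "4 dvd d"
    then have "2^2 dvd d" by simp
    then have "2 dvd (1::int)" using d(2) unfolding squarefree_def by blast
    then show False by simp
  qed
  have z2: "2 * z = of_int m + of_int N * sqrt_neg d"
  proof -
    have "2 * z = of_rat (2 * a) + of_rat (2 * b) * sqrt_neg d"
      by (simp add: ab of_rat_mult algebra_simps)
    then show ?thesis by (simp add: m b2)
  qed
  have sq: "[t^2 = (if even t then 0 else 1)] (mod 4)" for t :: int
  proof (cases "even t")
    case True
    then obtain k where "t = 2 * k" by (auto elim: evenE)
    then have "t^2 = 4 * k^2" by (simp add: power2_eq_square)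
    then show ?thesis using True by (simp add: cong_def)
  next
    case False
    then obtain k where "t = 2 * k + 1" by (auto elim: oddE)
    then have "t^2 = 1 + 4 * (k^2 + k)" by (simp add: power2_eq_square algebra_simps)
    then have "t^2 mod 4 = 1" by presburger
    then show ?thesis using False by (simp add: cong_def)
  qed
  have eq: "[(if even m then 0 else 1) + d * (if even N then 0 else 1) = 0] (mod 4)"
  proof -
    have "[(if even m then 0 else 1) + d * (if even N then 0 else 1) = m^2 + d * N^2] (mod 4)"
      by (intro cong_add cong_mult cong_refl cong_sym[OF sq])
    then show ?thesis by (simp add: mN cong_def)
  qed
  have parity: "even m \<and> even N \<or> odd m \<and> odd N \<and> d mod 4 = 3"
  proof (cases "even m"; cases "even N")
    assume "even m" "odd N"
    then have "d mod 4 = 0" using eq by (simp add: cong_def)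
    then show ?thesis using d4 by presburger
  next
    assume "odd m" "even N"
    then show ?thesis using eq by (simp add: cong_def)
  next
    assume "odd m" "odd N"
    then have "(1 + d) mod 4 = 0" using eq by (simp add: cong_def)
    then have "d mod 4 = 3" by presburger
    then show ?thesis using \<open>odd m\<close> \<open>odd N\<close> by blast
  qed simp
  show ?thesis
  proof (cases "[- d = 1] (mod 4)")
    case True
    then have "d mod 4 = 3" unfolding cong_def by presburger
    then have "even m = even N"
      using parity by blast
    then have "even (m + N)" by simp
    then obtain k where "m + N = 2 * k" by (rule evenE)
    then have m_eq: "m = 2 * k - N" by simp
    have th: "sqrt_neg d = 2 * theta d + 1"
      using True by (simp add: theta_def)
    have "2 * z = 2 * (of_int k + of_int N * theta d)"
      unfolding z2 m_eq th by (simp add: algebra_simps)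
    then have "z = of_int k + of_int N * theta d" by (simp only: mult_cancel_left) simp
    then show ?thesis by (rule that)
  next
    case False
    then have "d mod 4 \<noteq> 3" unfolding cong_def by presburger
    then have "even m \<and> even N"
      using parity by blast
    then obtain i j where "m = 2 * i" "N = 2 * j" by (auto elim!: evenE)
    then have "2 * z = 2 * (of_int i + of_int j * theta d)"
      using False by (simp add: z2 theta_def)
    then have "z = of_int i + of_int j * theta d" by (simp only: mult_cancel_left) simp
    then show ?thesis by (rule that)
  qed
qed


section \<open>The order generated by a quadratic irrationality\<close>

text \<open>Both shapes of \<open>\<theta>\<close> are covered by a polynomial \<open>X\<^sup>2 + e X + c\<close>, with \<open>e = 0\<close> for \<open>\<surd>-d\<close> and
  \<open>e = 1\<close> for \<open>(-1 + \<surd>-d) / 2\<close>; the trace of \<open>\<theta>\<close> is \<open>- e\<close>.\<close>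

locale imag_quad =
  fixes \<theta> :: complex and e c :: int
  assumes theta_root: "\<theta>^2 + of_int e * \<theta> + of_int c = 0"
    and Im_theta: "Im \<theta> > 0"
begin

definition quad_order :: "complex set" where
  "quad_order = {of_int x + of_int y * \<theta> | x y. True}"

text \<open>The norm form, that is \<open>x\<^sup>2 + d y\<^sup>2\<close> or \<open>x\<^sup>2 - x y + (1 + d) / 4 y\<^sup>2\<close>.\<close>

definition nrm :: "int \<Rightarrow> int \<Rightarrow> int" where
  "nrm x y = x^2 - e * x * y + c * y^2"

lemma theta_square: "\<theta> * \<theta> = - of_int e * \<theta> - of_int c"
  using theta_root by (simp add: power2_eq_square eq_diff_eq eq_neg_iff_add_eq_0 add_ac)

lemma Re_theta: "Re \<theta> = - of_int e / 2"
proof -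
  have "Im (\<theta> * \<theta>) = Im (- of_int e * \<theta> - of_int c)"
    by (simp only: theta_square)
  then have "Im \<theta> * (2 * Re \<theta> + of_int e) = 0"
    by (simp add: algebra_simps)
  then show ?thesis using Im_theta by simp
qed

lemma cnj_theta: "cnj \<theta> = - of_int e - \<theta>"
  using Re_theta by (simp add: complex_eq_iff)

lemma coords_eq_iff:
  "of_int x + of_int y * \<theta> = of_int x' + of_int y' * \<theta> \<longleftrightarrow> x = x' \<and> y = y'"
proof
  assume eq: "of_int x + of_int y * \<theta> = of_int x' + of_int y' * \<theta>"
  from arg_cong[OF eq, of Im] have "y = y'" using Im_theta by simp
  with eq show "x = x' \<and> y = y'" by simp
qed simp

lemma coords_mult:
  "(of_int x + of_int y * \<theta>) * (of_int x' + of_int y' * \<theta>)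
    = of_int (x * x' - c * y * y') + of_int (x * y' + y * x' - e * y * y') * \<theta>"
proof -
  have "(of_int x + of_int y * \<theta>) * (of_int x' + of_int y' * \<theta>)
    = of_int (x * x') + of_int (x * y' + y * x') * \<theta> + of_int (y * y') * (\<theta> * \<theta>)"
    by (simp add: algebra_simps)
  then show ?thesis by (simp add: theta_square algebra_simps)
qed

lemma cnj_coords: "cnj (of_int x + of_int y * \<theta>) = of_int (x - e * y) + of_int (- y) * \<theta>"
  by (simp add: cnj_theta algebra_simps)

lemma coords_norm: "(of_int x + of_int y * \<theta>) * cnj (of_int x + of_int y * \<theta>) = of_int (nrm x y)"
  unfolding cnj_coords coords_mult by (simp add: nrm_def power2_eq_square algebra_simps)

lemma quad_order_of_int: "of_int x \<in> quad_order"
  unfolding quad_order_def by (rule CollectI, rule exI[of _ x], rule exI[of _ 0]) simp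

lemma quad_order_coords: "of_int x + of_int y * \<theta> \<in> quad_order"
  unfolding quad_order_def by blast

lemma quad_order_theta: "\<theta> \<in> quad_order"
  using quad_order_coords[of 0 1] by simp

lemma quad_order_add: "u \<in> quad_order \<Longrightarrow> v \<in> quad_order \<Longrightarrow> u + v \<in> quad_order"
  unfolding quad_order_def
proof clarify
  fix x y x' y' :: int
  show "\<exists>x'' y''. of_int x + of_int y * \<theta> + (of_int x' + of_int y' * \<theta>)
      = of_int x'' + of_int y'' * \<theta> \<and> True"
    by (rule exI[of _ "x + x'"], rule exI[of _ "y + y'"]) (simp add: algebra_simps)
qed

lemma quad_order_mult: "u \<in> quad_order \<Longrightarrow> v \<in> quad_order \<Longrightarrow> u * v \<in> quad_order"
  unfolding quad_order_def using coords_mult by blast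

lemma quad_order_uminus: "u \<in> quad_order \<Longrightarrow> - u \<in> quad_order"
  using quad_order_mult[OF quad_order_of_int[of "-1"]] by simp

lemma quad_order_diff: "u \<in> quad_order \<Longrightarrow> v \<in> quad_order \<Longrightarrow> u - v \<in> quad_order"
  using quad_order_add[of u "- v"] quad_order_uminus by simp

lemma quad_order_power: "u \<in> quad_order \<Longrightarrow> u ^ n \<in> quad_order"
  using quad_order_of_int[of 1] by (induction n) (auto intro: quad_order_mult)

lemma quad_order_cnj: "u \<in> quad_order \<Longrightarrow> cnj u \<in> quad_order"
  unfolding quad_order_def using cnj_coords by blast

lemma quad_order_norm:
  assumes "u \<in> quad_order"
  obtains n :: int where "u * cnj u = of_int n" "n \<ge> 0" "u \<noteq> 0 \<Longrightarrow> n > 0"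
proof -
  obtain n where n: "u * cnj u = of_int n"
    using assms coords_norm by (auto simp: quad_order_def)
  have "(cmod u)^2 = of_int n"
    using arg_cong[OF n[folded complex_norm_square], of Re] by simp
  then have r: "real_of_int n = (cmod u)^2" by simp
  have "real_of_int n \<ge> 0" unfolding r by simp
  moreover have "u \<noteq> 0 \<Longrightarrow> real_of_int n > 0" unfolding r by simp
  ultimately show ?thesis using n that[of n] by simp
qed

text \<open>Two distinct prime ideals above \<open>p\<close> give a simple root of the minimal polynomial of \<open>\<theta>\<close>
  modulo \<open>p\<close>. If \<open>\<alpha> = x + y \<theta>\<close> lies in one and not in the other, then its norm is divisible by \<open>p\<close>
  and so its conjugate lies in the other; hence the trace \<open>2 x - e y\<close> is not divisible by \<open>p\<close>,
  and \<open>- x / y\<close> is the root.\<close>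

lemma simple_root_of_distinct_primes:
  assumes p: "Factorial_Ring.prime p"
    and P: "\<And>u v. u \<in> P \<Longrightarrow> v \<in> P \<Longrightarrow> u + v \<in> P" "\<And>u v. u \<in> quad_order \<Longrightarrow> v \<in> P \<Longrightarrow> u * v \<in> P"
      "of_nat p \<in> P" "1 \<notin> P"
    and P': "\<And>u v. u \<in> P' \<Longrightarrow> v \<in> P' \<Longrightarrow> u + v \<in> P'" "\<And>u v. u \<in> quad_order \<Longrightarrow> v \<in> P' \<Longrightarrow> u * v \<in> P'"
      "of_nat p \<in> P'" "\<And>u v. u \<in> quad_order \<Longrightarrow> v \<in> quad_order \<Longrightarrow> u * v \<in> P' \<Longrightarrow> u \<in> P' \<or> v \<in> P'"
    and \<alpha>: "\<alpha> \<in> quad_order" "\<alpha> \<in> P" "\<alpha> \<notin> P'"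
  shows "\<exists>h. int p dvd h^2 + e * h + c \<and> \<not> int p dvd 2 * h + e"
proof -
  have pp: "Factorial_Ring.prime (int p)" using p by simp
  have pZ: "int p dvd n" if "of_int n \<in> P" for n
  proof (rule ccontr)
    assume "\<not> int p dvd n"
    then have "coprime n (int p)" using prime_imp_coprime[OF pp] by (simp add: coprime_commute)
    then obtain r where "[n * r = 1] (mod int p)" using cong_solve_coprime_int by blast
    then have "int p dvd 1 - n * r" by (simp add: cong_iff_dvd_diff dvd_diff_commute)
    then obtain q where "1 - n * r = int p * q" by blast
    then have q: "1 = n * r + int p * q" by simp
    have "of_int r * of_int n + of_int q * of_nat p \<in> P"
      by (intro P(1) P(2) quad_order_of_int that P(3))
    also have "of_int r * of_int n + of_int q * of_nat p = (of_int (n * r + int p * q) :: complex)"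
      by simp
    also have "\<dots> = 1" by (simp only: q[symmetric]) simp
    finally show False using P(4) by simp
  qed
  have pP': "of_int n \<in> P'" if n: "int p dvd n" for n
  proof -
    from n obtain k where "n = int p * k" by blast
    then have "(of_int n :: complex) = of_int k * of_nat p" by simp
    then show ?thesis using P'(2)[OF quad_order_of_int P'(3)] by simp
  qed
  obtain x y where xy: "\<alpha> = of_int x + of_int y * \<theta>"
    using \<alpha>(1) by (auto simp: quad_order_def)
  have N: "\<alpha> * cnj \<alpha> = of_int (nrm x y)" by (simp only: xy coords_norm)
  have "cnj \<alpha> * \<alpha> \<in> P" by (intro P(2) quad_order_cnj \<alpha>)
  then have pN: "int p dvd nrm x y" using pZ N by (simp add: mult.commute)
  then have "\<alpha> * cnj \<alpha> \<in> P'" unfolding N by (rule pP')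
  then have cP': "cnj \<alpha> \<in> P'" using P'(4)[OF \<alpha>(1) quad_order_cnj[OF \<alpha>(1)]] \<alpha>(3) by blast
  have tr: "\<not> int p dvd 2 * x - e * y"
  proof
    assume "int p dvd 2 * x - e * y"
    then have "of_int (2 * x - e * y) + of_int (- 1) * cnj \<alpha> \<in> P'"
      by (intro P'(1) P'(2) pP' cP' quad_order_of_int)
    also have "of_int (2 * x - e * y) + of_int (- 1) * cnj \<alpha> = \<alpha>"
      unfolding xy cnj_coords by (simp add: algebra_simps)
    finally show False using \<alpha>(3) by simp
  qed
  have y: "\<not> int p dvd y"
  proof
    assume y: "int p dvd y"
    then have "int p dvd x^2"
      using pN unfolding nrm_def by (simp add: dvd_add_left_iff dvd_diff_left_iff power2_eq_square)
    then have "int p dvd x" using pp prime_dvd_power by blast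
    then show False using tr y by simp
  qed
  then have "coprime y (int p)" using prime_imp_coprime[OF pp] by (simp add: coprime_commute)
  then obtain r where r: "[y * r = 1] (mod int p)" using cong_solve_coprime_int by blast
  define h where "h = - (x * r)"
  have hy: "[h * y = - x] (mod int p)"
  proof -
    have "[- x * (y * r) = - x * 1] (mod int p)" by (intro cong_mult r cong_refl)
    then show ?thesis by (simp add: h_def mult_ac)
  qed
  have "[y^2 * (h^2 + e * h + c) = (h * y)^2 + e * (h * y) * y + c * y^2] (mod int p)"
    by (simp add: power2_eq_square algebra_simps)
  also have "[(h * y)^2 + e * (h * y) * y + c * y^2 = (- x)^2 + e * (- x) * y + c * y^2] (mod int p)"
    by (intro cong_add cong_mult cong_pow hy cong_refl)
  also have "(- x)^2 + e * (- x) * y + c * y^2 = nrm x y" by (simp add: nrm_def)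
  finally have "int p dvd y^2 * (h^2 + e * h + c)" using pN by (simp only: cong_dvd_iff)
  then have 1: "int p dvd h^2 + e * h + c"
    using y pp prime_dvd_multD prime_dvd_power by blast
  have "\<not> int p dvd 2 * h + e"
  proof
    assume "int p dvd 2 * h + e"
    then have "int p dvd y * (2 * h + e)" by simp
    moreover have "[y * (2 * h + e) = 2 * (h * y) + e * y] (mod int p)"
      by (simp add: algebra_simps)
    moreover have "[2 * (h * y) + e * y = 2 * (- x) + e * y] (mod int p)"
      by (intro cong_add cong_mult hy cong_refl)
    ultimately have "int p dvd 2 * (- x) + e * y" by (simp only: cong_dvd_iff)
    then have "int p dvd - (2 * (- x) + e * y)" by (simp only: dvd_minus_iff)
    then show False using tr by (simp add: algebra_simps)
  qed
  with 1 show ?thesis by blast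
qed

end

section \<open>The ring of integers and complete splitting\<close>

definition theta_linear_coeff :: "int \<Rightarrow> int" where
  "theta_linear_coeff d = (if [- d = 1] (mod 4) then 1 else 0)"

definition theta_norm :: "int \<Rightarrow> int" where
  "theta_norm d = (if [- d = 1] (mod 4) then (1 + d) div 4 else d)"

lemma theta_norm_times_4: "[- d = 1] (mod 4) \<Longrightarrow> 4 * theta_norm d = 1 + d"
  unfolding theta_norm_def cong_def by presburger

lemma imag_quad_theta:
  assumes "d > 0"
  shows "imag_quad (theta d) (theta_linear_coeff d) (theta_norm d)"
proof
  show "Im (theta d) > 0" using assms by (simp add: theta_def sqrt_neg_def)
  show "(theta d)^2 + of_int (theta_linear_coeff d) * theta d + of_int (theta_norm d) = 0"
  proof (cases "[- d = 1] (mod 4)")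
    case True
    have "4 * ((theta d)^2 + of_int (theta_linear_coeff d) * theta d + of_int (theta_norm d))
      = sqrt_neg d * sqrt_neg d - 1 + of_int (4 * theta_norm d)"
      using True by (simp add: theta_def theta_linear_coeff_def field_simps power2_eq_square)
    also have "\<dots> = 0" unfolding theta_norm_times_4[OF True] using assms by (simp add: sqrt_neg_square)
    finally show ?thesis by (simp only: mult_eq_0_iff) simp
  next
    case False
    then show ?thesis
      using assms by (simp add: theta_def theta_linear_coeff_def theta_norm_def power2_eq_square sqrt_neg_square)
  qed
qed

lemma theta_in_quad_field: "theta d \<in> quad_field d"
proof (cases "[- d = 1] (mod 4)")
  case True
  then have "theta d = of_rat (- 1 / 2) + of_rat (1 / 2) * sqrt_neg d"
    by (simp add: theta_def of_rat_divide of_rat_minus diff_divide_distrib)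
  then show ?thesis unfolding quad_field_def by blast
next
  case False
  then have "theta d = of_rat 0 + of_rat 1 * sqrt_neg d"
    by (simp add: theta_def)
  then show ?thesis unfolding quad_field_def by blast
qed



lemma quad_field_integral:
  assumes "d > 0" "squarefree d" "z \<in> quad_field d" "algebraic_int z"
  shows "z \<in> imag_quad.quad_order (theta d)"
proof -
  interpret imag_quad "theta d" "theta_linear_coeff d" "theta_norm d"
    by (rule imag_quad_theta[OF assms(1)])
  show ?thesis
    using quad_field_algebraic_int[OF assms] quad_order_coords by metis
qed

lemma quad_field_of_int: "of_int n \<in> quad_field d"
proof -
  have "of_int n = of_rat (of_int n) + of_rat 0 * sqrt_neg d" by simp
  then show ?thesis unfolding quad_field_def by blast
qed

lemma quad_field_add: "u \<in> quad_field d \<Longrightarrow> v \<in> quad_field d \<Longrightarrow> u + v \<in> quad_field d"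
  unfolding quad_field_def
proof clarify
  fix x y x' y' :: rat
  show "\<exists>a b. of_rat x + of_rat y * sqrt_neg d + (of_rat x' + of_rat y' * sqrt_neg d)
      = of_rat a + of_rat b * sqrt_neg d \<and> True"
    by (rule exI[of _ "x + x'"], rule exI[of _ "y + y'"]) (simp add: of_rat_add algebra_simps)
qed

lemma quad_field_scale: "v \<in> quad_field d \<Longrightarrow> of_int n * v \<in> quad_field d"
  unfolding quad_field_def
proof clarify
  fix x y :: rat
  show "\<exists>a b. of_int n * (of_rat x + of_rat y * sqrt_neg d) = of_rat a + of_rat b * sqrt_neg d \<and> True"
    by (rule exI[of _ "of_int n * x"], rule exI[of _ "of_int n * y"]) (simp add: of_rat_mult algebra_simps)
qed

lemma quad_order_subset_field:
  assumes "d > 0"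
  shows "imag_quad.quad_order (theta d) \<subseteq> quad_field d"
proof -
  interpret imag_quad "theta d" "theta_linear_coeff d" "theta_norm d"
    by (rule imag_quad_theta[OF assms(1)])
  show ?thesis
    using quad_field_add[OF quad_field_of_int quad_field_scale[OF theta_in_quad_field]]
    by (auto simp: quad_order_def)
qed

lemma quad_order_algebraic_int:
  assumes d: "d > 0" and u: "u \<in> imag_quad.quad_order (theta d)"
  shows "algebraic_int u"
proof -
  interpret imag_quad "theta d" "theta_linear_coeff d" "theta_norm d"
    by (rule imag_quad_theta[OF d])
  obtain x y where xy: "u = of_int x + of_int y * theta d" using u by (auto simp: quad_order_def)
  define t where "t = 2 * x - theta_linear_coeff d * y"
  have t: "u + cnj u = of_int t" unfolding xy cnj_coords by (simp add: t_def)
  have n: "u * cnj u = of_int (nrm x y)" unfolding xy by (rule coords_norm)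
  define f where "f = [: of_int (nrm x y), of_int (- t), 1 :: complex :]"
  have "Polynomial.poly f u = u * cnj u - u * of_int t + u * u"
    by (simp add: f_def n algebra_simps)
  also have "\<dots> = 0" unfolding t[symmetric] by (simp add: algebra_simps)
  finally have "Polynomial.poly f u = 0" .
  moreover have "Polynomial.lead_coeff f = 1" by (simp add: f_def)
  moreover have "\<forall>i. Polynomial.coeff f i \<in> \<int>"
    by (auto simp: f_def coeff_pCons split: nat.splits)
  ultimately show ?thesis by (intro algebraic_int.intros)
qed

lemma quad_integers_carrier:
  assumes "d > 0" "squarefree d"
  shows "carrier (quad_integers d) = imag_quad.quad_order (theta d)"
  using quad_field_integral[OF assms] quad_order_subset_field[OF assms(1)]
    quad_order_algebraic_int[OF assms(1)] by (auto simp: quad_integers_def)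

theorem splits_completely_simple_root:
  assumes d: "d > 0" "squarefree d" and p: "Factorial_Ring.prime p" and s: "splits_completely p d"
  shows "\<exists>h. int p dvd h^2 + theta_linear_coeff d * h + theta_norm d \<and> \<not> int p dvd 2 * h + theta_linear_coeff d"
proof -
  interpret imag_quad "theta d" "theta_linear_coeff d" "theta_norm d"
    by (rule imag_quad_theta[OF d(1)])
  define R where "R = quad_integers d"
  have carR: "carrier R = quad_order" unfolding R_def by (rule quad_integers_carrier[OF d])
  have ops: "\<And>x y. x \<otimes>\<^bsub>R\<^esub> y = x * y" "\<And>x y. x \<oplus>\<^bsub>R\<^esub> y = x + y" "\<one>\<^bsub>R\<^esub> = 1"
    by (simp_all add: R_def quad_integers_def ring_of_type_algebra_def)
  obtain P1 P2 where P: "primeideal P1 R" "primeideal P2 R" "P1 \<noteq> P2"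
    "cgenideal R (of_nat p) = ideal_prod R P1 P2"
    using s unfolding splits_completely_def R_def by blast
  interpret P1: primeideal P1 R by fact
  interpret P2: primeideal P2 R by fact
  have pR: "of_nat p \<in> carrier R"
    using quad_order_of_int[of "int p"] by (simp add: carR)
  have "of_nat p \<in> cgenideal R (of_nat p)"
    by (rule P1.cgenideal_self[OF pR])
  then have pP: "of_nat p \<in> P1 \<inter> P2"
    unfolding P(4) using P1.ideal_prod_inter[OF P1.is_ideal P2.is_ideal] by blast
  have ideal_add: "u + v \<in> Q" if "primeideal Q R" "u \<in> Q" "v \<in> Q" for Q u v
  proof -
    interpret Q: primeideal Q R by (rule that(1))
    show ?thesis using Q.a_closed[OF that(2,3)] by (simp add: ops)
  qed
  have ideal_mult: "w * u \<in> Q" if "primeideal Q R" "w \<in> quad_order" "u \<in> Q" for Q u w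
  proof -
    interpret Q: primeideal Q R by (rule that(1))
    show ?thesis using Q.I_l_closed[OF that(3), of w] that(2) by (simp add: ops carR)
  qed
  have ideal_proper: "1 \<notin> Q" if "primeideal Q R" for Q
  proof -
    interpret Q: primeideal Q R by (rule that)
    show ?thesis using Q.one_imp_carrier Q.I_notcarr by (auto simp: ops)
  qed
  have ideal_prime: "v \<in> Q \<or> w \<in> Q"
    if "primeideal Q R" "v \<in> quad_order" "w \<in> quad_order" "v * w \<in> Q" for Q v w
  proof -
    interpret Q: primeideal Q R by (rule that(1))
    show ?thesis using Q.I_prime[of v w] that(2-) by (simp add: ops carR)
  qed
  have main: ?thesis
    if Q: "primeideal Q R" "primeideal Q' R" and \<alpha>: "\<alpha> \<in> Q" "\<alpha> \<notin> Q'" "of_nat p \<in> Q" "of_nat p \<in> Q'"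
    for Q Q' \<alpha>
  proof -
    interpret Q: primeideal Q R by (rule Q(1))
    have "\<alpha> \<in> quad_order" using Q.a_subset \<alpha>(1) by (auto simp: carR)
    from simple_root_of_distinct_primes[OF p ideal_add[OF Q(1)] ideal_mult[OF Q(1)] \<alpha>(3)
        ideal_proper[OF Q(1)] ideal_add[OF Q(2)] ideal_mult[OF Q(2)] \<alpha>(4) ideal_prime[OF Q(2)]
        this \<alpha>(1,2)]
    show ?thesis .
  qed
  from \<open>P1 \<noteq> P2\<close> consider \<alpha> where "\<alpha> \<in> P1" "\<alpha> \<notin> P2" | \<alpha> where "\<alpha> \<in> P2" "\<alpha> \<notin> P1" by blast
  then show ?thesis
  proof cases
    case 1
    then show ?thesis using main[OF P(1,2)] pP by blast
  next
    case 2
    then show ?thesis using main[OF P(2,1)] pP by blast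
  qed
qed


section \<open>A split prime: the powers of a prime ideal as congruence conditions\<close>

text \<open>Here \<open>Z\<close> stands for the p-adic integers inside the complex numbers. It is described as a subring
  that does not contain \<open>1 / p\<close>, has the residues of the integers modulo \<open>p\<close>, and is a valuation ring
  on the quotients of the order. The choice of \<open>Z\<close> is the choice of one of the two primes above \<open>p\<close>.\<close>

locale split_order = imag_quad +
  fixes p :: nat and Z :: "complex set"
  assumes e_cases: "e = 0 \<or> e = 1"
    and prime_p: "Factorial_Ring.prime p"
    and unramified: "\<not> int p dvd e^2 - 4 * c"
    and Z_of_int: "of_int n \<in> Z"
    and Z_add: "u \<in> Z \<Longrightarrow> v \<in> Z \<Longrightarrow> u + v \<in> Z"
    and Z_mult: "u \<in> Z \<Longrightarrow> v \<in> Z \<Longrightarrow> u * v \<in> Z"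
    and Z_inverse_p: "1 / of_nat p \<notin> Z"
    and Z_residue: "z \<in> Z \<Longrightarrow> \<exists>a::int. (z - of_int a) / of_nat p \<in> Z"
    and Z_valuation: "u \<in> quad_order \<Longrightarrow> v \<in> quad_order \<Longrightarrow> u / v \<in> Z \<or> v / u \<in> Z"
begin

lemma p_pos [simp]: "p > 0" "p \<noteq> 0" "(of_nat p :: complex) \<noteq> 0"
  using prime_gt_0_nat[OF prime_p] by auto

lemma prime_int_p: "Factorial_Ring.prime (int p)"
  using prime_p by simp

lemma Z_uminus: "u \<in> Z \<Longrightarrow> - u \<in> Z"
  using Z_mult[OF Z_of_int[of "- 1"]] by simp

lemma Z_diff: "u \<in> Z \<Longrightarrow> v \<in> Z \<Longrightarrow> u - v \<in> Z"
  using Z_add[of u "- v"] Z_uminus by simp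

lemma Z_0: "0 \<in> Z" and Z_1: "1 \<in> Z" and Z_of_nat: "of_nat n \<in> Z"
  using Z_of_int[of 0] Z_of_int[of 1] Z_of_int[of "int n"] by simp_all

lemma Z_power: "u \<in> Z \<Longrightarrow> u ^ n \<in> Z"
  by (induction n) (auto simp: Z_1 Z_mult)

lemma Z_div_power_le:
  assumes "u / of_nat p ^ n \<in> Z" "m \<le> n"
  shows "u / of_nat p ^ m \<in> Z"
proof -
  have "u / of_nat p ^ m = of_nat p ^ (n - m) * (u / of_nat p ^ n)"
    using assms(2) by (simp add: field_simps flip: power_add)
  also have "\<dots> \<in> Z" by (intro Z_mult Z_power Z_of_nat assms(1))
  finally show ?thesis .
qed

lemma bezout_p:
  assumes "\<not> int p dvd n"
  obtains r q where "n * r = 1 + int p * q"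
proof -
  have "coprime n (int p)"
    using prime_imp_coprime[OF prime_int_p assms] by (simp add: coprime_commute)
  then obtain r where "[n * r = 1] (mod int p)" using cong_solve_coprime_int by blast
  then have "int p dvd n * r - 1" by (simp add: cong_iff_dvd_diff)
  then obtain q where "n * r - 1 = int p * q" by blast
  then have "n * r = 1 + int p * q" by simp
  then show ?thesis by (rule that)
qed

lemma Z_int_div_p:
  assumes "of_int n / of_nat p \<in> Z"
  shows "int p dvd n"
proof (rule ccontr)
  assume "\<not> int p dvd n"
  then obtain r q where rq: "n * r = 1 + int p * q" by (rule bezout_p)
  have nr: "(of_int n :: complex) * of_int r = of_int (1 + int p * q)" by (simp flip: rq)
  have "of_int n / of_nat p * of_int r - of_int q
      = (of_int n * of_int r - of_nat p * of_int q) / (of_nat p :: complex)"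
    by (simp add: diff_divide_distrib)
  then have "1 / of_nat p = of_int n / of_nat p * of_int r - (of_int q :: complex)"
    unfolding nr by simp
  also have "\<dots> \<in> Z" by (intro Z_diff Z_mult assms Z_of_int)
  finally show False using Z_inverse_p by simp
qed

lemma Z_int_div_power:
  assumes "of_int n / of_nat p ^ k \<in> Z"
  shows "int p ^ k dvd n"
  using assms
proof (induction k)
  case (Suc k)
  have "int p ^ k dvd n" by (rule Suc.IH[OF Z_div_power_le[OF Suc.prems]]) simp
  then obtain m where m: "n = int p ^ k * m" by blast
  have eq: "of_int m / of_nat p = (of_int n / of_nat p ^ Suc k :: complex)"
    by (simp add: m)
  have "of_int m / of_nat p \<in> Z" unfolding eq by (rule Suc.prems)
  then have "int p dvd m" by (rule Z_int_div_p)
  then show ?case by (simp add: m mult.commute)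
qed simp

lemma Z_residue_power:
  assumes "z \<in> Z"
  shows "\<exists>a::int. (z - of_int a) / of_nat p ^ k \<in> Z"
proof (induction k)
  case 0
  show ?case using Z_diff[OF assms Z_of_int] by auto
next
  case (Suc k)
  then obtain a :: int where a: "(z - of_int a) / of_nat p ^ k \<in> Z" by blast
  obtain b :: int where b: "((z - of_int a) / of_nat p ^ k - of_int b) / of_nat p \<in> Z"
    using Z_residue[OF a] by blast
  have eq: "((z - of_int a) / of_nat p ^ k - of_int b) / of_nat p
      = (z - of_int (a + int p ^ k * b)) / of_nat p ^ Suc k"
    by (simp add: field_simps)
  show ?case by (rule exI) (rule b[unfolded eq])
qed

lemma Z_theta: "\<theta> \<in> Z"
proof -
  have nz: "\<theta> \<noteq> 0" using Im_theta by auto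
  have "\<theta> / 1 \<in> Z \<or> 1 / \<theta> \<in> Z"
    using Z_valuation[OF quad_order_theta quad_order_of_int[of 1]] by simp
  moreover have "\<theta> = of_int (- e) - of_int c * (1 / \<theta>)"
  proof -
    have "\<theta> * \<theta> = of_int (- e) * \<theta> - of_int c" using theta_square by simp
    then show ?thesis using nz by (simp add: field_simps)
  qed
  moreover have "of_int (- e) - of_int c * (1 / \<theta>) \<in> Z" if "1 / \<theta> \<in> Z"
    by (intro Z_diff Z_mult Z_of_int that)
  ultimately show ?thesis by fastforce
qed

lemma quad_order_Z: "u \<in> quad_order \<Longrightarrow> u \<in> Z"
  by (auto simp: quad_order_def intro!: Z_add Z_mult Z_of_int Z_theta)

text \<open>The valuation is discrete on the order: what is not divisible by \<open>p\<close> is a unit. Up to an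
  integer factor such an element is \<open>v = 1 + p t\<close>. Of \<open>(v - 1) / v\<close> and its inverse one is integral;
  the latter is \<open>1 + 1 / (p t)\<close>, which would make \<open>1 / p\<close> integral, and the former is \<open>1 - 1 / v\<close>.\<close>

lemma Z_unit:
  assumes w: "w \<in> quad_order" and nd: "w / of_nat p \<notin> Z"
  shows "1 / w \<in> Z"
proof -
  obtain a :: int where a: "(w - of_int a) / of_nat p \<in> Z"
    using Z_residue[OF quad_order_Z[OF w]] by blast
  have "\<not> int p dvd a"
  proof
    assume "int p dvd a"
    then obtain b where b: "a = int p * b" by blast
    have "w / of_nat p = (w - of_int a) / of_nat p + of_int b" by (simp add: b field_simps)
    also have "\<dots> \<in> Z" by (intro Z_add a Z_of_int)
    finally show False using nd by simp
  qed
  then obtain r q where rq: "a * r = 1 + int p * q" by (rule bezout_p)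
  define v where "v = of_int r * w"
  define t where "t = (v - 1) / of_nat p"
  have v: "v \<in> quad_order" unfolding v_def by (intro quad_order_mult quad_order_of_int w)
  have ar: "(of_int a :: complex) * of_int r = of_int (1 + int p * q)" by (simp flip: rq)
  have "of_int r * ((w - of_int a) / of_nat p) + of_int q
      = (v - of_int a * of_int r + of_nat p * of_int q) / of_nat p"
    by (simp add: v_def add_divide_distrib diff_divide_distrib right_diff_distrib mult.commute)
  then have "t = of_int r * ((w - of_int a) / of_nat p) + of_int q"
    unfolding ar by (simp add: t_def)
  also have "\<dots> \<in> Z" by (intro Z_add Z_mult Z_of_int a)
  finally have tZ: "t \<in> Z" .
  have vt: "v = 1 + of_nat p * t" by (simp add: t_def)
  have v0: "v \<noteq> 0"
  proof
    assume "v = 0"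
    then have "1 / of_nat p = - t" by (simp add: t_def)
    then show False using Z_uminus[OF tZ] Z_inverse_p by simp
  qed
  have "(v - 1) / v \<in> Z"
  proof (rule ccontr)
    assume n: "(v - 1) / v \<notin> Z"
    have "v - 1 \<in> quad_order" using quad_order_diff[OF v quad_order_of_int[of 1]] by simp
    from Z_valuation[OF v this] n have 1: "v / (v - 1) \<in> Z" by simp
    have "v - 1 \<noteq> 0" using n Z_0 by auto
    then have t0: "t \<noteq> 0" by (simp add: t_def)
    have "1 / of_nat p = t * (v / (v - 1) - 1)" using t0 by (simp add: vt field_simps)
    also have "\<dots> \<in> Z" by (intro Z_mult tZ Z_diff 1 Z_1)
    finally show False using Z_inverse_p by simp
  qed
  then have "1 - (v - 1) / v \<in> Z" by (intro Z_diff Z_1)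
  also have "1 - (v - 1) / v = 1 / v" using v0 by (simp add: field_simps)
  finally have "of_int r * (1 / v) \<in> Z" by (intro Z_mult Z_of_int)
  also have "of_int r * (1 / v) = 1 / w" using v0 by (simp add: v_def)
  finally show ?thesis .
qed

lemma theta_discriminant: "(2 * \<theta> + of_int e) * (2 * \<theta> + of_int e) = of_int (e^2 - 4 * c)"
proof -
  have "(2 * \<theta> + of_int e) * (2 * \<theta> + of_int e)
      = 4 * (\<theta> * \<theta>) + 4 * of_int e * \<theta> + of_int (e^2)"
    by (simp add: algebra_simps power2_eq_square)
  then show ?thesis by (simp add: theta_square algebra_simps)
qed

text \<open>Divisibility by \<open>p\<^sup>m\<close> at both primes above \<open>p\<close>, that is of an element and of its conjugate
  at the chosen one, is divisibility by \<open>p\<^sup>m\<close>: the second coordinate times the discriminant is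
  a multiple of the difference of conjugates.\<close>

lemma divisible_by_power:
  assumes v: "v \<in> quad_order" and d: "v / of_nat p ^ m \<in> Z" "cnj v / of_nat p ^ m \<in> Z"
  shows "v / of_nat p ^ m \<in> quad_order"
proof -
  obtain x y where xy: "v = of_int x + of_int y * \<theta>" using v by (auto simp: quad_order_def)
  have "v - cnj v = of_int y * (2 * \<theta> + of_int e)"
    unfolding xy cnj_coords by (simp add: algebra_simps)
  then have "of_int (y * (e^2 - 4 * c)) / of_nat p ^ m
      = (v / of_nat p ^ m - cnj v / of_nat p ^ m) * (2 * \<theta> + of_int e)"
    unfolding of_int_mult theta_discriminant[symmetric] by (simp add: diff_divide_distrib[symmetric])
  also have "\<dots> \<in> Z"
    using Z_add[OF Z_mult[OF Z_of_int[of 2] Z_theta] Z_of_int] by (intro Z_mult Z_diff d) simp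
  finally have "int p ^ m dvd y * (e^2 - 4 * c)" by (rule Z_int_div_power)
  moreover have "coprime (int p ^ m) (e^2 - 4 * c)"
    using prime_imp_coprime[OF prime_int_p unramified] by simp
  ultimately have "int p ^ m dvd y" by (simp add: coprime_dvd_mult_left_iff)
  then obtain y' where y': "y = int p ^ m * y'" by blast
  have "of_int x / of_nat p ^ m = v / of_nat p ^ m - of_int y' * \<theta>"
    by (simp add: xy y' field_simps)
  also have "\<dots> \<in> Z" by (intro Z_diff Z_mult Z_of_int Z_theta d)
  finally have "int p ^ m dvd x" by (rule Z_int_div_power)
  then obtain x' where x': "x = int p ^ m * x'" by blast
  have "v / of_nat p ^ m = of_int x' + of_int y' * \<theta>"
    by (simp add: xy x' y' field_simps)
  then show ?thesis by (simp only: quad_order_coords)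
qed

text \<open>With \<open>\<pp>\<close> the prime ideal above \<open>p\<close> singled out by \<open>Z\<close>, this is \<open>\<pp>\<^sup>2\<^sup>k\<close>.\<close>

definition ideal_power :: "nat \<Rightarrow> complex set" where
  "ideal_power k = {w \<in> quad_order. w / of_nat p ^ (2 * k) \<in> Z}"

lemma ideal_power_order: "w \<in> ideal_power k \<Longrightarrow> w \<in> quad_order"
  by (simp add: ideal_power_def)

lemma ideal_power_div: "w \<in> ideal_power k \<Longrightarrow> w / of_nat p ^ (2 * k) \<in> Z"
  by (simp add: ideal_power_def)

lemma ideal_power_0: "ideal_power 0 = quad_order"
  using quad_order_Z by (auto simp: ideal_power_def)

lemma ideal_power_p: "of_nat p ^ (2 * k) \<in> ideal_power k"
  using quad_order_power[OF quad_order_of_int[of "int p"]] Z_1 by (simp add: ideal_power_def)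

text \<open>The powers of \<open>\<pp>\<close> are prime to its conjugate: the element \<open>\<theta> - h\<close> with an integer \<open>h\<close>
  congruent to \<open>\<theta>\<close> lies in \<open>\<pp>\<^sup>2\<^sup>k\<close>, and if \<open>p\<close> divided its conjugate as well, it would divide the
  difference of the two, a square root of the discriminant.\<close>

lemma ideal_power_conjugate_unit:
  obtains g where "g \<in> ideal_power k" "1 / cnj g \<in> Z" "g \<noteq> 0"
proof (cases k)
  case 0
  then show ?thesis using that[of 1] Z_1 quad_order_of_int[of 1] by (simp add: ideal_power_0)
next
  case (Suc l)
  obtain h :: int where h: "(\<theta> - of_int h) / of_nat p ^ (2 * k) \<in> Z"
    using Z_residue_power[OF Z_theta] by blast
  define g where "g = \<theta> - of_int h"
  have go: "g \<in> quad_order" unfolding g_def by (intro quad_order_diff quad_order_theta quad_order_of_int)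
  have g: "g \<in> ideal_power k" using h go by (simp add: ideal_power_def g_def)
  have gp: "g / of_nat p ^ 1 \<in> Z"
    by (rule Z_div_power_le[OF ideal_power_div[OF g]]) (simp add: Suc)
  have "cnj g / of_nat p \<notin> Z"
  proof
    assume "cnj g / of_nat p \<in> Z"
    then have "(g / of_nat p - cnj g / of_nat p) * (2 * \<theta> + of_int e) \<in> Z"
      using Z_add[OF Z_mult[OF Z_of_int[of 2] Z_theta] Z_of_int] gp by (intro Z_mult Z_diff) simp_all
    moreover have "g - cnj g = 2 * \<theta> + of_int e" by (simp add: g_def cnj_theta)
    then have "(g / of_nat p - cnj g / of_nat p) * (2 * \<theta> + of_int e) = of_int (e^2 - 4 * c) / of_nat p"
      unfolding theta_discriminant[symmetric] by (simp add: diff_divide_distrib[symmetric])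
    ultimately have "of_int (e^2 - 4 * c) / of_nat p \<in> Z" by (simp only:)
    then have "int p dvd e^2 - 4 * c" by (rule Z_int_div_p)
    then show False using unramified by simp
  qed
  then have "1 / cnj g \<in> Z" by (rule Z_unit[OF quad_order_cnj[OF go]])
  moreover have "Im g > 0" using Im_theta by (simp add: g_def)
  then have "g \<noteq> 0" by (intro notI) simp
  ultimately show ?thesis using g by (intro that)
qed

text \<open>An element of \<open>\<pp>\<^sup>2\<^sup>k\<close> with the norm of the ideal generates it, for in
  \<open>u / w = u \<cdot> cnj w / p\<^sup>2\<^sup>k\<close> the numerator is divisible by \<open>p\<^sup>2\<^sup>k\<close> at \<open>\<pp>\<close> because of \<open>u\<close>, and at
  the conjugate of \<open>\<pp>\<close> because of the conjugate of \<open>w\<close>.\<close>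

lemma generator_of_norm:
  assumes w: "w \<in> ideal_power k" "w * cnj w = of_nat p ^ (2 * k)" and u: "u \<in> ideal_power k"
  shows "u / w \<in> quad_order"
proof -
  have w0: "w \<noteq> 0" using w(2) by auto
  have eq: "u / w = u * cnj w / of_nat p ^ (2 * k)"
    using w0 by (simp add: w(2)[symmetric])
  have o: "u * cnj w \<in> quad_order" using w u by (intro quad_order_mult quad_order_cnj ideal_power_order)
  have "u / of_nat p ^ (2 * k) * cnj w \<in> Z"
    using w u by (intro Z_mult ideal_power_div quad_order_Z quad_order_cnj ideal_power_order)
  moreover have "cnj u * (w / of_nat p ^ (2 * k)) \<in> Z"
    using w u by (intro Z_mult ideal_power_div quad_order_Z quad_order_cnj ideal_power_order)
  ultimately show ?thesis
    unfolding eq by (intro divisible_by_power o) simp_all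
qed

end


section \<open>Two-by-two matrices\<close>

lemma mat2_mult:
  "mat2 a b c d ** mat2 a' b' c' d' = mat2 (a * a' + b * c') (a * b' + b * d') (c * a' + d * c') (c * b' + d * d')"
  by (simp add: mat2_def vec_eq_iff forall_2 matrix_matrix_mult_def sum_2 vector_2)

lemma mat2_nth: "mat2 a b c d $ 1 $ 1 = a" "mat2 a b c d $ 1 $ 2 = b"
  "mat2 a b c d $ 2 $ 1 = c" "mat2 a b c d $ 2 $ 2 = d"
  by (simp_all add: mat2_def vector_2)

lemma mat_1_eq_mat2: "(mat 1 :: rat^2^2) = mat2 1 0 0 1"
  by (simp add: mat2_def vec_eq_iff forall_2 mat_def vector_2)

lemma matrix_inv_eqI:
  fixes A B :: "rat^2^2"
  assumes "A ** B = mat 1" "B ** A = mat 1"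
  shows "matrix_inv A = B"
proof -
  have inv: "A ** matrix_inv A = mat 1 \<and> matrix_inv A ** A = mat 1"
    unfolding matrix_inv_def by (rule someI[of _ B]) (use assms in simp)
  have "matrix_inv A = (B ** A) ** matrix_inv A" by (simp add: assms)
  also have "\<dots> = B ** (A ** matrix_inv A)" by (simp only: matrix_mul_assoc)
  also have "\<dots> = B" by (simp add: inv)
  finally show ?thesis .
qed

lemma matrix_inv_inverse:
  fixes A :: "rat^2^2"
  assumes "invertible A"
  shows "A ** matrix_inv A = mat 1" "matrix_inv A ** A = mat 1"
proof -
  obtain B where "A ** B = mat 1 \<and> B ** A = mat 1"
    using assms by (auto simp: invertible_def)
  then have "A ** matrix_inv A = mat 1 \<and> matrix_inv A ** A = mat 1"
    unfolding matrix_inv_def by (rule someI)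
  then show "A ** matrix_inv A = mat 1" "matrix_inv A ** A = mat 1" by auto
qed

lemma matrix_inv_mult_inv:
  fixes A C :: "rat^2^2"
  assumes "invertible A" "invertible C"
  shows "invertible (A ** matrix_inv C)" "matrix_inv (A ** matrix_inv C) = C ** matrix_inv A"
proof -
  note A = matrix_inv_inverse[OF assms(1)] and C = matrix_inv_inverse[OF assms(2)]
  have "(A ** matrix_inv C) ** (C ** matrix_inv A) = A ** (matrix_inv C ** C) ** matrix_inv A"
    by (simp only: matrix_mul_assoc)
  then have 1: "(A ** matrix_inv C) ** (C ** matrix_inv A) = mat 1" by (simp add: A C)
  have "(C ** matrix_inv A) ** (A ** matrix_inv C) = C ** (matrix_inv A ** A) ** matrix_inv C"
    by (simp only: matrix_mul_assoc)
  then have 2: "(C ** matrix_inv A) ** (A ** matrix_inv C) = mat 1" by (simp add: A C)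
  show "invertible (A ** matrix_inv C)"
    unfolding invertible_def using 1 2 by blast
  show "matrix_inv (A ** matrix_inv C) = C ** matrix_inv A"
    by (rule matrix_inv_eqI[OF 1 2])
qed

lemma invertible_mat2:
  assumes "a * d - b * c = 1"
  shows "invertible (mat2 a b c d)"
proof -
  have ad: "a * d = 1 + b * c" using assms by simp
  have "mat2 a b c d ** mat2 d (- b) (- c) a = mat 1" "mat2 d (- b) (- c) a ** mat2 a b c d = mat 1"
    unfolding mat2_mult mat_1_eq_mat2 using ad by (simp_all add: mult.commute)
  then show ?thesis unfolding invertible_def by blast
qed


section \<open>The fundamental domain and the reduction at infinity\<close>

lemma cmod_ge_1_iff: "cmod z \<ge> 1 \<longleftrightarrow> (Re z)^2 + (Im z)^2 \<ge> 1"
  by (simp add: cmod_def)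

lemma fund_domainD:
  assumes "z \<in> fund_domain"
  shows "Im z > 0" "(Re z)^2 + (Im z)^2 \<ge> 1" "- 1/2 \<le> Re z" "Re z < 1/2"
proof -
  have *: "Im z > 0 \<and> (Re z)^2 + (Im z)^2 \<ge> 1 \<and> - 1/2 \<le> Re z \<and> Re z < 1/2"
  proof (cases "Im z > 0 \<and> cmod z > 1 \<and> - 1/2 \<le> Re z \<and> Re z < 1/2")
    case True
    then have "cmod z \<ge> 1" by simp
    with True show ?thesis by (simp add: cmod_ge_1_iff)
  next
    case False
    then obtain \<alpha> where a: "z = exp (\<i> * complex_of_real \<alpha>)" "pi / 2 \<le> \<alpha>" "\<alpha> \<le> 2 * pi / 3"
      using assms by (auto simp: fund_domain_def)
    have ReIm: "Re z = cos \<alpha>" "Im z = sin \<alpha>" using a(1) by (simp_all add: Re_exp Im_exp)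
    have ab: "0 < \<alpha>" "\<alpha> < pi" using a(2,3) pi_gt_zero by linarith+
    have "sin \<alpha> > 0" using ab by (rule sin_gt_zero)
    moreover have "cos \<alpha> \<le> cos (pi / 2)" using a ab by (intro cos_monotone_0_pi_le) simp_all
    moreover have "cos (2 * pi / 3) \<le> cos \<alpha>" using a ab by (intro cos_monotone_0_pi_le) simp_all
    ultimately show ?thesis using ReIm by (simp add: cos_120)
  qed
  then show "Im z > 0" "(Re z)^2 + (Im z)^2 \<ge> 1" "- 1/2 \<le> Re z" "Re z < 1/2" by auto
qed

lemma fund_domain_outerI:
  assumes "Im z > 0" "(Re z)^2 + (Im z)^2 > 1" "- 1/2 \<le> Re z" "Re z < 1/2"
  shows "z \<in> fund_domain"
proof -
  have "cmod z > 1" using assms(2) by (simp add: cmod_def)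
  with assms show ?thesis by (simp add: fund_domain_def)
qed

lemma fund_domain_arcI:
  assumes "Im z > 0" "(Re z)^2 + (Im z)^2 = 1" "- 1/2 \<le> Re z" "Re z \<le> 0"
  shows "z \<in> fund_domain"
proof -
  define \<alpha> where "\<alpha> = arccos (Re z)"
  have r: "- 1 \<le> Re z" "Re z \<le> 1" using assms by auto
  have c: "cos \<alpha> = Re z" unfolding \<alpha>_def using r by simp
  have s: "sin \<alpha> = Im z"
  proof -
    have "sin \<alpha> = sqrt (1 - (Re z)^2)" unfolding \<alpha>_def using r by (rule sin_arccos)
    also have "1 - (Re z)^2 = (Im z)^2" using assms(2) by simp
    finally show ?thesis using assms(1) by simp
  qed
  have "arccos 0 \<le> \<alpha>" unfolding \<alpha>_def using assms r by (intro arccos_le_arccos) auto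
  moreover have "\<alpha> \<le> arccos (- 1/2)" unfolding \<alpha>_def using assms r by (intro arccos_le_arccos) auto
  moreover have "arccos (- 1/2) = 2 * pi / 3"
    using arccos_cos[of "2 * pi / 3"] pi_gt_zero by (simp add: cos_120)
  ultimately have "pi / 2 \<le> \<alpha>" "\<alpha> \<le> 2 * pi / 3" by simp_all
  moreover have "z = exp (\<i> * complex_of_real \<alpha>)"
    by (simp add: complex_eq_iff Re_exp Im_exp c s)
  ultimately show ?thesis unfolding fund_domain_def by blast
qed

lemma inf_b_bounds: "- 1/2 \<le> Re (z - of_int (inf_b z))" "Re (z - of_int (inf_b z)) < 1/2"
proof -
  define b where "b = \<lfloor>Re z + 1/2\<rfloor>"
  have *: "- 1/2 \<le> Re (z - of_int b)" "Re (z - of_int b) < 1/2"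
    unfolding b_def using floor_correct[of "Re z + 1/2"] by (simp_all add: algebra_simps)
  have "inf_b z = b" by (rule inf_b_eqI[OF *])
  with * show "- 1/2 \<le> Re (z - of_int (inf_b z))" "Re (z - of_int (inf_b z)) < 1/2" by simp_all
qed

lemma Re_Im_inversion:
  "Re (- 1 / w) = - Re w / ((Re w)^2 + (Im w)^2)" "Im (- 1 / w) = Im w / ((Re w)^2 + (Im w)^2)"
  by (simp_all add: Re_divide Im_divide)

text \<open>Once the translated point is not inside the unit disc, the next inversion or the one after
  it lands in the fundamental domain; only the primitive cube root of unity has to be excluded,
  whose inversion is the fixed point \<open>\<rho>\<close> of the reduction step.\<close>

lemma inf_step_reaches_domain:
  assumes im: "Im z > 0" and w: "w = z - of_int (inf_b z)" and out: "(Re w)^2 + (Im w)^2 \<ge> 1"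
    and not_omega: "w \<noteq> Complex (- 1/2) (sqrt 3 / 2)"
  shows "\<exists>j. (inf_step ^^ j) z \<in> fund_domain"
proof -
  have Re: "- 1/2 \<le> Re w" "Re w < 1/2" and Im: "Im w > 0"
    using inf_b_bounds[of z] im by (simp_all add: w)
  have w0: "w \<noteq> 0" using Im by auto
  define n where "n = (Re w)^2 + (Im w)^2"
  have n: "n \<ge> 1" using out by (simp add: n_def)
  have s1: "inf_step z = - 1 / w" by (simp add: inf_step_def w)
  have ReIm: "Re (- 1 / w) = - Re w / n" "Im (- 1 / w) = Im w / n"
    unfolding n_def by (rule Re_Im_inversion)+
  have return_step: "inf_step (- 1 / w) = w" if "- 1/2 \<le> - Re w / n" "- Re w / n < 1/2"
  proof -
    have "inf_b (- 1 / w) = 0" by (rule inf_b_eqI) (use that ReIm in simp_all)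
    then show ?thesis using w0 by (simp add: inf_step_def)
  qed
  \<comment> \<open>The inversion of a point on the left edge has real part \<open>1/2\<close> only from the corner.\<close>
  have edge: "Re w > - 1/2 \<or> n > 1"
  proof (rule ccontr)
    assume "\<not> (Re w > - 1/2 \<or> n > 1)"
    then have r: "Re w = - 1/2" "n = 1" using Re n by auto
    then have "(Im w)^2 = 3 / 4" by (simp add: n_def power2_eq_square)
    then have "Im w = sqrt (3 / 4)" using Im by (metis abs_of_pos real_sqrt_abs)
    then have "Im w = sqrt 3 / 2" by (simp add: real_sqrt_divide)
    with r show False using not_omega by (simp add: complex_eq_iff)
  qed
  have lower: "- 1/2 \<le> - Re w / n"
  proof -
    have "Re w * 2 \<le> n" using Re n by simp
    then show ?thesis using n by (simp add: field_simps)
  qed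
  have upper: "- Re w / n < 1/2"
  proof -
    have "- Re w * 2 < n" using Re n edge by auto
    then show ?thesis using n by (simp add: field_simps)
  qed
  have two: "(inf_step ^^ 2) z = w"
    using s1 return_step[OF lower upper] by (simp add: numeral_2_eq_2)
  show ?thesis
  proof (cases "n > 1 \<or> Re w \<le> 0")
    case True
    then have "w \<in> fund_domain"
      using fund_domain_outerI[of w] fund_domain_arcI[of w] Re Im n by (fastforce simp: n_def)
    then show ?thesis using two by (intro exI[of _ 2]) simp
  next
    case False
    then have n1: "n = 1" and pos: "Re w > 0" using n by auto
    have "- 1 / w \<in> fund_domain"
      by (rule fund_domain_arcI) (use n1 pos Re Im ReIm in \<open>simp_all add: n_def\<close>)
    then show ?thesis using s1 by (intro exI[of _ 1]) simp
  qed
qed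

text \<open>In the lattice \<open>\<int> + \<int> x\<close> the squared length of \<open>m x + n\<close> is
  \<open>m\<^sup>2 |x|\<^sup>2 + 2 m n Re x + n\<^sup>2 \<ge> m\<^sup>2 - |m n| + n\<^sup>2\<close>, a positive integer.\<close>

lemma fund_domain_shortest_vector:
  fixes m n :: int
  assumes "x \<in> fund_domain" "m \<noteq> 0 \<or> n \<noteq> 0"
  shows "cmod (of_int m * x + of_int n) \<ge> 1"
proof -
  define R where "R = Re x"
  define S where "S = (Re x)^2 + (Im x)^2"
  have R: "\<bar>R\<bar> \<le> 1/2" and S: "S \<ge> 1" using fund_domainD[OF assms(1)] by (auto simp: R_def S_def)
  have "real_of_int (m^2 + n^2 - \<bar>m * n\<bar>) \<ge> 1"
  proof -
    have "m^2 + n^2 - \<bar>m * n\<bar> > 0"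
    proof -
      have "2 * (m^2 + n^2 - \<bar>m * n\<bar>) = m^2 + n^2 + (\<bar>m\<bar> - \<bar>n\<bar>)^2"
        by (simp add: power2_eq_square algebra_simps abs_mult)
      moreover have "m^2 + n^2 > 0" using assms(2) by (simp add: sum_power2_gt_zero_iff)
      ultimately have "2 * (m^2 + n^2 - \<bar>m * n\<bar>) > 0"
        using zero_le_power2[of "\<bar>m\<bar> - \<bar>n\<bar>"] by (simp only:)
      then show ?thesis by simp
    qed
    then show ?thesis by linarith
  qed
  moreover have "(Re (of_int m * x + of_int n))^2 + (Im (of_int m * x + of_int n))^2
      = (of_int m)^2 * S + 2 * R * of_int (m * n) + (of_int n)^2"
    by (simp add: R_def S_def power2_eq_square algebra_simps)
  moreover have "(of_int m)^2 * S \<ge> (of_int m)^2 * 1" by (intro mult_left_mono S) simp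
  moreover have "2 * R * of_int (m * n) \<ge> - \<bar>of_int (m * n)\<bar>"
  proof -
    have "\<bar>2 * R * of_int (m * n)\<bar> = (2 * \<bar>R\<bar>) * \<bar>of_int (m * n)\<bar>" by (simp add: abs_mult)
    also have "\<dots> \<le> 1 * \<bar>of_int (m * n)\<bar>" using R by (intro mult_right_mono) auto
    finally show ?thesis by simp
  qed
  ultimately show ?thesis unfolding cmod_ge_1_iff by simp
qed


section \<open>The expansion computes bases of the powers of the prime ideal\<close>

context split_order
begin

definition row_value :: "int \<Rightarrow> int \<Rightarrow> complex" where
  "row_value s t = of_int s * \<theta> + of_int t"

definition scaled_mat :: "nat \<Rightarrow> int \<Rightarrow> int \<Rightarrow> int \<Rightarrow> int \<Rightarrow> rat^2^2" where
  "scaled_mat k q r s t = mat2 (of_int q / of_nat p ^ k) (of_int r / of_nat p ^ k)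
     (of_int s / of_nat p ^ k) (of_int t / of_nat p ^ k)"

text \<open>The invariant of the expansion: after \<open>k\<close> rounds, \<open>p\<^sup>k\<close> times the accumulated matrix is
  integral, its rows are the coordinates of a basis of \<open>\<pp>\<^sup>2\<^sup>k\<close>, and the current point is the
  quotient of the basis vectors.\<close>

definition basis_coords :: "nat \<Rightarrow> rat^2^2 \<Rightarrow> complex \<Rightarrow> int \<Rightarrow> int \<Rightarrow> int \<Rightarrow> int \<Rightarrow> bool" where
  "basis_coords k M x q r s t \<longleftrightarrow> M = scaled_mat k q r s t \<and> q * t - r * s = int p ^ (2 * k) \<and>
     x * row_value s t = row_value q r \<and>
     (\<forall>w. w \<in> ideal_power k \<longleftrightarrow> (\<exists>m n. w = of_int m * row_value q r + of_int n * row_value s t))"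

definition basis_at :: "nat \<Rightarrow> rat^2^2 \<Rightarrow> complex \<Rightarrow> bool" where
  "basis_at k M x \<longleftrightarrow> (\<exists>q r s t. basis_coords k M x q r s t)"

lemma row_value_order: "row_value s t \<in> quad_order"
  unfolding row_value_def using quad_order_coords[of t s] by (simp add: add.commute)

lemma row_value_0_iff: "row_value s t = 0 \<longleftrightarrow> s = 0 \<and> t = 0"
  unfolding row_value_def using coords_eq_iff[of t s 0 0] by (auto simp: add.commute)

lemma basis_coords_facts:
  assumes b: "basis_coords k M x q r s t"
  shows "row_value q r \<in> ideal_power k" "row_value s t \<in> ideal_power k" "row_value s t \<noteq> 0"
    "row_value q r = x * row_value s t" "x = row_value q r / row_value s t"
    "Im (row_value q r * cnj (row_value s t)) = real p ^ (2 * k) * Im \<theta>"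
    "Im x * (cmod (row_value s t))^2 = real p ^ (2 * k) * Im \<theta>"
    "Im x > 0"
proof -
  note B = b[unfolded basis_coords_def]
  have "row_value q r = of_int 1 * row_value q r + of_int 0 * row_value s t"
    "row_value s t = of_int 0 * row_value q r + of_int 1 * row_value s t" by simp_all
  with B show I: "row_value q r \<in> ideal_power k" "row_value s t \<in> ideal_power k" by blast+
  show nz: "row_value s t \<noteq> 0"
  proof
    assume "row_value s t = 0"
    then have "int p ^ (2 * k) = 0" using B by (simp add: row_value_0_iff)
    then show False by simp
  qed
  show eq: "row_value q r = x * row_value s t" using B by simp
  then show x: "x = row_value q r / row_value s t" using nz by simp
  have "Im (row_value q r * cnj (row_value s t)) = of_int (q * t - r * s) * Im \<theta>"
    by (simp add: row_value_def algebra_simps)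
  then show im: "Im (row_value q r * cnj (row_value s t)) = real p ^ (2 * k) * Im \<theta>"
    using B by simp
  have "row_value q r * cnj (row_value s t) = x * of_real ((cmod (row_value s t))^2)"
    unfolding eq complex_norm_square by (simp only: mult.assoc)
  from arg_cong[OF this, of Im] show Imx: "Im x * (cmod (row_value s t))^2 = real p ^ (2 * k) * Im \<theta>"
    using im by simp
  have "0 < Im x * (cmod (row_value s t))^2"
    unfolding Imx using Im_theta by simp
  then show "Im x > 0" by (simp add: zero_less_mult_iff)
qed

lemma basis_at_0: "basis_at 0 (mat 1) \<theta>"
proof -
  have "basis_coords 0 (mat 1) \<theta> 1 0 0 1"
    unfolding basis_coords_def
  proof (intro conjI allI)
    show "mat 1 = scaled_mat 0 1 0 0 1" by (simp add: scaled_mat_def mat_1_eq_mat2)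
    fix w
    show "w \<in> ideal_power 0 \<longleftrightarrow> (\<exists>m n. w = of_int m * row_value 1 0 + of_int n * row_value 0 1)"
      unfolding ideal_power_0 quad_order_def row_value_def by (auto simp: add.commute)
  qed (simp_all add: row_value_def)
  then show ?thesis unfolding basis_at_def by blast
qed

text \<open>A step of the reduction at infinity changes the basis by a matrix of determinant \<open>1\<close>; the
  inversion of the initialization step is the case \<open>b = 0\<close>.\<close>

lemma basis_at_inf_step:
  assumes "basis_at k M x"
  shows "basis_at k (mat2 0 (- 1) 1 (- of_int b) ** M) (- 1 / (x - of_int b))"
proof -
  obtain q r s t where b: "basis_coords k M x q r s t" using assms by (auto simp: basis_at_def)
  have M: "M = scaled_mat k q r s t" and det: "q * t - r * s = int p ^ (2 * k)"
    and span: "w \<in> ideal_power k \<longleftrightarrow> (\<exists>m n. w = of_int m * row_value q r + of_int n * row_value s t)" for w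
    using b by (simp_all only: basis_coords_def)
  note F = basis_coords_facts[OF b]
  define \<alpha> \<beta> where "\<alpha> = row_value q r" and "\<beta> = row_value s t"
  have ab: "row_value (- s) (- t) = - \<beta>" "row_value (q - b * s) (r - b * t) = \<alpha> - of_int b * \<beta>"
    by (simp_all add: \<alpha>_def \<beta>_def row_value_def algebra_simps)
  have "Im (x - of_int b) > 0" using F(8) by simp
  then have xb: "x - of_int b \<noteq> 0" by (intro notI) simp
  have "basis_coords k (mat2 0 (- 1) 1 (- of_int b) ** M) (- 1 / (x - of_int b)) (- s) (- t) (q - b * s) (r - b * t)"
    unfolding basis_coords_def ab
  proof (intro conjI allI)
    show "mat2 0 (- 1) 1 (- of_int b) ** M = scaled_mat k (- s) (- t) (q - b * s) (r - b * t)"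
      unfolding M by (simp add: scaled_mat_def mat2_mult diff_divide_distrib)
    have "- s * (r - b * t) - - t * (q - b * s) = q * t - r * s" by (simp add: algebra_simps)
    then show "- s * (r - b * t) - - t * (q - b * s) = int p ^ (2 * k)" by (simp only: det)
    have "\<alpha> - of_int b * \<beta> = (x - of_int b) * \<beta>"
      using F(4) by (simp add: \<alpha>_def \<beta>_def left_diff_distrib)
    then show "- 1 / (x - of_int b) * (\<alpha> - of_int b * \<beta>) = - \<beta>" using xb by simp
    fix w
    have "w \<in> ideal_power k \<longleftrightarrow> (\<exists>m n. w = of_int m * \<alpha> + of_int n * \<beta>)"
      unfolding \<alpha>_def \<beta>_def by (rule span)
    also have "\<dots> \<longleftrightarrow> (\<exists>m n. w = of_int m * - \<beta> + of_int n * (\<alpha> - of_int b * \<beta>))"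
    proof (safe, goal_cases)
      case (1 m n)
      show ?case
        by (rule exI[of _ "- n - b * m"], rule exI[of _ m]) (simp add: algebra_simps)
    next
      case (2 m n)
      show ?case
        by (rule exI[of _ n], rule exI[of _ "- m - b * n"]) (simp add: algebra_simps)
    qed
    finally show "w \<in> ideal_power k \<longleftrightarrow> (\<exists>m n. w = of_int m * - \<beta> + of_int n * (\<alpha> - of_int b * \<beta>))" .
  qed
  then show ?thesis unfolding basis_at_def by blast
qed

lemma basis_at_ratio:
  assumes "basis_at k M x"
  obtains u v where "u \<in> quad_order" "v \<in> quad_order" "v \<noteq> 0" "x = u / v"
proof -
  obtain q r s t where b: "basis_coords k M x q r s t" using assms by (auto simp: basis_at_def)
  from that[OF row_value_order row_value_order basis_coords_facts(3,5)[OF b]] show ?thesis .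
qed

lemma basis_at_Im_pos: "basis_at k M x \<Longrightarrow> Im x > 0"
  unfolding basis_at_def using basis_coords_facts(8) by blast

lemma basis_at_init:
  assumes "basis_at k M x"
  shows "basis_at k (cf_D Z x ** M) (cf_z Z x)" "cf_z Z x \<in> Z"
proof -
  show "basis_at k (cf_D Z x ** M) (cf_z Z x)"
    using assms basis_at_inf_step[OF assms, of 0] by (simp add: cf_D_def cf_z_def)
  obtain u v where uv: "u \<in> quad_order" "v \<in> quad_order" "v \<noteq> 0" "x = u / v"
    using basis_at_ratio[OF assms] .
  show "cf_z Z x \<in> Z"
  proof (cases "x \<in> Z")
    case False
    then have "v / u \<in> Z" using Z_valuation[OF uv(1,2)] uv(4) by simp
    then have "- (v / u) \<in> Z" by (rule Z_uminus)
    then show ?thesis using False uv(4) by (simp add: cf_z_def)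
  qed (simp add: cf_z_def)
qed

lemma cf_a_residue:
  assumes z: "cf_z Z x \<in> Z"
  shows "(cf_z Z x - of_nat (cf_a p Z x)) / of_nat p ^ 2 \<in> Z"
proof -
  let ?P = "\<lambda>a. a < p^2 \<and> (cf_z Z x - of_nat a) / of_nat p ^ 2 \<in> Z"
  obtain a0 :: int where a0: "(cf_z Z x - of_int a0) / of_nat p ^ 2 \<in> Z"
    using Z_residue_power[OF z] by blast
  define a where "a = nat (a0 mod (int p ^ 2))"
  have pos: "int p ^ 2 > 0" by simp
  have ai: "int a = a0 mod (int p ^ 2)" using pos by (simp add: a_def)
  then have "int a < int (p ^ 2)" using pos by simp
  then have lt: "a < p^2" by (simp only: of_nat_less_iff)
  define b where "b = a0 div int p ^ 2"
  have b: "a0 = int a + int p ^ 2 * b" unfolding ai b_def by (rule mod_mult_div_eq[symmetric])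
  have "(cf_z Z x - of_nat a) / of_nat p ^ 2 = (cf_z Z x - of_int a0) / of_nat p ^ 2 + of_int b"
    unfolding b by (simp add: diff_divide_distrib add_divide_distrib)
  also have "\<dots> \<in> Z" by (intro Z_add a0 Z_of_int)
  finally have Pa: "?P a" using lt by simp
  moreover have "a' = a" if a': "?P a'" for a'
  proof -
    have "(cf_z Z x - of_nat a) / of_nat p ^ 2 - (cf_z Z x - of_nat a') / of_nat p ^ 2 \<in> Z"
      using Pa a' by (intro Z_diff) simp_all
    also have "(cf_z Z x - of_nat a) / of_nat p ^ 2 - (cf_z Z x - of_nat a') / of_nat p ^ 2
        = of_int (int a' - int a) / of_nat p ^ 2"
      by (simp add: diff_divide_distrib)
    finally have "int p ^ 2 dvd int a' - int a" by (rule Z_int_div_power)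
    moreover have "\<bar>int a' - int a\<bar> < int (p ^ 2)"
    proof -
      have "int a < int (p ^ 2)" "int a' < int (p ^ 2)" using Pa a' by (simp_all only: of_nat_less_iff)
      then show ?thesis by linarith
    qed
    ultimately have "int a' - int a = 0"
      using dvd_imp_le_int[of "int a' - int a" "int p ^ 2"] by (cases "int a' - int a = 0") simp_all
    then show ?thesis by simp
  qed
  ultimately have "?P (cf_a p Z x)"
    unfolding cf_a_def by (rule theI[of ?P a])
  then show ?thesis by (rule conjunct2)
qed

text \<open>The p-adic reduction passes to the sublattice of index \<open>p\<^sup>2\<close> cut out by the congruence
  modulo \<open>\<pp>\<^sup>2\<close>. With basis \<open>\<alpha> = z \<beta>\<close>, \<open>\<beta>\<close> of \<open>\<pp>\<^sup>2\<^sup>k\<close> and \<open>z\<close> integral, \<open>\<beta> / p\<^sup>2\<^sup>k\<close> is a unit because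
  \<open>p\<^sup>2\<^sup>k\<close> lies in the ideal; hence \<open>m \<alpha> + n \<beta>\<close> lies in \<open>\<pp>\<^sup>2\<^sup>k\<^sup>+\<^sup>2\<close> exactly if \<open>m z + n\<close>
  is divisible by \<open>p\<^sup>2\<close>.\<close>

lemma basis_at_padic_step:
  assumes "basis_at k M z" and z: "z \<in> Z" and a: "(z - of_int a) / of_nat p ^ 2 \<in> Z"
  shows "basis_at (Suc k) (mat2 (1 / of_nat p) 0 0 (of_nat p) ** mat2 1 (- of_int a) 0 1 ** M)
    ((z - of_int a) / of_nat p ^ 2)"
proof -
  obtain q r s t where b: "basis_coords k M z q r s t" using assms(1) by (auto simp: basis_at_def)
  have M: "M = scaled_mat k q r s t" and det: "q * t - r * s = int p ^ (2 * k)"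
    and span': "w \<in> ideal_power k \<longleftrightarrow> (\<exists>m n. w = of_int m * row_value q r + of_int n * row_value s t)" for w
    using b by (simp_all only: basis_coords_def)
  note F = basis_coords_facts[OF b]
  define \<alpha> \<beta> where "\<alpha> = row_value q r" and "\<beta> = row_value s t"
  define P where "P = int p ^ 2"
  have ab: "row_value (q - a * s) (r - a * t) = \<alpha> - of_int a * \<beta>" "row_value (P * s) (P * t) = of_int P * \<beta>"
    by (simp_all add: \<alpha>_def \<beta>_def row_value_def algebra_simps)
  have \<alpha>: "\<alpha> = z * \<beta>" using F(4) by (simp add: \<alpha>_def \<beta>_def)
  have \<beta>0: "\<beta> \<noteq> 0" using F(3) by (simp add: \<beta>_def)
  have span: "w \<in> ideal_power k \<longleftrightarrow> (\<exists>m n. w = of_int m * \<alpha> + of_int n * \<beta>)" for w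
    unfolding \<alpha>_def \<beta>_def by (rule span')
  have "1 / (\<beta> / of_nat p ^ (2 * k)) \<in> Z"
  proof -
    obtain m n where mn: "of_nat p ^ (2 * k) = of_int m * \<alpha> + of_int n * \<beta>"
      using ideal_power_p span by blast
    have "1 / (\<beta> / of_nat p ^ (2 * k)) = of_int m * z + of_int n"
      using \<beta>0 by (simp add: mn \<alpha> add_divide_distrib)
    then show ?thesis using z by (simp add: Z_add Z_mult Z_of_int)
  qed
  note unit = this
  have mem: "w \<in> ideal_power (Suc k) \<longleftrightarrow> P dvd m * a + n"
    if w: "w = of_int m * \<alpha> + of_int n * \<beta>" for w m n
  proof -
    have wI: "w \<in> ideal_power k" using w span by blast
    have weq: "w / of_nat p ^ (2 * Suc k)
        = \<beta> / of_nat p ^ (2 * k) * ((of_int m * z + of_int n) / of_nat p ^ 2)"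
      by (simp add: w \<alpha> power_add power2_eq_square algebra_simps)
    have weq': "(of_int m * z + of_int n) / of_nat p ^ 2
        = 1 / (\<beta> / of_nat p ^ (2 * k)) * (w / of_nat p ^ (2 * Suc k))"
      unfolding weq using \<beta>0 by simp
    have red: "(of_int m * z + of_int n) / of_nat p ^ 2
        = of_int m * ((z - of_int a) / of_nat p ^ 2) + of_int (m * a + n) / of_nat p ^ 2"
      by (simp add: add_divide_distrib diff_divide_distrib right_diff_distrib)
    have red': "of_int (m * a + n) / of_nat p ^ 2
        = (of_int m * z + of_int n) / of_nat p ^ 2 - of_int m * ((z - of_int a) / of_nat p ^ 2)"
      unfolding red by simp
    show ?thesis
    proof
      assume "w \<in> ideal_power (Suc k)"
      then have "(of_int m * z + of_int n) / of_nat p ^ 2 \<in> Z"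
        unfolding weq' by (intro Z_mult unit ideal_power_div)
      then have "of_int (m * a + n) / of_nat p ^ 2 \<in> Z"
        unfolding red' by (intro Z_diff Z_mult Z_of_int a)
      then show "P dvd m * a + n" unfolding P_def by (rule Z_int_div_power)
    next
      assume "P dvd m * a + n"
      then obtain j where j: "m * a + n = P * j" by blast
      have "of_int (m * a + n) / of_nat p ^ 2 = (of_int j :: complex)"
        unfolding j by (simp add: P_def)
      then have "(of_int m * z + of_int n) / of_nat p ^ 2 \<in> Z"
        unfolding red by (simp only:) (intro Z_add Z_mult Z_of_int a)
      then have "w / of_nat p ^ (2 * Suc k) \<in> Z"
        unfolding weq using wI F(2) by (intro Z_mult ideal_power_div) (simp_all add: \<beta>_def)
      then show "w \<in> ideal_power (Suc k)"
        using ideal_power_order[OF wI] unfolding ideal_power_def by simp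
    qed
  qed
  have down: "w \<in> ideal_power k" if "w \<in> ideal_power (Suc k)" for w
    using that Z_div_power_le[OF ideal_power_div[OF that], of "2 * k"]
    by (simp add: ideal_power_def)
  have "basis_coords (Suc k) (mat2 (1 / of_nat p) 0 0 (of_nat p) ** mat2 1 (- of_int a) 0 1 ** M)
    ((z - of_int a) / of_nat p ^ 2) (q - a * s) (r - a * t) (P * s) (P * t)"
    unfolding basis_coords_def ab
  proof (intro conjI allI)
    show "mat2 (1 / of_nat p) 0 0 (of_nat p) ** mat2 1 (- of_int a) 0 1 ** M
        = scaled_mat (Suc k) (q - a * s) (r - a * t) (P * s) (P * t)"
      unfolding M by (simp add: scaled_mat_def mat2_mult P_def power2_eq_square diff_divide_distrib)
    show "(q - a * s) * (P * t) - (r - a * t) * (P * s) = int p ^ (2 * Suc k)"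
    proof -
      have "(q - a * s) * (P * t) - (r - a * t) * (P * s) = P * (q * t - r * s)"
        by (simp add: algebra_simps)
      then show ?thesis unfolding det by (simp add: P_def power_add power2_eq_square)
    qed
    show "(z - of_int a) / of_nat p ^ 2 * (of_int P * \<beta>) = \<alpha> - of_int a * \<beta>"
      by (simp add: P_def \<alpha> left_diff_distrib)
    fix w
    show "w \<in> ideal_power (Suc k) \<longleftrightarrow>
      (\<exists>m n. w = of_int m * (\<alpha> - of_int a * \<beta>) + of_int n * (of_int P * \<beta>))"
    proof
      assume w: "w \<in> ideal_power (Suc k)"
      then obtain m n where mn: "w = of_int m * \<alpha> + of_int n * \<beta>" using down span by blast
      then have "P dvd m * a + n" using mem w by blast
      then obtain j where "m * a + n = P * j" by blast
      then have n: "n = P * j - m * a" by simp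
      have "w = of_int m * (\<alpha> - of_int a * \<beta>) + of_int j * (of_int P * \<beta>)"
        unfolding mn n by (simp add: algebra_simps)
      then show "\<exists>m n. w = of_int m * (\<alpha> - of_int a * \<beta>) + of_int n * (of_int P * \<beta>)" by blast
    next
      assume "\<exists>m n. w = of_int m * (\<alpha> - of_int a * \<beta>) + of_int n * (of_int P * \<beta>)"
      then obtain m n where "w = of_int m * (\<alpha> - of_int a * \<beta>) + of_int n * (of_int P * \<beta>)" by blast
      then have "w = of_int m * \<alpha> + of_int (P * n - m * a) * \<beta>" by (simp add: algebra_simps)
      from mem[OF this] show "w \<in> ideal_power (Suc k)" by simp
    qed
  qed
  then show ?thesis unfolding basis_at_def by blast
qed

lemma basis_at_cf_zj:
  assumes "basis_at k M x"
  shows "basis_at (Suc k) (cf_Qj p Z x j ** (cf_P p Z x ** (cf_D Z x ** M))) (cf_zj p Z x j)"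
proof (induction j)
  case 0
  note I = basis_at_init[OF assms]
  have "(cf_z Z x - of_int (int (cf_a p Z x))) / of_nat p ^ 2 \<in> Z"
    using cf_a_residue[OF I(2)] by simp
  from basis_at_padic_step[OF I this]
  show ?case by (simp add: cf_zj_def cf_P_def)
next
  case (Suc j)
  from basis_at_inf_step[OF Suc, of "inf_b (cf_zj p Z x j)"]
  show ?case by (simp add: cf_zj_def inf_step_def matrix_mul_assoc)
qed

text \<open>Here \<open>A\<close> and \<open>B\<close> are two coefficients of the norm form \<open>N(m \<beta> - n \<alpha>) / p\<^sup>2\<^sup>k\<close> of the basis
  \<open>\<alpha>, \<beta>\<close>, up to the sign of \<open>B\<close>. They are integers, for norms and traces of products with
  conjugates of elements of \<open>\<pp>\<^sup>2\<^sup>k\<close> are divisible by \<open>p\<^sup>2\<^sup>k\<close>.\<close>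

lemma basis_at_norm_form:
  assumes "basis_at k M x"
  obtains A B :: int where "A > 0" "Re x = of_int B / (2 * of_int A)" "Im x = Im \<theta> / of_int A"
proof -
  obtain q r s t where b: "basis_coords k M x q r s t" using assms by (auto simp: basis_at_def)
  note F = basis_coords_facts[OF b]
  define \<alpha> \<beta> where "\<alpha> = row_value q r" and "\<beta> = row_value s t"
  have mem: "\<alpha> \<in> ideal_power k" "\<beta> \<in> ideal_power k" "\<alpha> \<in> quad_order" "\<beta> \<in> quad_order" "\<beta> \<noteq> 0"
    using F(1-3) by (simp_all add: \<alpha>_def \<beta>_def row_value_order)
  obtain n2 where n2: "\<beta> * cnj \<beta> = of_int n2" and n2_pos: "n2 > 0"
  proof (rule quad_order_norm[OF mem(4)])
    fix n assume "\<beta> * cnj \<beta> = of_int n" "\<beta> \<noteq> 0 \<Longrightarrow> n > 0"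
    then show thesis using mem(5) by (intro that[of n]) simp_all
  qed
  have "\<alpha> * cnj \<beta> \<in> quad_order" by (intro quad_order_mult quad_order_cnj mem)
  then obtain x0 y0 where xy: "\<alpha> * cnj \<beta> = of_int x0 + of_int y0 * \<theta>" by (auto simp: quad_order_def)
  define n1 where "n1 = 2 * x0 - e * y0"
  have n1: "\<alpha> * cnj \<beta> + cnj (\<alpha> * cnj \<beta>) = of_int n1"
    unfolding xy cnj_coords by (simp add: n1_def)
  have "of_int n2 / of_nat p ^ (2 * k) = \<beta> / of_nat p ^ (2 * k) * cnj \<beta>"
    unfolding n2[symmetric] by simp
  also have "\<dots> \<in> Z"
    by (rule Z_mult[OF ideal_power_div[OF mem(2)] quad_order_Z[OF quad_order_cnj[OF mem(4)]]])
  finally have "int p ^ (2 * k) dvd n2" by (rule Z_int_div_power)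
  then obtain A where A: "n2 = int p ^ (2 * k) * A" by blast
  have "of_int n1 / of_nat p ^ (2 * k) = \<alpha> / of_nat p ^ (2 * k) * cnj \<beta> + \<beta> / of_nat p ^ (2 * k) * cnj \<alpha>"
  proof -
    have "cnj (\<alpha> * cnj \<beta>) = \<beta> * cnj \<alpha>" by simp
    then have "of_int n1 = \<alpha> * cnj \<beta> + \<beta> * cnj \<alpha>" using n1 by (simp only:)
    then show ?thesis by (simp only: add_divide_distrib times_divide_eq_left)
  qed
  also have "\<dots> \<in> Z"
    by (rule Z_add[OF Z_mult[OF ideal_power_div[OF mem(1)] quad_order_Z[OF quad_order_cnj[OF mem(4)]]]
          Z_mult[OF ideal_power_div[OF mem(2)] quad_order_Z[OF quad_order_cnj[OF mem(3)]]]])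
  finally have "int p ^ (2 * k) dvd n1" by (rule Z_int_div_power)
  then obtain B where B: "n1 = int p ^ (2 * k) * B" by blast
  have pp: "real p ^ (2 * k) > 0" by simp
  have "0 < int p ^ (2 * k) * A" using n2_pos by (simp only: A)
  then have Apos: "A > 0" by (simp only: zero_less_mult_iff) simp
  have xn: "x * of_int n2 = \<alpha> * cnj \<beta>"
    unfolding n2[symmetric] using F(4) by (simp add: \<alpha>_def \<beta>_def)
  have "Im x * of_int n2 = real p ^ (2 * k) * Im \<theta>"
    using arg_cong[OF xn, of Im] F(6) by (simp add: \<alpha>_def \<beta>_def)
  then have "real p ^ (2 * k) * (Im x * of_int A) = real p ^ (2 * k) * Im \<theta>"
    unfolding A by simp
  then have "Im x * of_int A = Im \<theta>" using pp by (simp only: mult_cancel_left) simp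
  then have im: "Im x = Im \<theta> / of_int A" using Apos by (simp add: eq_divide_eq)
  have "Re (\<alpha> * cnj \<beta>) * 2 = of_int n1"
    using arg_cong[OF n1, of Re] by simp
  then have "Re x * of_int n2 * 2 = of_int n1"
    using arg_cong[OF xn, of Re] by simp
  then have "real p ^ (2 * k) * (Re x * of_int A * 2) = real p ^ (2 * k) * of_int B"
    unfolding A B by simp
  then have "Re x * of_int A * 2 = of_int B" using pp by (simp only: mult_cancel_left) simp
  then have "Re x = of_int B / (2 * of_int A)" using Apos by (simp add: eq_divide_eq mult_ac)
  from that[OF Apos this im] show ?thesis .
qed

text \<open>The imaginary part increases as long as the translated point lies inside the unit disc,
  and its values at bases of a given ideal are \<open>Im \<theta> / A\<close> with positive integers \<open>A\<close>.\<close>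

lemma inf_steps_terminate:
  assumes "basis_at k M z"
    and no_omega: "\<And>u v. u \<in> quad_order \<Longrightarrow> v \<in> quad_order \<Longrightarrow> v \<noteq> 0 \<Longrightarrow> u / v \<noteq> Complex (- 1/2) (sqrt 3 / 2)"
  shows "\<exists>j. (inf_step ^^ j) z \<in> fund_domain"
proof -
  have "\<exists>j. (inf_step ^^ j) z \<in> fund_domain"
    if "basis_at k M z" "Im z = Im \<theta> / of_nat n" "n > 0" for n M z
    using that
  proof (induction n arbitrary: M z rule: less_induct)
    case (less n)
    define w where "w = z - of_int (inf_b z)"
    have Im: "Im z > 0" by (rule basis_at_Im_pos[OF less.prems(1)])
    show ?case
    proof (cases "(Re w)^2 + (Im w)^2 \<ge> 1")
      case True
      have "w \<noteq> Complex (- 1/2) (sqrt 3 / 2)"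
      proof -
        obtain u v where uv: "u \<in> quad_order" "v \<in> quad_order" "v \<noteq> 0" "z = u / v"
          using basis_at_ratio[OF less.prems(1)] .
        have "w = (u - of_int (inf_b z) * v) / v" using uv by (simp add: w_def diff_divide_distrib)
        then show ?thesis
          using no_omega[of "u - of_int (inf_b z) * v" v] uv
          by (simp add: quad_order_diff quad_order_mult quad_order_of_int)
      qed
      then show ?thesis by (rule inf_step_reaches_domain[OF Im w_def True])
    next
      case False
      have Imw: "Im w = Im z" by (simp add: w_def)
      define N where "N = (Re w)^2 + (Im w)^2"
      have N: "0 < N" "N < 1" using False Im Imw by (auto simp: N_def sum_power2_gt_zero_iff)
      define z' where "z' = inf_step z"
      have z': "basis_at k (mat2 0 (- 1) 1 (- of_int (inf_b z)) ** M) z'"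
        using basis_at_inf_step[OF less.prems(1), of "inf_b z"] by (simp add: z'_def inf_step_def)
      obtain A B :: int where A: "A > 0" "Re z' = of_int B / (2 * of_int A)" "Im z' = Im \<theta> / of_int A"
        using basis_at_norm_form[OF z'] .
      have Az: "Im z' = Im \<theta> / of_nat (nat A)" "nat A > 0" using A by simp_all
      have "Im z' = Im z / N"
        unfolding z'_def inf_step_def w_def[symmetric] Re_Im_inversion N_def Imw ..
      then have "Im z' > Im z" using N Im by (simp add: less_divide_eq)
      then have "Im \<theta> / of_nat n < Im \<theta> / of_nat (nat A)"
        unfolding Az(1)[symmetric] less.prems(2)[symmetric] .
      then have "nat A < n" using Im_theta Az(2) less.prems(3)
        by (simp add: divide_less_cancel field_simps)
      from less.IH[OF this z' Az] obtain j where "(inf_step ^^ j) z' \<in> fund_domain" by blast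
      then have "(inf_step ^^ Suc j) z \<in> fund_domain"
        by (simp add: z'_def funpow_swap1)
      then show ?thesis by blast
    qed
  qed
  moreover obtain A B :: int where "A > 0" "Re z = of_int B / (2 * of_int A)" "Im z = Im \<theta> / of_int A"
    using basis_at_norm_form[OF assms(1)] .
  then have "Im z = Im \<theta> / of_nat (nat A)" "nat A > 0" by simp_all
  ultimately show ?thesis using assms(1) by blast
qed

lemma cf_round:
  assumes b: "basis_at k M x" and f: "\<exists>j. cf_zj p Z x j \<in> fund_domain"
  shows "basis_at (Suc k) ((cf_Q p Z x ** cf_P p Z x ** cf_D Z x) ** M) (cf_next p Z x)"
    "cf_next p Z x \<in> fund_domain"
  using basis_at_cf_zj[OF b, of "cf_len p Z x"] LeastI_ex[OF f]
  by (simp_all add: cf_Q_def cf_next_def cf_len_def matrix_mul_assoc)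

lemma invertible_round: "invertible (cf_Q p Z x ** cf_P p Z x ** cf_D Z x)"
proof -
  have D: "invertible (cf_D Z x)"
    by (simp add: cf_D_def mat_1_eq_mat2 invertible_mat2)
  have "(of_nat p :: rat) \<noteq> 0" by simp
  then have P: "invertible (cf_P p Z x)"
    unfolding cf_P_def mat2_mult by (intro invertible_mat2) simp
  have "invertible (cf_Qj p Z x j)" for j
    by (induction j) (simp_all add: mat_1_eq_mat2 invertible_mat2 invertible_mult)
  then have Q: "invertible (cf_Q p Z x)" by (simp add: cf_Q_def)
  show ?thesis by (intro invertible_mult D P Q)
qed

end


section \<open>Periodicity\<close>

context split_order
begin

lemma cf_x_1: "cf_x p Z \<theta> (Suc 0) = \<theta>"
  by (simp add: cf_x_def)

lemma cf_x_Suc_Suc: "cf_x p Z \<theta> (Suc (Suc k)) = cf_next p Z (cf_x p Z \<theta> (Suc k))"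
  by (simp add: cf_x_def)

lemma cf_B_basis:
  assumes "\<And>i. i < k \<Longrightarrow> \<exists>j. cf_zj p Z (cf_x p Z \<theta> (Suc i)) j \<in> fund_domain"
  shows "basis_at k (matrix_inv (cf_B p Z \<theta> k)) (cf_x p Z \<theta> (Suc k)) \<and> invertible (cf_B p Z \<theta> k)"
  using assms
proof (induction k)
  case 0
  have "invertible (mat 1 :: rat^2^2)" unfolding invertible_def by (rule exI[of _ "mat 1"]) simp
  moreover have "matrix_inv (mat 1 :: rat^2^2) = mat 1" by (rule matrix_inv_eqI) simp_all
  ultimately show ?case
    using basis_at_0 by (simp_all add: cf_x_1)
next
  case (Suc k)
  define x where "x = cf_x p Z \<theta> (Suc k)"
  define R where "R = cf_Q p Z x ** cf_P p Z x ** cf_D Z x"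
  have IH: "basis_at k (matrix_inv (cf_B p Z \<theta> k)) x" "invertible (cf_B p Z \<theta> k)"
    using Suc unfolding x_def by simp_all
  have R: "invertible R" unfolding R_def by (rule invertible_round)
  have B: "cf_B p Z \<theta> (Suc k) = cf_B p Z \<theta> k ** matrix_inv R"
    by (simp add: cf_A_def x_def R_def Let_def)
  have "\<exists>j. cf_zj p Z x j \<in> fund_domain" using Suc.prems unfolding x_def by simp
  from cf_round(1)[OF IH(1) this, folded R_def]
  have "basis_at (Suc k) (matrix_inv (cf_B p Z \<theta> (Suc k))) (cf_x p Z \<theta> (Suc (Suc k)))"
    unfolding B matrix_inv_mult_inv(2)[OF IH(2) R] cf_x_Suc_Suc x_def[symmetric] .
  moreover have "invertible (cf_B p Z \<theta> (Suc k))"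
    unfolding B by (rule matrix_inv_mult_inv(1)[OF IH(2) R])
  ultimately show ?case by simp
qed

text \<open>By induction, the point of each round is the point of a basis, from which the next
  reduction at infinity terminates.\<close>

theorem cf_defined_if_no_omega:
  assumes "\<And>u v. u \<in> quad_order \<Longrightarrow> v \<in> quad_order \<Longrightarrow> v \<noteq> 0 \<Longrightarrow> u / v \<noteq> Complex (- 1/2) (sqrt 3 / 2)"
  shows "cf_defined p Z \<theta>"
proof -
  have "\<exists>j. cf_zj p Z (cf_x p Z \<theta> (Suc k)) j \<in> fund_domain" for k
  proof (induction k rule: less_induct)
    case (less k)
    from basis_at_cf_zj[OF conjunct1[OF cf_B_basis[OF less]], where j = 0] assms
    have "\<exists>j. (inf_step ^^ j) (cf_zj p Z (cf_x p Z \<theta> (Suc k)) 0) \<in> fund_domain"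
      by (rule inf_steps_terminate)
    then show ?case by (simp add: cf_zj_def)
  qed
  then show ?thesis
    unfolding cf_defined_def by (metis One_nat_def Suc_le_D)
qed

lemma cf_defined_round:
  assumes "cf_defined p Z \<theta>"
  shows "\<exists>j. cf_zj p Z (cf_x p Z \<theta> (Suc k)) j \<in> fund_domain"
  using assms unfolding cf_defined_def by simp

lemma cf_x_basis:
  assumes "cf_defined p Z \<theta>"
  shows "basis_at k (matrix_inv (cf_B p Z \<theta> k)) (cf_x p Z \<theta> (Suc k))"
  by (rule conjunct1[OF cf_B_basis]) (rule cf_defined_round[OF assms])

lemma cf_x_in_fund_domain:
  assumes "cf_defined p Z \<theta>"
  shows "cf_x p Z \<theta> (Suc (Suc k)) \<in> fund_domain"
  unfolding cf_x_Suc_Suc by (rule cf_round(2)[OF cf_x_basis[OF assms] cf_defined_round[OF assms]])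

lemma basis_coords_span:
  "basis_coords k M x q r s t \<Longrightarrow>
    w \<in> ideal_power k \<longleftrightarrow> (\<exists>m n. w = of_int m * row_value q r + of_int n * row_value s t)"
  by (simp only: basis_coords_def)

lemma order_norm_pos:
  assumes "u \<in> quad_order" "u \<noteq> 0"
  shows "cmod u \<ge> 1"
proof (rule quad_order_norm[OF assms(1)])
  fix n assume n: "u * cnj u = of_int n" "u \<noteq> 0 \<Longrightarrow> n > 0"
  have "(cmod u)^2 = of_int n"
    using arg_cong[OF n(1)[folded complex_norm_square], of Re] by simp
  moreover have "n \<ge> 1" using n(2) assms(2) by simp
  ultimately have "1^2 \<le> (cmod u)^2" by simp
  then show ?thesis by (rule power2_le_imp_le) simp
qed

text \<open>Let \<open>w\<close> generate the ideal \<open>\<pp>\<^sup>2\<^sup>k\<close>, and let \<open>\<delta> w\<close>, \<open>\<gamma> w\<close> be its basis with point \<open>x = \<delta> / \<gamma>\<close>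
  in the fundamental domain. Then \<open>1 = \<gamma> (m x + n)\<close> for integers \<open>m\<close>, \<open>n\<close>. Neither factor is
  shorter than \<open>1\<close>, so \<open>\<gamma>\<close> is a unit, \<open>x\<close> lies in the order, and \<open>x - \<theta>\<close> is an integer; it is
  \<open>0\<close> because both points lie in the same strip of width \<open>1\<close>.\<close>

lemma principal_imp_theta:
  assumes w: "w \<in> ideal_power k" "w * cnj w = of_nat p ^ (2 * k)"
    and "basis_at k M x" and x: "x \<in> fund_domain"
  shows "x = \<theta>"
proof -
  obtain q r s t where b: "basis_coords k M x q r s t" using assms(3) by (auto simp: basis_at_def)
  note F = basis_coords_facts[OF b]
  define \<alpha> \<beta> where "\<alpha> = row_value q r" and "\<beta> = row_value s t"
  have mem: "\<alpha> \<in> ideal_power k" "\<beta> \<in> ideal_power k" and \<beta>0: "\<beta> \<noteq> 0" and \<alpha>: "\<alpha> = x * \<beta>"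
    and Imx: "Im x * (cmod \<beta>)^2 = real p ^ (2 * k) * Im \<theta>"
    unfolding \<alpha>_def \<beta>_def using F(1-4,7) by blast+
  have w0: "w \<noteq> 0" using w(2) by auto
  define \<gamma> \<delta> where "\<gamma> = \<beta> / w" and "\<delta> = \<alpha> / w"
  have o: "\<gamma> \<in> quad_order" "\<delta> \<in> quad_order"
    unfolding \<gamma>_def \<delta>_def by (rule generator_of_norm[OF w mem(2)], rule generator_of_norm[OF w mem(1)])
  have \<gamma>0: "\<gamma> \<noteq> 0" using \<beta>0 w0 by (simp add: \<gamma>_def)
  have \<delta>: "\<delta> = x * \<gamma>" by (simp add: \<gamma>_def \<delta>_def \<alpha>)
  obtain m n where mn: "w = of_int m * \<alpha> + of_int n * \<beta>"
    using basis_coords_span[OF b] w(1) unfolding \<alpha>_def \<beta>_def by blast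
  have "\<gamma> * (of_int m * x + of_int n) = (of_int m * \<alpha> + of_int n * \<beta>) / w"
    unfolding \<alpha> \<gamma>_def by (simp add: distrib_left add_divide_distrib mult_ac)
  then have one: "\<gamma> * (of_int m * x + of_int n) = 1" using w0 by (simp flip: mn)
  have "m \<noteq> 0 \<or> n \<noteq> 0" using one by auto
  then have "cmod (of_int m * x + of_int n) \<ge> 1" by (rule fund_domain_shortest_vector[OF x])
  moreover have \<gamma>1: "cmod \<gamma> \<ge> 1" by (rule order_norm_pos[OF o(1) \<gamma>0])
  moreover have prod: "cmod \<gamma> * cmod (of_int m * x + of_int n) = 1"
    unfolding norm_mult[symmetric] one by simp
  ultimately have "cmod \<gamma> * 1 \<le> 1"
    using mult_left_mono[of 1 "cmod (of_int m * x + of_int n)" "cmod \<gamma>"] by simp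
  with \<gamma>1 have cm: "cmod \<gamma> = 1" by simp
  then have "\<gamma> * cnj \<gamma> = 1" by (simp flip: complex_norm_square)
  then have "x = \<delta> * cnj \<gamma>" by (simp add: \<delta> mult.assoc)
  then have "x \<in> quad_order" using o by (simp add: quad_order_mult quad_order_cnj)
  then obtain u v where uv: "x = of_int u + of_int v * \<theta>" by (auto simp: quad_order_def)
  have "\<beta> = \<gamma> * w" using w0 by (simp add: \<gamma>_def)
  then have "(cmod \<beta>)^2 = (cmod w)^2" using cm by (simp add: norm_mult)
  moreover have "(cmod w)^2 = real p ^ (2 * k)"
    using arg_cong[OF w(2)[folded complex_norm_square], of Re] by (simp flip: of_nat_power)
  ultimately have "Im x * real p ^ (2 * k) = Im \<theta> * real p ^ (2 * k)" using Imx by (simp add: mult.commute)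
  then have "Im x = Im \<theta>" by simp
  then have v: "v = 1" using Im_theta by (simp add: uv)
  have "Re x = of_int u - of_int e / 2" by (simp add: uv v Re_theta)
  then have "- 1/2 \<le> of_int u - real_of_int e / 2" "of_int u - real_of_int e / 2 < 1/2"
    using fund_domainD(3,4)[OF x] by simp_all
  then have "u = 0" using e_cases by auto
  then show ?thesis by (simp add: uv v)
qed

text \<open>If the lattices of two rounds have the same point, then they are homothetic, and the ratio \<open>\<kappa>\<close>
  generates the quotient of the two ideals. It is integral at \<open>\<pp>\<close> since it maps
  \<open>p\<^sup>2\<^sup>i\<close> into \<open>\<pp>\<^sup>2\<^sup>j\<close>, and at the conjugate of \<open>\<pp>\<close> since it maps an element prime to that conjugate
  into the order.\<close>

lemma equal_points_imp_principal:
  assumes bi: "basis_at i M x" and bj: "basis_at j M' x" and ij: "i < j"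
  obtains \<kappa> where "\<kappa> \<in> ideal_power (j - i)" "\<kappa> * cnj \<kappa> = of_nat p ^ (2 * (j - i))"
proof -
  obtain q r s t where b: "basis_coords i M x q r s t" using bi by (auto simp: basis_at_def)
  obtain q' r' s' t' where b': "basis_coords j M' x q' r' s' t'" using bj by (auto simp: basis_at_def)
  note F = basis_coords_facts[OF b] and F' = basis_coords_facts[OF b']
  define \<beta> \<beta>' where "\<beta> = row_value s t" and "\<beta>' = row_value s' t'"
  have nz: "\<beta> \<noteq> 0" "\<beta>' \<noteq> 0" unfolding \<beta>_def \<beta>'_def by (rule F(3), rule F'(3))
  define \<kappa> where "\<kappa> = \<beta>' / \<beta>"
  have j_split: "2 * (j - i) + 2 * i = 2 * j" using ij by simp
  have scale: "\<kappa> * u \<in> ideal_power j" if ui: "u \<in> ideal_power i" for u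
  proof -
    obtain m n where mn: "u = of_int m * row_value q r + of_int n * row_value s t"
      using ui basis_coords_span[OF b] by blast
    have u: "u = (of_int m * x + of_int n) * \<beta>"
      unfolding mn F(4) \<beta>_def by (simp add: algebra_simps)
    have "\<kappa> * u = (of_int m * x + of_int n) * \<beta>'" unfolding u using nz(1) by (simp add: \<kappa>_def)
    also have "\<dots> = of_int m * row_value q' r' + of_int n * row_value s' t'"
      unfolding F'(4) \<beta>'_def by (simp add: algebra_simps)
    finally show ?thesis using basis_coords_span[OF b'] by blast
  qed
  have u0: "\<kappa> * of_nat p ^ (2 * i) \<in> ideal_power j" by (rule scale[OF ideal_power_p])
  obtain g where g: "g \<in> ideal_power i" "1 / cnj g \<in> Z" "g \<noteq> 0" by (rule ideal_power_conjugate_unit)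
  have "cnj (\<kappa> * g) * (1 / cnj g) \<in> Z"
    by (rule Z_mult[OF quad_order_Z[OF quad_order_cnj[OF ideal_power_order[OF scale[OF g(1)]]]] g(2)])
  then have cZ: "cnj \<kappa> \<in> Z" using g(3) by simp
  have eq: "\<kappa> = \<kappa> * of_nat p ^ (2 * i) / of_nat p ^ (2 * i)" by simp
  have "\<kappa> * of_nat p ^ (2 * i) / of_nat p ^ (2 * i) \<in> quad_order"
  proof (rule divisible_by_power[OF ideal_power_order[OF u0]])
    show "\<kappa> * of_nat p ^ (2 * i) / of_nat p ^ (2 * i) \<in> Z"
      by (rule Z_div_power_le[OF ideal_power_div[OF u0]]) (use ij in simp)
    show "cnj (\<kappa> * of_nat p ^ (2 * i)) / of_nat p ^ (2 * i) \<in> Z" using cZ by simp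
  qed
  then have lo: "\<kappa> \<in> quad_order" by simp
  have "\<kappa> / of_nat p ^ (2 * (j - i)) = \<kappa> * of_nat p ^ (2 * i) / of_nat p ^ (2 * j)"
  proof -
    have "(of_nat p :: complex) ^ (2 * j) = of_nat p ^ (2 * (j - i)) * of_nat p ^ (2 * i)"
      unfolding power_add[symmetric] j_split ..
    then show ?thesis by simp
  qed
  then have 1: "\<kappa> \<in> ideal_power (j - i)"
    using lo ideal_power_div[OF u0] by (simp add: ideal_power_def)
  have "Im x * (cmod \<beta>)^2 = real p ^ (2 * i) * Im \<theta>" "Im x * (cmod \<beta>')^2 = real p ^ (2 * j) * Im \<theta>"
    unfolding \<beta>_def \<beta>'_def by (rule F(7), rule F'(7))
  moreover have "real p ^ (2 * j) = real p ^ (2 * (j - i)) * real p ^ (2 * i)"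
    unfolding power_add[symmetric] j_split ..
  ultimately have "Im x * (cmod \<beta>')^2 = real p ^ (2 * (j - i)) * (Im x * (cmod \<beta>)^2)" by simp
  then have "Im x * (cmod \<beta>')^2 = Im x * (real p ^ (2 * (j - i)) * (cmod \<beta>)^2)" by (simp only: mult_ac)
  then have "(cmod \<beta>')^2 = real p ^ (2 * (j - i)) * (cmod \<beta>)^2"
    using F(8) by (simp only: mult_cancel_left) simp
  then have "(cmod \<kappa>)^2 = real p ^ (2 * (j - i))"
    using nz(1) by (simp add: \<kappa>_def norm_divide power_divide)
  then have "\<kappa> * cnj \<kappa> = of_nat p ^ (2 * (j - i))"
    unfolding complex_norm_square[symmetric] by simp
  with 1 show ?thesis by (rule that)
qed

text \<open>In the fundamental domain the imaginary part is at least \<open>1/2\<close> and the real part at most \<open>1/2\<close> in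
  absolute value, which bounds the coefficients \<open>A\<close> and \<open>B\<close> of the norm forms.\<close>

lemma finite_basis_points: "finite {x \<in> fund_domain. \<exists>k M. basis_at k M x}"
proof -
  define K where "K = \<lceil>2 * Im \<theta>\<rceil>"
  define pt where "pt = (\<lambda>(A :: int, B :: int). Complex (of_int B / (2 * of_int A)) (Im \<theta> / of_int A))"
  have "x \<in> pt ` ({- K..K} \<times> {- K..K})" if x: "x \<in> fund_domain" and b: "basis_at k M x" for x k M
  proof -
    obtain A B :: int where AB: "A > 0" "Re x = of_int B / (2 * of_int A)" "Im x = Im \<theta> / of_int A"
      using basis_at_norm_form[OF b] .
    note D = fund_domainD[OF x]
    have "(1/2)^2 \<le> (Im x)^2"
    proof -
      have "\<bar>Re x\<bar> \<le> 1/2" using D by auto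
      then have "\<bar>Re x\<bar>^2 \<le> (1/2)^2" by (intro power_mono) auto
      then show ?thesis using D(2) by (simp add: power2_eq_square)
    qed
    then have "1/2 \<le> Im x" by (rule power2_le_imp_le) (use D(1) in simp)
    then have "of_int A \<le> 2 * Im \<theta>" using AB by (simp add: le_divide_eq)
    then have A: "A \<le> K" unfolding K_def by linarith
    have "\<bar>Re x\<bar> \<le> 1/2" using D by auto
    then have "\<bar>real_of_int B\<bar> / (2 * of_int A) \<le> 1/2" using AB by (simp add: abs_mult)
    then have "\<bar>real_of_int B\<bar> \<le> of_int A" using AB(1) by (simp add: divide_le_eq)
    then have B: "\<bar>B\<bar> \<le> A" by linarith
    have "x = pt (A, B)" by (simp add: pt_def complex_eq_iff AB)
    moreover have "(A, B) \<in> {- K..K} \<times> {- K..K}" using A B AB(1) by auto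
    ultimately show ?thesis by (rule image_eqI)
  qed
  then have "{x \<in> fund_domain. \<exists>k M. basis_at k M x} \<subseteq> pt ` ({- K..K} \<times> {- K..K})" by blast
  then show ?thesis by (rule finite_subset) simp
qed

text \<open>Two rounds with the same point exist by finiteness. There is no preperiod because the homothety
  between their lattices makes a power of \<open>\<pp>\<^sup>2\<close> principal, and this leads back to \<open>\<theta>\<close>.\<close>

theorem cf_purely_periodic:
  assumes df: "cf_defined p Z \<theta>"
  shows "purely_periodic p Z \<theta>"
proof -
  \<comment> \<open>The start \<open>x\<^sub>1 = \<theta>\<close> is left out, since only later points are known to be reduced.\<close>
  define f where "f = (\<lambda>k. cf_x p Z \<theta> (Suc (Suc k)))"
  have "range f \<subseteq> {x \<in> fund_domain. \<exists>k M. basis_at k M x}"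
    using cf_x_in_fund_domain[OF df] cf_x_basis[OF df] unfolding f_def by blast
  then have "finite (range f)" using finite_basis_points finite_subset by blast
  then have "\<not> inj f" using finite_imageD[of f UNIV] infinite_UNIV_nat by blast
  then obtain i j where "i < j" "f i = f j"
    unfolding inj_def by (metis linorder_neqE_nat)
  then have ij: "Suc i < Suc j" and eq: "cf_x p Z \<theta> (Suc (Suc i)) = cf_x p Z \<theta> (Suc (Suc j))"
    by (simp_all add: f_def)
  obtain n where n: "Suc j - Suc i = Suc n" using ij by (metis Suc_diff_Suc)
  obtain \<kappa> where "\<kappa> \<in> ideal_power (Suc n)" "\<kappa> * cnj \<kappa> = of_nat p ^ (2 * Suc n)"
    using equal_points_imp_principal[OF cf_x_basis[OF df] cf_x_basis[OF df, of "Suc j", folded eq] ij]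
    unfolding n .
  from principal_imp_theta[OF this cf_x_basis[OF df] cf_x_in_fund_domain[OF df]]
  have "cf_x p Z \<theta> (Suc (Suc n)) = \<theta>" .
  then show ?thesis unfolding purely_periodic_def
    by (intro exI[of _ "Suc n"]) (simp add: cf_x_1)
qed

end


section \<open>Solutions of the Pell-like equation\<close>

context split_order
begin

text \<open>A common prime factor of the coordinates divides the norm, hence is \<open>p\<close>.\<close>

lemma coprime_coords:
  assumes v: "v = of_int x + of_int y * \<theta>" and norm: "v * cnj v = of_nat p ^ m"
    and nd: "v / of_nat p \<notin> quad_order"
  shows "coprime x y"
proof (rule ccontr)
  assume nc: "\<not> coprime x y"
  have "(of_int (nrm x y) :: complex) = of_int (int p ^ m)"
    using norm unfolding v coords_norm by simp
  then have n: "nrm x y = int p ^ m" by (simp only: of_int_eq_iff)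
  have "gcd x y \<noteq> 0"
  proof
    assume "gcd x y = 0"
    then have "nrm x y = 0" by (simp add: nrm_def)
    then show False by (simp add: n)
  qed
  moreover have "\<not> is_unit (gcd x y)" using nc by (simp add: coprime_iff_gcd_eq_1)
  ultimately obtain l where l: "l dvd gcd x y" "Factorial_Ring.prime l"
    using prime_divisor_exists by blast
  then obtain x' y' where xy: "x = l * x'" "y = l * y'" by (auto elim!: dvdE)
  have "l dvd nrm x y"
    unfolding nrm_def power2_eq_square xy(1,2) by (simp add: mult.assoc)
  then have "l dvd int p" unfolding n using l(2) prime_dvd_power by blast
  then have "l = int p" using l(2) prime_int_p primes_dvd_imp_eq by blast
  then have "v / of_nat p = of_int x' + of_int y' * \<theta>"
    by (simp add: v xy field_simps)
  then show False using nd quad_order_coords by metis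
qed

text \<open>At a period the point is \<open>\<theta>\<close> again, and the second basis vector generates the ideal; its
  conjugate is a unit at \<open>\<pp>\<close>, as it divides an element prime to the conjugate of \<open>\<pp>\<close>.\<close>

lemma period_generator:
  assumes b: "basis_coords k M \<theta> q r s t"
  shows "row_value s t \<in> ideal_power k" "row_value s t * cnj (row_value s t) = of_nat p ^ (2 * k)"
    "1 / cnj (row_value s t) \<in> Z" "coprime s t"
proof -
  define \<beta> where "\<beta> = row_value s t"
  note F = basis_coords_facts[OF b]
  have bI: "\<beta> \<in> ideal_power k" and b0: "\<beta> \<noteq> 0" unfolding \<beta>_def by (rule F(2), rule F(3))
  have "Im \<theta> * (cmod \<beta>)^2 = Im \<theta> * real p ^ (2 * k)"
    unfolding \<beta>_def F(7) by simp
  then have "(cmod \<beta>)^2 = real p ^ (2 * k)" using Im_theta by simp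
  then have norm: "\<beta> * cnj \<beta> = of_nat p ^ (2 * k)"
    unfolding complex_norm_square[symmetric] by simp
  obtain g where g: "g \<in> ideal_power k" "1 / cnj g \<in> Z" "g \<noteq> 0"
    by (rule ideal_power_conjugate_unit)
  have gb: "g / \<beta> \<in> quad_order" by (rule generator_of_norm[OF bI norm g(1)])
  have "cnj (g / \<beta>) * (1 / cnj g) \<in> Z" by (intro Z_mult g(2) quad_order_Z quad_order_cnj gb)
  also have "cnj (g / \<beta>) * (1 / cnj g) = 1 / cnj \<beta>" using g(3) by simp
  finally have unit: "1 / cnj \<beta> \<in> Z" .
  have "\<beta> = of_int t + of_int s * \<theta>" by (simp add: \<beta>_def row_value_def add.commute)
  then have "coprime t s"
  proof (rule coprime_coords[OF _ norm])
    show "\<beta> / of_nat p \<notin> quad_order"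
    proof
      assume "\<beta> / of_nat p \<in> quad_order"
      then have "cnj (\<beta> / of_nat p) * (1 / cnj \<beta>) \<in> Z"
        by (intro Z_mult unit quad_order_Z quad_order_cnj)
      then show False using b0 Z_inverse_p by simp
    qed
  qed
  then show "coprime s t" by (simp add: coprime_commute)
  show "row_value s t \<in> ideal_power k" "row_value s t * cnj (row_value s t) = of_nat p ^ (2 * k)"
    "1 / cnj (row_value s t) \<in> Z"
    using bI norm unit by (simp_all only: \<beta>_def)
qed

lemma cf_period_props:
  assumes df: "cf_defined p Z \<theta>"
  shows "cf_period p Z \<theta> \<ge> 1" "cf_x p Z \<theta> (Suc (cf_period p Z \<theta>)) = \<theta>"
    "cf_x p Z \<theta> (Suc n) = \<theta> \<Longrightarrow> cf_period p Z \<theta> dvd n"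
proof -
  define N where "N = cf_period p Z \<theta>"
  define f where "f = cf_next p Z"
  have xf: "cf_x p Z \<theta> (Suc n) = (f ^^ n) \<theta>" for n by (simp add: cf_x_def f_def)
  have N: "N = (LEAST N. N \<ge> 1 \<and> (f ^^ N) \<theta> = \<theta>)"
    unfolding N_def cf_period_def by (simp add: xf)
  have "\<exists>N\<ge>1. (f ^^ N) \<theta> = \<theta>"
    using cf_purely_periodic[OF df] unfolding purely_periodic_def by (simp add: xf)
  then have "N \<ge> 1 \<and> (f ^^ N) \<theta> = \<theta>" unfolding N by (rule LeastI_ex)
  then have N1: "N \<ge> 1" and fN: "(f ^^ N) \<theta> = \<theta>" by blast+
  show "cf_period p Z \<theta> \<ge> 1" "cf_x p Z \<theta> (Suc (cf_period p Z \<theta>)) = \<theta>"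
    using N1 fN by (simp_all add: xf N_def)
  assume "cf_x p Z \<theta> (Suc n) = \<theta>"
  then have "(f ^^ (n mod N)) \<theta> = \<theta>" using funpow_mod_eq[OF fN, of n] by (simp add: xf)
  moreover have "n mod N < N" using N1 by simp
  ultimately have "\<not> n mod N \<ge> 1" using not_less_Least[of "n mod N" "\<lambda>N. N \<ge> 1 \<and> (f ^^ N) \<theta> = \<theta>"] N by blast
  then have "n mod N = 0" by simp
  then show "cf_period p Z \<theta> dvd n" unfolding N_def by (rule mod_0_imp_dvd)
qed

text \<open>A solution is coprime to \<open>\<pp>\<close> or to its conjugate, so it or its conjugate generates
  \<open>\<pp>\<^sup>2\<^sup>\<nu>\<close>. The expansion then returns to \<open>\<theta>\<close> after \<open>\<nu>\<close> rounds, so \<open>\<nu>\<close> is a multiple \<open>r N\<close> of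
  the period, and the solution differs by a unit from the \<open>r\<close>-th power of the generator found
  at the period.\<close>

theorem pell_solutions:
  assumes df: "cf_defined p Z \<theta>" and N_def: "N = cf_period p Z \<theta>"
  obtains s t :: int where "of_int s = of_nat p ^ N * matrix_inv (cf_B p Z \<theta> N) $ 2 $ 1"
    "of_int t = of_nat p ^ N * matrix_inv (cf_B p Z \<theta> N) $ 2 $ 2" "coprime s t"
    "{(of_int x + of_int y * \<theta>, \<nu>) | x y \<nu>. coprime x y \<and> nrm x y = int p ^ (2 * \<nu>)}
      = {(\<zeta> * b ^ r, r * N) | \<zeta> b r. \<zeta> \<in> quad_order \<and> \<zeta> * cnj \<zeta> = 1
           \<and> (b = row_value s t \<or> b = cnj (row_value s t))}"
proof -
  note per = cf_period_props[OF df, folded N_def]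
  obtain q r0 s t where b: "basis_coords N (matrix_inv (cf_B p Z \<theta> N)) \<theta> q r0 s t"
    using cf_x_basis[OF df, of N] unfolding per(2) basis_at_def by blast
  define \<beta> where "\<beta> = row_value s t"
  note G = period_generator[OF b, folded \<beta>_def]
  have bo: "\<beta> \<in> quad_order" by (rule ideal_power_order[OF G(1)])
  have norm_power: "\<beta> ^ r * cnj (\<beta> ^ r) = of_nat p ^ (2 * (r * N))" for r
  proof -
    have "\<beta> ^ r * cnj (\<beta> ^ r) = (\<beta> * cnj \<beta>) ^ r" by (simp add: power_mult_distrib)
    also have "\<dots> = of_nat p ^ (2 * (r * N))" unfolding G(2) power_mult[symmetric] by (simp add: mult_ac)
    finally show ?thesis .
  qed
  have power_mem: "\<beta> ^ r \<in> ideal_power (r * N)" for r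
  proof -
    have "(\<beta> / of_nat p ^ (2 * N)) ^ r \<in> Z" by (rule Z_power[OF ideal_power_div[OF G(1)]])
    also have "(\<beta> / of_nat p ^ (2 * N)) ^ r = \<beta> ^ r / of_nat p ^ (2 * (r * N))"
      unfolding power_divide power_mult[symmetric] by (simp add: mult_ac)
    finally show ?thesis using quad_order_power[OF bo] by (simp add: ideal_power_def)
  qed
  have gen: "\<exists>\<zeta> r. \<nu> = r * N \<and> w = \<zeta> * \<beta> ^ r \<and> \<zeta> \<in> quad_order \<and> \<zeta> * cnj \<zeta> = 1"
    if w: "w \<in> ideal_power \<nu>" "w * cnj w = of_nat p ^ (2 * \<nu>)" for w \<nu>
  proof -
    have "cf_x p Z \<theta> (Suc \<nu>) = \<theta>"
    proof (cases \<nu>)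
      case (Suc n)
      show ?thesis
        using principal_imp_theta[OF w cf_x_basis[OF df]] cf_x_in_fund_domain[OF df, of n] Suc by simp
    qed (simp add: cf_x_1)
    then have "N dvd \<nu>" by (rule per(3))
    then obtain r where "\<nu> = N * r" by (rule dvdE)
    then have r: "\<nu> = r * N" by simp
    define \<zeta> where "\<zeta> = w / \<beta> ^ r"
    have "\<beta> ^ r * cnj (\<beta> ^ r) \<noteq> 0" unfolding norm_power by simp
    then have nz: "\<beta> ^ r \<noteq> 0" by (intro notI) simp
    have "\<zeta> \<in> quad_order"
      unfolding \<zeta>_def by (rule generator_of_norm[OF power_mem norm_power]) (use w(1) r in simp)
    moreover have "w = \<zeta> * \<beta> ^ r" using nz by (simp add: \<zeta>_def)
    moreover have "\<zeta> * cnj \<zeta> = (w * cnj w) / (\<beta> ^ r * cnj (\<beta> ^ r))" by (simp add: \<zeta>_def)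
    then have "\<zeta> * cnj \<zeta> = 1" unfolding w(2) norm_power r by simp
    ultimately show ?thesis using r by blast
  qed
  show ?thesis
  proof (rule that[of s t])
    have pN: "(of_nat p :: rat) ^ N \<noteq> 0" by simp
    have M: "matrix_inv (cf_B p Z \<theta> N) = scaled_mat N q r0 s t"
      using b by (simp only: basis_coords_def)
    show "of_int s = of_nat p ^ N * matrix_inv (cf_B p Z \<theta> N) $ 2 $ 1"
      "of_int t = of_nat p ^ N * matrix_inv (cf_B p Z \<theta> N) $ 2 $ 2"
      unfolding M scaled_mat_def mat2_nth using pN by simp_all
    show "coprime s t" by (rule G(4))
    show "{(of_int x + of_int y * \<theta>, \<nu>) | x y \<nu>. coprime x y \<and> nrm x y = int p ^ (2 * \<nu>)}
      = {(\<zeta> * b ^ r, r * N) | \<zeta> b r. \<zeta> \<in> quad_order \<and> \<zeta> * cnj \<zeta> = 1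
           \<and> (b = row_value s t \<or> b = cnj (row_value s t))}" (is "?L = ?R")
    proof
      show "?L \<subseteq> ?R"
      proof
        fix v assume "v \<in> ?L"
        then obtain x y \<nu> where v: "v = (of_int x + of_int y * \<theta>, \<nu>)" and cop: "coprime x y"
          and nr: "nrm x y = int p ^ (2 * \<nu>)" by blast
        define w where "w = of_int x + of_int y * \<theta>"
        have wo: "w \<in> quad_order" unfolding w_def by (rule quad_order_coords)
        have wn: "w * cnj w = of_nat p ^ (2 * \<nu>)" unfolding w_def coords_norm nr by simp
        then have w0: "w \<noteq> 0" by auto
        have "w / of_nat p \<notin> Z \<or> cnj w / of_nat p \<notin> Z"
        proof (rule ccontr)
          assume "\<not> ?thesis"
          then have "w / of_nat p ^ 1 \<in> quad_order"
            by (intro divisible_by_power wo) simp_all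
          then obtain x' y' where "w / of_nat p = of_int x' + of_int y' * \<theta>"
            by (auto simp: quad_order_def)
          then have "w = of_nat p * (of_int x' + of_int y' * \<theta>)"
            by (simp add: divide_eq_eq mult.commute)
          then have "of_int x + of_int y * \<theta> = of_int (int p * x') + of_int (int p * y') * \<theta>"
            by (simp add: w_def algebra_simps)
          then have "int p dvd x" "int p dvd y" by (simp_all only: coords_eq_iff) simp_all
          then have "is_unit (int p)" using cop coprime_common_divisor by blast
          then show False using prime_int_p not_prime_unit by blast
        qed
        then have "w \<in> ideal_power \<nu> \<or> cnj w \<in> ideal_power \<nu>"
        proof
          assume "w / of_nat p \<notin> Z"
          then have "1 / w \<in> Z" by (rule Z_unit[OF wo])
          also have "1 / w = cnj w / of_nat p ^ (2 * \<nu>)"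
            unfolding wn[symmetric] using w0 by simp
          finally show ?thesis using quad_order_cnj[OF wo] by (simp add: ideal_power_def)
        next
          assume "cnj w / of_nat p \<notin> Z"
          then have "1 / cnj w \<in> Z" by (rule Z_unit[OF quad_order_cnj[OF wo]])
          also have "1 / cnj w = w / of_nat p ^ (2 * \<nu>)"
            unfolding wn[symmetric] using w0 by simp
          finally show ?thesis using wo by (simp add: ideal_power_def)
        qed
        then have "\<exists>\<zeta> b r. w = \<zeta> * b ^ r \<and> \<nu> = r * N \<and> \<zeta> \<in> quad_order \<and> \<zeta> * cnj \<zeta> = 1
           \<and> (b = \<beta> \<or> b = cnj \<beta>)"
        proof
          assume "w \<in> ideal_power \<nu>"
          from gen[OF this wn] show ?thesis by blast
        next
          assume c: "cnj w \<in> ideal_power \<nu>"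
          have "cnj w * cnj (cnj w) = of_nat p ^ (2 * \<nu>)" using wn by (simp add: mult.commute)
          from gen[OF c this] obtain \<zeta> r where z: "\<nu> = r * N" "cnj w = \<zeta> * \<beta> ^ r" "\<zeta> \<in> quad_order"
            "\<zeta> * cnj \<zeta> = 1" by blast
          have "w = cnj \<zeta> * (cnj \<beta>) ^ r" using arg_cong[OF z(2), of cnj] by simp
          moreover have "cnj \<zeta> * cnj (cnj \<zeta>) = 1" using z(4) by (simp add: mult.commute)
          ultimately show ?thesis using z(1) quad_order_cnj[OF z(3)] by blast
        qed
        then show "v \<in> ?R" unfolding v w_def[symmetric] \<beta>_def by blast
      qed
    next
      show "?R \<subseteq> ?L"
      proof
        fix u assume "u \<in> ?R"
        then obtain \<zeta> b r where u: "u = (\<zeta> * b ^ r, r * N)" and z: "\<zeta> \<in> quad_order" "\<zeta> * cnj \<zeta> = 1"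
          and bb: "b = \<beta> \<or> b = cnj \<beta>" unfolding \<beta>_def by blast
        define v where "v = \<zeta> * b ^ r"
        have bord: "b \<in> quad_order" using bb bo quad_order_cnj by blast
        have vo: "v \<in> quad_order" unfolding v_def by (intro quad_order_mult quad_order_power z bord)
        have "b ^ r * cnj (b ^ r) = of_nat p ^ (2 * (r * N))"
          using bb norm_power[of r] by (auto simp: mult.commute)
        moreover have "v * cnj v = (\<zeta> * cnj \<zeta>) * (b ^ r * cnj (b ^ r))" by (simp add: v_def mult_ac)
        ultimately have vn: "v * cnj v = of_nat p ^ (2 * (r * N))" using z(2) by simp
        have z0: "\<zeta> \<noteq> 0" "cnj \<zeta> = 1 / \<zeta>" using z(2) by (auto simp: eq_divide_eq mult.commute)
        have b0: "\<beta> \<noteq> 0" using G(2) by auto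
        have nd: "v / of_nat p \<notin> quad_order"
        proof
          assume d: "v / of_nat p \<in> quad_order"
          have cU: "(1 / cnj \<beta>) ^ r \<in> Z" by (rule Z_power[OF G(3)])
          from bb show False
          proof
            assume bb: "b = \<beta>"
            have "cnj (v / of_nat p) * (\<zeta> * (1 / cnj \<beta>) ^ r) \<in> Z"
              by (intro Z_mult cU quad_order_Z quad_order_cnj d z(1))
            also have "cnj (v / of_nat p) * (\<zeta> * (1 / cnj \<beta>) ^ r) = 1 / of_nat p"
              using z0 b0 by (simp add: v_def bb power_divide)
            finally show False using Z_inverse_p by simp
          next
            assume bb: "b = cnj \<beta>"
            have "v / of_nat p * (cnj \<zeta> * (1 / cnj \<beta>) ^ r) \<in> Z"
              by (intro Z_mult cU quad_order_Z quad_order_cnj d z(1))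
            also have "v / of_nat p * (cnj \<zeta> * (1 / cnj \<beta>) ^ r) = 1 / of_nat p"
              using z0 b0 by (simp add: v_def bb power_divide)
            finally show False using Z_inverse_p by simp
          qed
        qed
        obtain x y where xy: "v = of_int x + of_int y * \<theta>" using vo by (auto simp: quad_order_def)
        have "coprime x y" by (rule coprime_coords[OF xy vn nd])
        moreover have "(of_int (nrm x y) :: complex) = of_int (int p ^ (2 * (r * N)))"
          using vn unfolding xy coords_norm by simp
        then have "nrm x y = int p ^ (2 * (r * N))" by (simp only: of_int_eq_iff)
        ultimately show "u \<in> ?L" unfolding u v_def[symmetric] xy by blast
      qed
    qed
  qed
qed

text \<open>A unit \<open>\<zeta>\<close> of norm \<open>1\<close> satisfies \<open>\<zeta>\<^sup>2 = T \<zeta> - 1\<close> with an integral trace \<open>T\<close>, and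
  \<open>|T| \<le> 2\<close> because \<open>\<zeta>\<close> lies on the unit circle. The exponent is the least common multiple of the
  orders \<open>1, 2, 3, 4, 6\<close> that are left.\<close>

lemma unit_is_root_of_unity:
  assumes z: "\<zeta> \<in> quad_order" "\<zeta> * cnj \<zeta> = 1"
  shows "\<zeta> ^ 12 = 1"
proof -
  obtain x y where xy: "\<zeta> = of_int x + of_int y * \<theta>" using z(1) by (auto simp: quad_order_def)
  define T where "T = 2 * x - e * y"
  have "\<zeta> + cnj \<zeta> = of_int T" unfolding xy cnj_coords by (simp add: T_def)
  then have cz: "cnj \<zeta> = of_int T - \<zeta>" by (simp add: algebra_simps)
  have sq: "\<zeta> * \<zeta> = of_int T * \<zeta> - 1"
    using z(2) unfolding cz by (simp add: algebra_simps)
  have "cmod \<zeta> = 1"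
  proof -
    have "(cmod \<zeta>)^2 = 1" using arg_cong[OF z(2)[folded complex_norm_square], of Re] by simp
    then have "cmod \<zeta> = 1 \<or> cmod \<zeta> = - 1" by (simp only: power2_eq_1_iff)
    then show ?thesis using norm_ge_zero[of \<zeta>] by linarith
  qed
  then have "\<bar>Re \<zeta>\<bar> \<le> 1" using abs_Re_le_cmod[of \<zeta>] by simp
  moreover have ReT: "2 * Re \<zeta> = of_int T"
    using arg_cong[OF cz, of Re] by simp
  ultimately have "\<bar>real_of_int T\<bar> \<le> 2" by linarith
  then have "\<bar>T\<bar> \<le> 2" by linarith
  then consider "T = 2 \<or> T = - 2" | "T = 0" | "T = 1" | "T = - 1" by linarith
  then show ?thesis
  proof cases
    case 1
    then have "(\<zeta> - of_int (T div 2)) * (\<zeta> - of_int (T div 2)) = 0"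
      using sq by (auto simp: algebra_simps)
    then have "\<zeta> = of_int (T div 2)" by simp
    then show ?thesis using 1 by auto
  next
    case 2
    then have "\<zeta>^2 = - 1" using sq by (simp add: power2_eq_square)
    moreover have "\<zeta> ^ 12 = (\<zeta>^2) ^ 6" by (simp flip: power_mult)
    ultimately show ?thesis by simp
  next
    case 3
    then have s: "\<zeta> * \<zeta> = \<zeta> - 1" using sq by simp
    have "\<zeta>^3 = \<zeta> * \<zeta> * \<zeta>" by (simp add: power3_eq_cube)
    also have "\<dots> = (\<zeta> - 1) * \<zeta>" by (simp only: s)
    also have "\<dots> = \<zeta> * \<zeta> - \<zeta>" by (simp add: left_diff_distrib)
    finally have "\<zeta>^3 = - 1" unfolding s by simp
    moreover have "\<zeta> ^ 12 = (\<zeta>^3) ^ 4" by (simp flip: power_mult)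
    ultimately show ?thesis by simp
  next
    case 4
    then have s: "\<zeta> * \<zeta> = - \<zeta> - 1" using sq by simp
    have "\<zeta>^3 = \<zeta> * \<zeta> * \<zeta>" by (simp add: power3_eq_cube)
    also have "\<dots> = (- \<zeta> - 1) * \<zeta>" by (simp only: s)
    also have "\<dots> = - (\<zeta> * \<zeta>) - \<zeta>" by (simp add: left_diff_distrib)
    finally have "\<zeta>^3 = 1" unfolding s by simp
    moreover have "\<zeta> ^ 12 = (\<zeta>^3) ^ 4" by (simp flip: power_mult)
    ultimately show ?thesis by simp
  qed
qed

end

section \<open>The field generated by the square root of a negative integer\<close>

lemma root_of_unity_in_quad_field_iff:
  assumes d: "d > 0" "squarefree d"
    and so: "split_order (theta d) (theta_linear_coeff d) (theta_norm d) p Z"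
  shows "root_of_unity_in (quad_field d) \<zeta> \<longleftrightarrow>
    \<zeta> \<in> imag_quad.quad_order (theta d) \<and> \<zeta> * cnj \<zeta> = 1"
proof -
  interpret split_order "theta d" "theta_linear_coeff d" "theta_norm d" p Z by (rule so)
  show ?thesis
  proof
    assume "root_of_unity_in (quad_field d) \<zeta>"
    then obtain n where n: "n \<ge> 1" "\<zeta> ^ n = 1" and F: "\<zeta> \<in> quad_field d"
      by (auto simp: root_of_unity_in_def)
    have "algebraic_int (1 :: complex)" by (rule int_imp_algebraic_int) simp
    then have "algebraic_int \<zeta>"
    proof (rule algebraic_int_root)
      show "Polynomial.poly (Polynomial.monom 1 n) \<zeta> = 1" using n(2) by (simp add: poly_monom)
      show "\<forall>i. Polynomial.coeff (Polynomial.monom 1 n :: complex Polynomial.poly) i \<in> \<int>" by (simp add: coeff_monom)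
      show "Polynomial.lead_coeff (Polynomial.monom 1 n :: complex Polynomial.poly) = 1" by (simp add: degree_monom_eq)
      show "Polynomial.degree (Polynomial.monom 1 n :: complex Polynomial.poly) > 0" using n(1) by (simp add: degree_monom_eq)
    qed
    then have "\<zeta> \<in> quad_order" by (rule quad_field_integral[OF d F])
    moreover have "cmod \<zeta> ^ n = 1" using n(2) by (simp flip: norm_power)
    then have "cmod \<zeta> = 1"
      using n(1) power_eq_imp_eq_base[of "cmod \<zeta>" n 1] by simp
    then have "\<zeta> * cnj \<zeta> = 1" by (simp flip: complex_norm_square)
    ultimately show "\<zeta> \<in> quad_order \<and> \<zeta> * cnj \<zeta> = 1" by simp
  next
    assume "\<zeta> \<in> quad_order \<and> \<zeta> * cnj \<zeta> = 1"
    then have "\<zeta> ^ 12 = 1" "\<zeta> \<in> quad_field d"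
      using unit_is_root_of_unity quad_order_subset_field[OF d(1)] by auto
    then show "root_of_unity_in (quad_field d) \<zeta>"
      unfolding root_of_unity_in_def by (intro conjI exI[of _ 12]) simp_all
  qed
qed

text \<open>The primitive cube root of unity is integral, so it lies in the field only if it lies in the
  order; comparing imaginary parts then gives \<open>d = 3\<close>.\<close>

lemma omega_in_quad_field:
  assumes d: "d > 0" "squarefree d" and om: "Complex (- 1/2) (sqrt 3 / 2) \<in> quad_field d"
  shows "d = 3"
proof -
  interpret imag_quad "theta d" "theta_linear_coeff d" "theta_norm d" by (rule imag_quad_theta[OF d(1)])
  define \<omega> where "\<omega> = Complex (- 1/2) (sqrt 3 / 2)"
  have o: "\<omega> * \<omega> + \<omega> + 1 = 0" by (simp add: \<omega>_def complex_eq_iff)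
  define f where "f = [: 1, 1, 1 :: complex :]"
  have "Polynomial.poly f \<omega> = 0" using o by (simp add: f_def algebra_simps)
  moreover have "Polynomial.lead_coeff f = 1" by (simp add: f_def)
  moreover have "\<forall>i. Polynomial.coeff f i \<in> \<int>" by (auto simp: f_def coeff_pCons split: nat.splits)
  ultimately have "algebraic_int \<omega>" by (intro algebraic_int.intros)
  then have "\<omega> \<in> quad_order" using om unfolding \<omega>_def by (intro quad_field_integral d)
  then obtain x y where xy: "\<omega> = of_int x + of_int y * theta d" by (auto simp: quad_order_def)
  from arg_cong[OF xy, of Im] have im: "sqrt 3 / 2 = of_int y * Im (theta d)" by (simp add: \<omega>_def)
  define j :: int where "j = (if [- d = 1] (mod 4) then y else 2 * y)"
  have "sqrt 3 = of_int j * sqrt (of_int d)"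
    using im by (auto simp: j_def theta_def sqrt_neg_def)
  from arg_cong[OF this, of "\<lambda>u. u^2"] have "(3 :: real) = of_int j ^ 2 * of_int d"
    using d(1) by (simp add: power_mult_distrib)
  then have "real_of_int 3 = of_int (j^2 * d)" by simp
  then have j: "j^2 * d = 3" by (simp only: of_int_eq_iff)
  have "j^2 = 1"
  proof -
    have jle: "\<bar>j\<bar> < 2"
    proof (rule ccontr)
      assume "\<not> \<bar>j\<bar> < 2"
      then have "2^2 \<le> \<bar>j\<bar>^2" by (intro power_mono) auto
      then have "4 \<le> j^2" by simp
      then have "4 * 1 \<le> j^2 * d" using d(1) by (intro mult_mono) auto
      then show False using j by simp
    qed
    moreover have "j \<noteq> 0" using j by auto
    ultimately have "j = 1 \<or> j = - 1" by linarith
    then show ?thesis by auto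
  qed
  then show "d = 3" using j by simp
qed

theorem corollary4p4p2:
  fixes d :: int and p :: nat and \<phi> :: "complex \<Rightarrow> Qp_bar_elem"
  assumes "d > 0" and "squarefree d"
    and "Factorial_Ring.prime p" and "splits_completely p d"
    and "\<phi> \<in> ring_iso complex_ring (Qp_bar p)"
  shows
    "let Z = Zp_in_C p \<phi>; \<theta> = theta d; N = cf_period p Z \<theta> in
       quad_field d \<subseteq> Qp_in_C p \<phi> \<and>
       (d \<noteq> 3 \<longrightarrow> cf_defined p Z \<theta>) \<and>
       (cf_defined p Z \<theta> \<longrightarrow>
         purely_periodic p Z \<theta> \<and>
         (\<exists>s t :: int.
            of_int s = of_nat p ^ N * matrix_inv (cf_B p Z \<theta> N) $ 2 $ 1 \<and>
            of_int t = of_nat p ^ N * matrix_inv (cf_B p Z \<theta> N) $ 2 $ 2 \<and>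
            coprime s t \<and>
            (\<not> [- d = 1] (mod 4) \<longrightarrow>
              {(of_int x + sqrt_neg d * of_int y, \<nu>) | (x :: int) (y :: int) (\<nu> :: nat).
                 coprime x y \<and> x^2 + d * y^2 = int p ^ (2 * \<nu>)}
              = {(\<zeta> * (of_int t + \<sigma> * sqrt_neg d * of_int s) ^ r, r * N) | \<zeta> \<sigma> (r :: nat).
                   root_of_unity_in (quad_field d) \<zeta> \<and> \<sigma> \<in> {1, -1}}) \<and>
            ([- d = 1] (mod 4) \<longrightarrow>
              {(of_int x + (-1 + sqrt_neg d) / 2 * of_int y, \<nu>) | (x :: int) (y :: int) (\<nu> :: nat).
                 coprime x y \<and> 4 * x^2 - 4 * x * y + (1 + d) * y^2 = 4 * int p ^ (2 * \<nu>)}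
              = {(\<zeta> * (of_int t + (-1 + \<sigma> * sqrt_neg d) / 2 * of_int s) ^ r, r * N) | \<zeta> \<sigma> (r :: nat).
                   root_of_unity_in (quad_field d) \<zeta> \<and> \<sigma> \<in> {1, -1}})))"
proof -
  note d = assms(1,2)
  define Z where "Z = Zp_in_C p \<phi>"
  define e c where "e = theta_linear_coeff d" and "c = theta_norm d"
  interpret P: padic_identification p \<phi>
    using assms(3,5) by unfold_locales
  interpret imag_quad "theta d" e c
    unfolding e_def c_def by (rule imag_quad_theta[OF d(1)])
  obtain h where h: "int p dvd h^2 + e * h + c" "\<not> int p dvd 2 * h + e"
    using splits_completely_simple_root[OF d assms(3,4)] unfolding e_def c_def by blast
  have theta_Qp: "theta d \<in> Qp_in_C p \<phi>"
    by (rule P.hensel_quadratic[OF h theta_root])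
  have sqrt_Qp: "sqrt_neg d \<in> Qp_in_C p \<phi>"
  proof (cases "[- d = 1] (mod 4)")
    case True
    then have "sqrt_neg d = of_int 2 * theta d + of_int 1" by (simp add: theta_def)
    then show ?thesis
      using P.Qp_in_C_add[OF P.Qp_in_C_mult[OF P.Qp_in_C_of_int theta_Qp] P.Qp_in_C_of_int] by (simp only:)
  next
    case False
    then show ?thesis using theta_Qp by (simp add: theta_def)
  qed
  have field: "quad_field d \<subseteq> Qp_in_C p \<phi>"
  proof
    fix z assume "z \<in> quad_field d"
    then obtain a b where "z = of_rat a + of_rat b * sqrt_neg d" by (auto simp: quad_field_def)
    then show "z \<in> Qp_in_C p \<phi>"
      using P.Qp_in_C_add[OF P.Qp_in_C_of_rat P.Qp_in_C_mult[OF P.Qp_in_C_of_rat sqrt_Qp]] by (simp only:)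
  qed
  \<comment> \<open>The discriminant of \<open>f = X\<^sup>2 + e X + c\<close> is \<open>f'(h)\<^sup>2 - 4 f(h)\<close>.\<close>
  have unram: "\<not> int p dvd e^2 - 4 * c"
  proof
    assume "int p dvd e^2 - 4 * c"
    moreover have "e^2 - 4 * c = (2 * h + e)^2 - 4 * (h^2 + e * h + c)"
      by (simp add: power2_eq_square algebra_simps)
    moreover have "int p dvd 4 * (h^2 + e * h + c)" by (rule dvd_mult[OF h(1)])
    ultimately have "int p dvd (2 * h + e)^2" by (simp only: dvd_diff_left_iff)
    then have "int p dvd 2 * h + e" using assms(3) prime_dvd_power[of "int p"] by simp
    then show False using h(2) by simp
  qed
  interpret split_order "theta d" e c p Z
  proof unfold_locales
    show "e = 0 \<or> e = 1" by (simp add: e_def theta_linear_coeff_def)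
    fix u v assume uv: "u \<in> quad_order" "v \<in> quad_order"
    have "u \<in> Qp_in_C p \<phi>" "v \<in> Qp_in_C p \<phi>"
      using uv quad_order_subset_field[OF d(1)] field by blast+
    then have "u / v \<in> Qp_in_C p \<phi>" unfolding divide_inverse by (intro P.Qp_in_C_mult P.Qp_in_C_inverse)
    then show "u / v \<in> Z \<or> v / u \<in> Z" unfolding Z_def using P.Zp_valuation[of "u / v"] by simp
  qed (use assms(3) unram P.Zp_in_C_of_int P.Zp_in_C_add P.Zp_in_C_mult P.inverse_p_notin_Zp P.Zp_residue
      in \<open>simp_all add: Z_def\<close>)
  have root: "root_of_unity_in (quad_field d) \<zeta> \<longleftrightarrow> \<zeta> \<in> quad_order \<and> \<zeta> * cnj \<zeta> = 1" for \<zeta>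
    by (rule root_of_unity_in_quad_field_iff[OF d]) (use split_order_axioms in \<open>simp add: e_def c_def\<close>)
  have defined: "cf_defined p Z (theta d)" if "d \<noteq> 3"
  proof (rule cf_defined_if_no_omega)
    fix u v assume uv: "u \<in> quad_order" "v \<in> quad_order" "v \<noteq> 0"
    show "u / v \<noteq> Complex (- 1/2) (sqrt 3 / 2)"
    proof
      assume eq: "u / v = Complex (- 1/2) (sqrt 3 / 2)"
      obtain n where n: "v * cnj v = of_int n" by (rule quad_order_norm[OF uv(2)])
      have "u * cnj v \<in> quad_field d"
        using uv quad_order_subset_field[OF d(1)] quad_order_mult quad_order_cnj by blast
      then obtain a b where ab: "u * cnj v = of_rat a + of_rat b * sqrt_neg d" by (auto simp: quad_field_def)
      have "u / v = u * cnj v / (v * cnj v)" using uv(3) by simp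
      also have "\<dots> = of_rat (a / of_int n) + of_rat (b / of_int n) * sqrt_neg d"
        unfolding n ab by (simp add: add_divide_distrib of_rat_divide)
      finally have "u / v \<in> quad_field d" unfolding quad_field_def by blast
      then show False using omega_in_quad_field[OF d] that unfolding eq by simp
    qed
  qed
  define N where "N = cf_period p Z (theta d)"
  have sols: "\<exists>s t :: int.
            of_int s = of_nat p ^ N * matrix_inv (cf_B p Z (theta d) N) $ 2 $ 1 \<and>
            of_int t = of_nat p ^ N * matrix_inv (cf_B p Z (theta d) N) $ 2 $ 2 \<and>
            coprime s t \<and>
            (\<not> [- d = 1] (mod 4) \<longrightarrow>
              {(of_int x + sqrt_neg d * of_int y, \<nu>) | (x :: int) (y :: int) (\<nu> :: nat).
                 coprime x y \<and> x^2 + d * y^2 = int p ^ (2 * \<nu>)}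
              = {(\<zeta> * (of_int t + \<sigma> * sqrt_neg d * of_int s) ^ r, r * N) | \<zeta> \<sigma> (r :: nat).
                   root_of_unity_in (quad_field d) \<zeta> \<and> \<sigma> \<in> {1, -1}}) \<and>
            ([- d = 1] (mod 4) \<longrightarrow>
              {(of_int x + (-1 + sqrt_neg d) / 2 * of_int y, \<nu>) | (x :: int) (y :: int) (\<nu> :: nat).
                 coprime x y \<and> 4 * x^2 - 4 * x * y + (1 + d) * y^2 = 4 * int p ^ (2 * \<nu>)}
              = {(\<zeta> * (of_int t + (-1 + \<sigma> * sqrt_neg d) / 2 * of_int s) ^ r, r * N) | \<zeta> \<sigma> (r :: nat).
                   root_of_unity_in (quad_field d) \<zeta> \<and> \<sigma> \<in> {1, -1}})"
    if df: "cf_defined p Z (theta d)"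
  proof -
    obtain s t :: int where st: "of_int s = of_nat p ^ N * matrix_inv (cf_B p Z (theta d) N) $ 2 $ 1"
      "of_int t = of_nat p ^ N * matrix_inv (cf_B p Z (theta d) N) $ 2 $ 2" "coprime s t"
      and S: "{(of_int x + of_int y * theta d, \<nu>) | x y \<nu>. coprime x y \<and> nrm x y = int p ^ (2 * \<nu>)}
      = {(\<zeta> * b ^ r, r * N) | \<zeta> b r. \<zeta> \<in> quad_order \<and> \<zeta> * cnj \<zeta> = 1
           \<and> (b = row_value s t \<or> b = cnj (row_value s t))}"
      using pell_solutions[OF df N_def] .
    \<comment> \<open>The sign \<open>\<sigma>\<close> selects the generator or its conjugate.\<close>
    have R: "{(\<zeta> * g \<sigma> ^ r, r * N) | \<zeta> \<sigma> r. root_of_unity_in (quad_field d) \<zeta> \<and> \<sigma> \<in> {1, -1}}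
      = {(\<zeta> * b ^ r, r * N) | \<zeta> b r. \<zeta> \<in> quad_order \<and> \<zeta> * cnj \<zeta> = 1
           \<and> (b = row_value s t \<or> b = cnj (row_value s t))}"
      if g: "g 1 = row_value s t" "g (- 1) = cnj (row_value s t)" for g :: "complex \<Rightarrow> complex"
      unfolding root g(2)[symmetric] unfolding g(1)[symmetric] by blast
    show ?thesis
    proof (rule exI[of _ s], rule exI[of _ t], intro conjI impI st)
      assume n: "\<not> [- d = 1] (mod 4)"
      have th: "theta d = sqrt_neg d" and ec: "e = 0" "c = d"
        using n by (simp_all add: theta_def e_def c_def theta_linear_coeff_def theta_norm_def)
      have nr: "nrm x y = x^2 + d * y^2" for x y
        unfolding nrm_def unfolding ec by simp
      have rv: "row_value s t = of_int s * sqrt_neg d + of_int t"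
        unfolding row_value_def unfolding th ..
      have L: "{(of_int x + sqrt_neg d * of_int y, \<nu>) | (x :: int) (y :: int) (\<nu> :: nat).
                 coprime x y \<and> x^2 + d * y^2 = int p ^ (2 * \<nu>)}
        = {(of_int x + of_int y * theta d, \<nu>) | x y \<nu>. coprime x y \<and> nrm x y = int p ^ (2 * \<nu>)}"
        unfolding nr th by (simp only: mult.commute[of "sqrt_neg d"])
      show "{(of_int x + sqrt_neg d * of_int y, \<nu>) | (x :: int) (y :: int) (\<nu> :: nat).
                 coprime x y \<and> x^2 + d * y^2 = int p ^ (2 * \<nu>)}
              = {(\<zeta> * (of_int t + \<sigma> * sqrt_neg d * of_int s) ^ r, r * N) | \<zeta> \<sigma> (r :: nat).
                   root_of_unity_in (quad_field d) \<zeta> \<and> \<sigma> \<in> {1, -1}}"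
        unfolding L S
        by (rule R[of "\<lambda>\<sigma>. of_int t + \<sigma> * sqrt_neg d * of_int s", symmetric])
          (simp_all add: rv cnj_sqrt_neg mult.commute)
    next
      assume n: "[- d = 1] (mod 4)"
      have th: "theta d = (-1 + sqrt_neg d) / 2" and e: "e = 1" and c: "4 * c = 1 + d"
        using n theta_norm_times_4[OF n] by (simp_all add: theta_def e_def c_def theta_linear_coeff_def)
      have nrm4: "nrm x y = k \<longleftrightarrow> 4 * x^2 - 4 * x * y + (1 + d) * y^2 = 4 * k" for x y k
      proof -
        have "4 * nrm x y = 4 * x^2 - 4 * x * y + (4 * c) * y^2"
          unfolding nrm_def unfolding e by (simp add: algebra_simps)
        then show ?thesis unfolding c by linarith
      qed
      have rv: "row_value s t = of_int s * ((-1 + sqrt_neg d) / 2) + of_int t"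
        unfolding row_value_def unfolding th ..
      have L: "{(of_int x + (-1 + sqrt_neg d) / 2 * of_int y, \<nu>) | (x :: int) (y :: int) (\<nu> :: nat).
                 coprime x y \<and> 4 * x^2 - 4 * x * y + (1 + d) * y^2 = 4 * int p ^ (2 * \<nu>)}
        = {(of_int x + of_int y * theta d, \<nu>) | x y \<nu>. coprime x y \<and> nrm x y = int p ^ (2 * \<nu>)}"
        unfolding nrm4 th by (simp only: mult.commute[of "(-1 + sqrt_neg d) / 2"])
      show "{(of_int x + (-1 + sqrt_neg d) / 2 * of_int y, \<nu>) | (x :: int) (y :: int) (\<nu> :: nat).
                 coprime x y \<and> 4 * x^2 - 4 * x * y + (1 + d) * y^2 = 4 * int p ^ (2 * \<nu>)}
              = {(\<zeta> * (of_int t + (-1 + \<sigma> * sqrt_neg d) / 2 * of_int s) ^ r, r * N) | \<zeta> \<sigma> (r :: nat).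
                   root_of_unity_in (quad_field d) \<zeta> \<and> \<sigma> \<in> {1, -1}}"
        unfolding L S
        by (rule R[of "\<lambda>\<sigma>. of_int t + (-1 + \<sigma> * sqrt_neg d) / 2 * of_int s", symmetric])
          (simp_all add: rv cnj_sqrt_neg mult.commute)
    qed
  qed
  show ?thesis
    unfolding Let_def Z_def[symmetric] N_def[symmetric]
    using field defined sols cf_purely_periodic by blast
qed

end
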